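(* Let $t\in(0,1)$, let $s_0,s_1,s_2,\ldots$ be complex parameters, let $\gamma\neq0$ be a complex number (written $\gamma=t^\alpha$), let $n\ge1$, and let $u_1,\dots,u_{2n}$ satisfy, for some $\varepsilon>0$, $\left|\frac{u_i-s_x}{1-s_xu_i}\right|\le 1-\varepsilon<1$ for all $i$ and all $x\ge 0$. Define $$ \mathcal{P}(u_1,\dots,u_{2n};t,\alpha)=\sum_{\lambda:\ m_i(\lambda)\in2\mathbb{Z}_{\ge0}\ \forall i\ge0} \frac{(\gamma t;t)_{m_0(\lambda)}}{(t;t)_{m_0(\lambda)}}\prod_{j=1}^{m_0(\lambda)/2}\frac{1-s_0^2\gamma t^{2j-2}}{1-\gamma t^{2j}}\prod_{i=1}^\infty\prod_{j=1}^{m_i(\lambda)/2}\frac{1-s_i^2t^{2j-2}}{1-t^{2j}}\prod_{j=1}^{2n}\frac{1-\gamma s_0u_j}{1-s_0u_j}\,\Bigl[F_\lambda(u_1,\dots,u_{2n})\Big|_{s_0\to\gamma s_0}\Bigr], $$ the sum being over signatures $\lambda$ with $2n$ parts all of whose multiplicities (including $m_0(\lambda)$) are even. Then $$ \mathcal{P}(u_1,\dots,u_{2n};t,\alpha)=\prod_{j=1}^{2n}\frac{1}{1-s_0u_j}\prod_{1\le i<j\le 2n}\frac{1-tu_iu_j}{u_i-u_j}\;\mathop{\rm Pf}_{1\le i<j\le 2n}\left[\frac{Z_2(u_i,u_j)(u_i-u_j)}{(1-u_iu_j)(1-tu_iu_j)}\right], $$ where $Z_2(x,y)=(1-t)(1-\gamma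 s_0x)(1-\gamma s_0y)+(1-\gamma)(t-\gamma s_0^2)(1-xy)$.
   Context: A signature with $N$ parts is a sequence of integers $\lambda=(\lambda_1\ge\dots\ge\lambda_N\ge0)$; $m_i(\lambda)$ is the number of parts equal to $i$. $(a;t)_k=(1-a)(1-at)\cdots(1-at^{k-1})$. The spin Hall--Littlewood function is $$F_\lambda(u_1,\dots,u_N)=\sum_{\sigma\in S_N}\sigma\Biggl(\prod_{1\le i<j\le N}\frac{u_i-tu_j}{u_i-u_j}\prod_{i=1}^N\Bigl(\frac{1-t}{1-s_{\lambda_i}u_i}\prod_{j=0}^{\lambda_i-1}\frac{u_i-s_j}{1-s_ju_i}\Bigr)\Biggr),$$ with $\sigma$ permuting the $u_i$; $F_\lambda|_{s_0\to\gamma s_0}$ means the same function with the parameter $s_0$ replaced by $\gamma s_0$. $\mathrm{Pf}$ is the Pfaffian of the antisymmetric matrix with the given upper-triangular entries. (In the paper $\mathcal{P}$ is defined as a partition function of a higher spin vertex model, which equals the displayed weighted sum.) *)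

theory Defs
  imports "HOL-Analysis.Analysis" "HOL-Combinatorics.Permutations"
begin

text \<open>
  Indices are shifted to start at 0: the variables are \<open>u 0, \<dots>, u (N - 1)\<close> (values of \<open>u\<close> at larger
  indices are irrelevant), and a signature with \<open>N\<close> parts is a weakly decreasing list of naturals
  of length \<open>N\<close>.  Then \<open>m\<^sub>i(lam)\<close> is \<open>count_list lam i\<close>.
\<close>

definition signatures :: "nat \<Rightarrow> nat list set" where
  "signatures N = {lam. length lam = N \<and> sorted_wrt (\<ge>) lam}"

definition even_signatures :: "nat \<Rightarrow> nat list set" where
  "even_signatures N = {lam \<in> signatures N. \<forall>i. even (count_list lam i)}"

definition qpoch :: "complex \<Rightarrow> complex \<Rightarrow> nat \<Rightarrow> complex" where
  "qpoch a t k = (\<Prod>i<k. 1 - a * t ^ i)"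

definition spin_HL ::
    "complex \<Rightarrow> (nat \<Rightarrow> complex) \<Rightarrow> nat list \<Rightarrow> (nat \<Rightarrow> complex) \<Rightarrow> complex" where
  "spin_HL t s lam u =
     (\<Sum>\<sigma> | \<sigma> permutes {..<length lam}.
        (\<Prod>j<length lam. \<Prod>i<j. (u (\<sigma> i) - t * u (\<sigma> j)) / (u (\<sigma> i) - u (\<sigma> j))) *
        (\<Prod>i<length lam. (1 - t) / (1 - s (lam ! i) * u (\<sigma> i)) *
           (\<Prod>j<lam ! i. (u (\<sigma> i) - s j) / (1 - s j * u (\<sigma> i)))))"

text \<open>
  In the product over \<open>i \<ge> 1\<close> only those \<open>i\<close> that occur as parts of \<open>lam\<close> contribute a factor
  different from 1.
\<close>

definition P_summand ::
    "complex \<Rightarrow> complex \<Rightarrow> (nat \<Rightarrow> complex) \<Rightarrow> (nat \<Rightarrow> complex) \<Rightarrow> nat list \<Rightarrow> complex" where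
  "P_summand t \<gamma> s u lam =
     qpoch (\<gamma> * t) t (count_list lam 0) / qpoch t t (count_list lam 0) *
     (\<Prod>j = 1..count_list lam 0 div 2.
        (1 - (s 0)\<^sup>2 * \<gamma> * t ^ (2 * j - 2)) / (1 - \<gamma> * t ^ (2 * j))) *
     (\<Prod>i \<in> set lam - {0}. \<Prod>j = 1..count_list lam i div 2.
        (1 - (s i)\<^sup>2 * t ^ (2 * j - 2)) / (1 - t ^ (2 * j))) *
     (\<Prod>j<length lam. (1 - \<gamma> * s 0 * u j) / (1 - s 0 * u j)) *
     spin_HL t (s(0 := \<gamma> * s 0)) lam u"

definition P_fun ::
    "nat \<Rightarrow> complex \<Rightarrow> complex \<Rightarrow> (nat \<Rightarrow> complex) \<Rightarrow> (nat \<Rightarrow> complex) \<Rightarrow> complex" where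
  "P_fun N t \<gamma> s u = (\<Sum>\<^sub>\<infinity>lam \<in> even_signatures N. P_summand t \<gamma> s u lam)"

definition Z2 :: "complex \<Rightarrow> complex \<Rightarrow> complex \<Rightarrow> complex \<Rightarrow> complex \<Rightarrow> complex" where
  "Z2 t \<gamma> s0 x y =
     (1 - t) * (1 - \<gamma> * s0 * x) * (1 - \<gamma> * s0 * y) +
     (1 - \<gamma>) * (t - \<gamma> * s0\<^sup>2) * (1 - x * y)"

definition antisym_matrix :: "(nat \<Rightarrow> nat \<Rightarrow> complex) \<Rightarrow> nat \<Rightarrow> nat \<Rightarrow> complex" where
  "antisym_matrix a i j = (if i < j then a i j else if j < i then - a j i else 0)"

text \<open>
  \<open>pfaffian n a\<close> is the Pfaffian of the antisymmetric matrix of size \<open>2n\<close> whose entries above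
  the diagonal are \<open>a i j\<close> for \<open>i < j < 2n\<close>.
\<close>

definition pfaffian :: "nat \<Rightarrow> (nat \<Rightarrow> nat \<Rightarrow> complex) \<Rightarrow> complex" where
  "pfaffian n a =
     (\<Sum>\<sigma> | \<sigma> permutes {..<2 * n}.
        of_int (sign \<sigma>) * (\<Prod>i<n. antisym_matrix a (\<sigma> (2 * i)) (\<sigma> (2 * i + 1))))
     / (2 ^ n * fact n)"

end

theory Submission
  imports Defs "HOL-Combinatorics.Multiset_Permutations" "HOL-Computational_Algebra.Polynomial"
begin

text \<open>
  After multiplication by \<open>\<Prod>\<^bsub>i<j\<^esub> (1 - t u\<^sub>i u\<^sub>j) / (u\<^sub>i - u\<^sub>j)\<close> the Pfaffian of
  \<open>w(u\<^sub>i, u\<^sub>j) (u\<^sub>i - u\<^sub>j) / (1 - t u\<^sub>i u\<^sub>j)\<close> with \<open>w\<close> symmetric becomes a sum over perfect matchings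
  of the set of variables in which no signs occur.  Call it \<open>npf w\<close>.

  Removing the zero parts of a signature from the sum expresses the series through the \<open>\<gamma> = 1\<close>
  series in the variables \<open>J\<close> (the complement of the set \<open>I\<close> of variables carrying the zero parts)
  with shifted parameters \<open>s \<circ> Suc\<close>.  The theorem then follows from two facts.
  (1) The corresponding splitting identity for \<open>npf\<close>, by induction on the number of variables: as functions
  of one variable both sides are bounded, their poles at \<open>u\<^sub>i = u\<^sub>j\<close> cancel and their residues at
  \<open>u\<^sub>i u\<^sub>j = 1\<close> agree by induction, so their difference is constant.  Moving two variables to
  \<open>\<gamma> s\<^sub>0\<close> and \<open>t \<gamma> s\<^sub>0\<close> reduces both sides to the case \<open>t\<^sup>2 \<gamma>\<close> with two variables
  fewer (on the Pfaffian side by a Schur complement), so the constant is \<open>0\<close>.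
  (2) For \<open>\<gamma> = 1\<close> the sum does not depend on \<open>s\<close>: by (1), the error for \<open>s\<close> is the error for
  \<open>s \<circ> Suc\<close> times a number of modulus at most \<open>1 - \<epsilon>\<close>, and all errors are uniformly bounded.
\<close>

subsection \<open>Normalised Pfaffians\<close>

text \<open>Writing \<open>Z2 x y / (1 - x y)\<close> as a pole part
  \<open>(1 - t) (x - g s) (y - g s) / (1 - x y)\<close> plus the constant
  \<open>(1 - g t) (1 - g s^2)\<close> dictates the choices. The residue at \<open>x y = 1\<close>
  carries exactly the factors \<open>x - g s\<close> and \<open>y - g s\<close> by which variables
  of \<open>J\<close> enter the splitting sum. At \<open>x = g s\<close> the pole part disappears,
  so this row of the Pfaffian is constant and the Schur complement can be computed explicitly.

  No complex analysis is used. Let \<open>Y\<close> be the set of the other variables. With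
  denominators cleared, both sides are polynomials of degree at most \<open>2 |Y|\<close>; their
  difference and the clearing product share the \<open>2 |Y|\<close> zeros \<open>q\<close> and
  \<open>1 / q\<close>, hence are proportional. Distinctness of these zeros is why
  \<open>x y \<noteq> 1\<close> is assumed and why 0 has to stay out of \<open>Y\<close>.

  In (2) the contraction arises because only the term \<open>I = {}\<close> still involves all
  variables. The obstacle is the uniform bound: the parameters may be arbitrarily large, so the
  growth of the coefficients must be absorbed by the denominators of the weights.\<close>

definition phi :: "complex \<Rightarrow> complex \<Rightarrow> complex \<Rightarrow> complex" where
  "phi t x z = (1 - t * x * z) / (x - z)"

text \<open>Under a permutation of the variables the product of \<open>phi\<close> over
  \<open>i < j\<close> picks up the sign of the permutation, which will cancel the sign in the
  Pfaffian.\<close>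

lemma phi_antisym: "phi t y x = - phi t x y"
proof -
  have "phi t y x = (1 - t * x * y) / - (x - y)"
    by (simp add: phi_def mult.assoc mult.commute[of y x])
  then show ?thesis
    unfolding phi_def divide_minus_right .
qed

text \<open>\<open>X\<close> has \<open>2 n\<close> elements.  Each edge \<open>{x, y}\<close> of a matching contributes \<open>w x y\<close>, each pair of
  edges the product of the four \<open>phi\<close> between them; averaging over the first edge makes the
  definition independent of an ordering of \<open>X\<close>.\<close>
fun npf :: "complex \<Rightarrow> (complex \<Rightarrow> complex \<Rightarrow> complex) \<Rightarrow> nat \<Rightarrow> complex set \<Rightarrow> complex" where
  "npf t w 0 X = 1"
| "npf t w (Suc n) X =
     (\<Sum>x\<in>X. \<Sum>y\<in>X - {x}. w x y * (\<Prod>z\<in>X - {x, y}. phi t x z * phi t y z) * npf t w n (X - {x, y}))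
     / (2 * of_nat (Suc n))"

declare npf.simps(2) [simp del]

section \<open>Expansion of a normalised Pfaffian along an arbitrary row\<close>

lemma sum_offdiag_swap:
  fixes f :: "'a \<Rightarrow> 'a \<Rightarrow> 'b::comm_monoid_add"
  assumes "finite A"
  shows "(\<Sum>x\<in>A. \<Sum>y\<in>A - {x}. f x y) = (\<Sum>x\<in>A. \<Sum>y\<in>A - {x}. f y x)"
proof -
  have *: "(\<Sum>x\<in>A. \<Sum>y\<in>A - {x}. g x y) = (\<Sum>x\<in>A. \<Sum>y\<in>A. if x = y then 0 else g x y)" for g :: "'a \<Rightarrow> 'a \<Rightarrow> 'b"
    using assms by (intro sum.cong refl sum.mono_neutral_cong_left) auto
  show ?thesis
    unfolding * by (subst sum.swap) (auto intro!: sum.cong)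
qed

lemma sum_offdiag_antisym:
  fixes f :: "'a \<Rightarrow> 'a \<Rightarrow> complex"
  assumes "finite A" and "\<And>x y. x \<in> A \<Longrightarrow> y \<in> A \<Longrightarrow> x \<noteq> y \<Longrightarrow> f y x = - f x y"
  shows "(\<Sum>x\<in>A. \<Sum>y\<in>A - {x}. f x y) = 0"
proof -
  have "(\<Sum>x\<in>A. \<Sum>y\<in>A - {x}. f x y) = (\<Sum>x\<in>A. \<Sum>y\<in>A - {x}. f y x)"
    by (rule sum_offdiag_swap[OF assms(1)])
  also have "\<dots> = (\<Sum>x\<in>A. \<Sum>y\<in>A - {x}. - f x y)"
    by (intro sum.cong refl assms(2)) auto
  finally show ?thesis
    by (simp add: sum_negf)
qed

definition pair_coeff :: "complex \<Rightarrow> (complex \<Rightarrow> complex \<Rightarrow> complex) \<Rightarrow> complex set \<Rightarrow> complex \<Rightarrow> complex \<Rightarrow> complex" where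
  "pair_coeff t w X x y = w x y * (\<Prod>z\<in>X - {x, y}. phi t x z * phi t y z)"

text \<open>Two edges may be removed in either order: the four \<open>phi\<close> between them
  reappear with reversed arguments, and the four signs cancel.\<close>

lemma pair_coeff_exchange:
  assumes "finite X" "x \<in> X" "y \<in> X" "v \<in> X" "z \<in> X" "distinct [x, y, v, z]"
  shows "pair_coeff t w X x y * pair_coeff t w (X - {x, y}) v z =
    pair_coeff t w X v z * pair_coeff t w (X - {v, z}) x y"
proof -
  define Y where "Y = X - {x, y, v, z}"
  have fin: "finite Y" and nin: "x \<notin> Y" "y \<notin> Y" "v \<notin> Y" "z \<notin> Y"
    using assms by (auto simp: Y_def)
  have "X - {x, y} = insert v (insert z Y)" "X - {x, y} - {v, z} = Y"
    "X - {v, z} = insert x (insert y Y)" "X - {v, z} - {x, y} = Y"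
    using assms by (auto simp: Y_def)
  moreover have "v \<noteq> z" "x \<noteq> y"
    using assms by auto
  ultimately show ?thesis
    using fin nin unfolding pair_coeff_def
    by (simp add: phi_antisym[of t v x] phi_antisym[of t v y] phi_antisym[of t z x] phi_antisym[of t z y])
qed

text \<open>Once all rows of the double sum agree, the averaging in \<open>npf\<close> does nothing:
  there are \<open>2 (n + 1)\<close> equal rows over the denominator
  \<open>2 (n + 1)\<close>.\<close>

lemma npf_Suc_const_rows:
  assumes "card X = 2 * Suc n"
    and "\<And>x. x \<in> X \<Longrightarrow> (\<Sum>y\<in>X - {x}. pair_coeff t w X x y * npf t w n (X - {x, y})) = S"
  shows "npf t w (Suc n) X = S"
proof -
  have "npf t w (Suc n) X = (\<Sum>x\<in>X. S) / (2 * of_nat (Suc n))"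
    using assms(2) by (simp add: npf.simps(2) pair_coeff_def del: of_nat_Suc sum_constant)
  also have "\<dots> = of_nat (2 * Suc n) * S / (2 * of_nat (Suc n))"
    by (simp only: sum_constant assms(1))
  also have "\<dots> = S"
    using of_nat_neq_0[of n] unfolding of_nat_mult of_nat_numeral by (simp del: of_nat_Suc)
  finally show ?thesis .
qed

text \<open>Expand along \<open>x\<close> and then along \<open>v\<close>, or the other way round.
  The term matching \<open>x\<close> with \<open>v\<close> is common to both; in all others
  \<open>y\<close> and \<open>z\<close> are the partners of \<open>x\<close> and \<open>v\<close>,
  and the double sums agree by \<open>pair_coeff_exchange\<close>.\<close>

lemma npf_row_indep:
  assumes sym: "\<And>x y. w x y = w y x"
    and fin: "finite X" and card: "card X = 2 * Suc n" and x: "x \<in> X" and v: "v \<in> X"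
  shows "(\<Sum>y\<in>X - {x}. pair_coeff t w X x y * npf t w n (X - {x, y})) =
    (\<Sum>y\<in>X - {v}. pair_coeff t w X v y * npf t w n (X - {v, y}))"
  using fin card x v
proof (induction n arbitrary: X x v)
  case 0
  show ?case
  proof (cases "x = v")
    case False
    have "{x, v} \<subseteq> X" "card {x, v} = card X"
      using 0 False by auto
    then have "X = {x, v}"
      using card_subset_eq[of X "{x, v}"] 0(1) by auto
    then have "X - {x} = {v}" "X - {v} = {x}"
      using False by auto
    then show ?thesis
      by (simp add: pair_coeff_def sym[of x v] insert_commute mult_ac)
  qed simp
next
  case (Suc n)
  show ?case
  proof (cases "x = v")
    case False
    define A where "A = X - {x, v}"
    have fA: "finite A"
      using Suc.prems by (simp add: A_def)
    have row: "npf t w (Suc n) Y = (\<Sum>y\<in>Y - {a}. pair_coeff t w Y a y * npf t w n (Y - {a, y}))"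
      if Y: "finite Y" "card Y = 2 * Suc n" "a \<in> Y" for Y a
      by (rule npf_Suc_const_rows[OF Y(2)]) (rule Suc.IH[OF Y(1,2) _ Y(3)])
    have expand: "(\<Sum>y\<in>X - {a}. pair_coeff t w X a y * npf t w (Suc n) (X - {a, y})) =
      pair_coeff t w X a b * npf t w (Suc n) (X - {a, b}) +
      (\<Sum>y\<in>A. \<Sum>z\<in>A - {y}. pair_coeff t w X a y * pair_coeff t w (X - {a, y}) b z * npf t w n (X - {a, y} - {b, z}))"
      if ab: "{a, b} = {x, v}" "a \<noteq> b" for a b
    proof -
      have mem: "a \<in> X" "b \<in> X" and A: "A = X - {a, b}"
        using ab Suc.prems by (auto simp: A_def doubleton_eq_iff)
      have "X - {a} = insert b A" "b \<notin> A"
        using ab mem A by auto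
      then have "(\<Sum>y\<in>X - {a}. pair_coeff t w X a y * npf t w (Suc n) (X - {a, y})) =
        pair_coeff t w X a b * npf t w (Suc n) (X - {a, b}) +
        (\<Sum>y\<in>A. pair_coeff t w X a y * npf t w (Suc n) (X - {a, y}))"
        using fA by simp
      moreover have "pair_coeff t w X a y * npf t w (Suc n) (X - {a, y}) =
        (\<Sum>z\<in>A - {y}. pair_coeff t w X a y * pair_coeff t w (X - {a, y}) b z * npf t w n (X - {a, y} - {b, z}))"
        if y: "y \<in> A" for y
      proof -
        have "X - {a, y} - {b} = A - {y}"
          using A by auto
        moreover have "card (X - {a, y}) = 2 * Suc n"
          using y A mem Suc.prems by (auto simp add: card_Diff_subset card_insert_if)
        moreover have "b \<noteq> y"
          using y A by auto
        ultimately show ?thesis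
          using row[of "X - {a, y}" b] y A mem ab(2) Suc.prems(1) by (simp add: sum_distrib_left mult.assoc)
      qed
      ultimately show ?thesis
        by simp
    qed
    have "(\<Sum>y\<in>A. \<Sum>z\<in>A - {y}. pair_coeff t w X x y * pair_coeff t w (X - {x, y}) v z * npf t w n (X - {x, y} - {v, z})) =
      (\<Sum>y\<in>A. \<Sum>z\<in>A - {y}. pair_coeff t w X v z * pair_coeff t w (X - {v, z}) x y * npf t w n (X - {v, z} - {x, y}))"
    proof (intro sum.cong refl)
      fix y z assume yz: "y \<in> A" "z \<in> A - {y}"
      have "X - {x, y} - {v, z} = X - {v, z} - {x, y}"
        by auto
      then show "pair_coeff t w X x y * pair_coeff t w (X - {x, y}) v z * npf t w n (X - {x, y} - {v, z}) =
        pair_coeff t w X v z * pair_coeff t w (X - {v, z}) x y * npf t w n (X - {v, z} - {x, y})"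
        using pair_coeff_exchange[of X x y v z t w] yz False Suc.prems by (auto simp: A_def)
    qed
    also have "\<dots> = (\<Sum>y\<in>A. \<Sum>z\<in>A - {y}. pair_coeff t w X v y * pair_coeff t w (X - {v, y}) x z * npf t w n (X - {v, y} - {x, z}))"
      by (rule sum_offdiag_swap[OF fA])
    finally have main: "(\<Sum>y\<in>A. \<Sum>z\<in>A - {y}. pair_coeff t w X x y * pair_coeff t w (X - {x, y}) v z * npf t w n (X - {x, y} - {v, z})) =
      (\<Sum>y\<in>A. \<Sum>z\<in>A - {y}. pair_coeff t w X v y * pair_coeff t w (X - {v, y}) x z * npf t w n (X - {v, y} - {x, z}))" .
    have "pair_coeff t w X x v = pair_coeff t w X v x" "X - {x, v} = X - {v, x}"
      by (auto simp: pair_coeff_def sym[of x v] insert_commute mult.commute)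
    then show ?thesis
      using False main expand[of x v] expand[of v x] by (metis insert_commute)
  qed simp
qed

lemma npf_insert:
  assumes sym: "\<And>x y. w x y = w y x"
    and Y: "finite Y" "x \<notin> Y" "card Y = 2 * n + 1"
  shows "npf t w (Suc n) (insert x Y) =
    (\<Sum>y\<in>Y. w x y * (\<Prod>z\<in>Y - {y}. phi t x z * phi t y z) * npf t w n (Y - {y}))"
proof -
  let ?X = "insert x Y"
  have c: "card ?X = 2 * Suc n" and fin: "finite ?X"
    using Y by auto
  have "npf t w (Suc n) ?X = (\<Sum>y\<in>?X - {x}. pair_coeff t w ?X x y * npf t w n (?X - {x, y}))"
    by (rule npf_Suc_const_rows[OF c]) (rule npf_row_indep[OF sym fin c], auto)
  moreover have "?X - {x} = Y" "\<And>y. ?X - {x, y} = Y - {y}"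
    using Y by auto
  ultimately show ?thesis
    by (simp add: pair_coeff_def)
qed

text \<open>In Pfaffian terms: the expansion of a matrix in which the row of \<open>q\<close> occurs twice.\<close>
lemma npf_alternating:
  assumes sym: "\<And>x y. w x y = w y x"
    and Y: "finite Y" "q \<notin> Y" "card Y = 2 * n"
  shows "(\<Sum>y\<in>Y. w q y * (\<Prod>z\<in>Y - {y}. phi t y z) * npf t w n (insert q (Y - {y}))) = 0"
proof (cases n)
  case 0
  then show ?thesis
    using Y by simp
next
  case (Suc m)
  let ?f = "\<lambda>y z. w q y * (\<Prod>k\<in>Y - {y}. phi t y k) * (w q z * (\<Prod>k\<in>Y - {y, z}. phi t q k * phi t z k) * npf t w m (Y - {y, z}))"
  have "(\<Sum>y\<in>Y. w q y * (\<Prod>z\<in>Y - {y}. phi t y z) * npf t w n (insert q (Y - {y}))) =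
    (\<Sum>y\<in>Y. \<Sum>z\<in>Y - {y}. ?f y z)"
  proof (intro sum.cong refl)
    fix y assume y: "y \<in> Y"
    have "\<And>z. Y - {y} - {z} = Y - {y, z}"
      by auto
    then show "w q y * (\<Prod>z\<in>Y - {y}. phi t y z) * npf t w n (insert q (Y - {y})) = (\<Sum>z\<in>Y - {y}. ?f y z)"
      using npf_insert[OF sym, of "Y - {y}" q m t] Y y Suc by (simp add: sum_distrib_left)
  qed
  also have "\<dots> = 0"
  proof (rule sum_offdiag_antisym[OF Y(1)])
    fix y z assume yz: "y \<in> Y" "z \<in> Y" "y \<noteq> z"
    have s: "Y - {y} = insert z (Y - {y, z})" "Y - {z} = insert y (Y - {y, z})" "Y - {z, y} = Y - {y, z}"
      using yz by auto
    have "(\<Prod>k\<in>Y - {y}. phi t y k) = phi t y z * (\<Prod>k\<in>Y - {y, z}. phi t y k)"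
      unfolding s(1) using Y yz by simp
    moreover have "(\<Prod>k\<in>Y - {z}. phi t z k) = - phi t y z * (\<Prod>k\<in>Y - {y, z}. phi t z k)"
      unfolding s(2) using Y yz by (simp add: phi_antisym[of t z y])
    ultimately show "?f z y = - ?f y z"
      by (simp add: s(3) prod.distrib)
  qed
  finally show ?thesis .
qed

text \<open>Eliminating the rows of \<open>p\<close> and \<open>q\<close> from a Pfaffian subtracts
  \<open>(a_px a_qy - a_py a_qx) / a_pq\<close> from the entry \<open>a_xy\<close>; the
  \<open>phi\<close> factors in \<open>schur\<close> come from
  \<open>a_xy = w x y / phi t x y\<close>. Instead of transforming matrices, the proof expands along
  one \<open>x\<close>: the two correction terms become alternating sums, which
  \<open>npf_alternating\<close> turns into the terms matching \<open>x\<close> with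
  \<open>p\<close> and with \<open>q\<close>.\<close>

lemma npf_schur_complement:
  assumes sym: "\<And>x y. w x y = w y x" and sym': "\<And>x y. w' x y = w' y x"
    and pq: "p \<noteq> q" "w p q \<noteq> 0"
    and Y: "finite Y" "p \<notin> Y" "q \<notin> Y" "card Y = 2 * n"
    and schur: "\<And>x y. x \<in> Y \<Longrightarrow> y \<in> Y \<Longrightarrow> x \<noteq> y \<Longrightarrow> w p q * w' x y =
      w p q * w x y * (phi t x p * phi t y p * phi t x q * phi t y q) +
      phi t p q * phi t x y * (w p x * w q y * phi t p y * phi t x q - w p y * w q x * phi t p x * phi t y q)"
  shows "npf t w (Suc n) (insert p (insert q Y)) = w p q * npf t w' n Y"
  using Y schur
proof (induction n arbitrary: Y)
  case 0
  then show ?case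
    using npf_insert[OF sym, of "insert q Y" p 0 t] pq by (simp)
next
  case (Suc n)
  obtain x where x: "x \<in> Y"
    using Suc.prems(4) by fastforce
  define V where "V = Y - {x}"
  have V: "finite V" "x \<notin> V" "p \<notin> V" "q \<notin> V" "card V = 2 * n + 1" and Y: "Y = insert x V"
    using Suc.prems x by (auto simp: V_def)
  have xpq: "x \<noteq> p" "x \<noteq> q"
    using Suc.prems x by auto
  let ?N = "\<lambda>y. npf t w (Suc n) (insert p (insert q (V - {y})))"
  let ?P = "\<lambda>y. \<Prod>z\<in>V - {y}. phi t x z * phi t y z"
  have N: "?N y = w p q * npf t w' n (V - {y})" if "y \<in> V" for y
    using that Suc.prems V by (intro Suc.IH) (auto simp: Y)
  \<comment> \<open>This is \<open>npf_alternating\<close> for \<open>insert b V\<close> and the row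
    of \<open>a\<close>, with the term \<open>y = b\<close> moved to the other side.\<close>
  have alt: "(\<Sum>y\<in>V. w a y * phi t b y * (\<Prod>z\<in>V - {y}. phi t y z) * ?N y) =
    w a b * (\<Prod>z\<in>V. phi t b z) * npf t w (Suc n) (insert a V)" if ab: "{a, b} = {p, q}" "a \<noteq> b" for a b
  proof -
    have nin: "a \<notin> V" "b \<notin> V"
      using ab V by (auto simp: doubleton_eq_iff)
    have "(\<Sum>y\<in>insert b V. w a y * (\<Prod>z\<in>insert b V - {y}. phi t y z) * npf t w (Suc n) (insert a (insert b V - {y}))) = 0"
      using nin V ab(2) by (intro npf_alternating[OF sym]) auto
    moreover have "insert b V - {b} = V"
      using nin by auto
    moreover have "w a y * (\<Prod>z\<in>insert b V - {y}. phi t y z) * npf t w (Suc n) (insert a (insert b V - {y})) =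
      - (w a y * phi t b y * (\<Prod>z\<in>V - {y}. phi t y z) * ?N y)" if "y \<in> V" for y
    proof -
      have "insert b V - {y} = insert b (V - {y})"
        using that nin by auto
      moreover have "insert a (insert b (V - {y})) = insert p (insert q (V - {y}))"
        using ab by (auto simp: doubleton_eq_iff)
      ultimately show ?thesis
        using nin V(1) by (simp add: phi_antisym[of t y b])
    qed
    ultimately show ?thesis
      using nin V(1) by (simp add: sum_negf)
  qed
  have prodx: "phi t x y * ?P y = (\<Prod>z\<in>V. phi t x z) * (\<Prod>z\<in>V - {y}. phi t y z)" if "y \<in> V" for y
    using that V(1) by (simp add: prod.distrib prod.remove)
  have corr: "(\<Sum>y\<in>V. phi t p q * phi t x y * (w a x * w b y * phi t a y * phi t x b) * ?P y * ?N y) =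
      w p q * (w x a * (phi t x b * phi t p q * (\<Prod>z\<in>V. phi t x z * phi t a z)) * npf t w (Suc n) (insert b V))"
    if ab: "{b, a} = {p, q}" "b \<noteq> a" for a b
  proof -
    have "(\<Sum>y\<in>V. phi t p q * phi t x y * (w a x * w b y * phi t a y * phi t x b) * ?P y * ?N y) =
      (\<Sum>y\<in>V. phi t p q * (w a x * phi t x b) * (phi t x y * ?P y) * (w b y * phi t a y * ?N y))"
      by (intro sum.cong refl) (simp add: mult_ac)
    also have "\<dots> = (\<Sum>y\<in>V. phi t p q * (w a x * phi t x b) * (\<Prod>z\<in>V. phi t x z) * (w b y * phi t a y * (\<Prod>z\<in>V - {y}. phi t y z) * ?N y))"
      by (intro sum.cong refl, subst prodx) (simp_all add: mult_ac)
    also have "\<dots> = phi t p q * (w a x * phi t x b) * (\<Prod>z\<in>V. phi t x z) * (w b a * (\<Prod>z\<in>V. phi t a z) * npf t w (Suc n) (insert b V))"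
      using alt[OF ab] by (simp add: sum_distrib_left[symmetric])
    also have "w b a = w p q"
      using ab sym by (auto simp: doubleton_eq_iff)
    finally show ?thesis
      by (simp add: prod.distrib sym[of a x] mult_ac)
  qed
  \<comment> \<open>One factor \<open>w p q\<close> lets \<open>schur\<close> replace
    \<open>w'\<close>, the other turns the remaining \<open>npf t w' n\<close> into
    \<open>?N\<close>; nothing is divided before the end.\<close>
  have "w p q * (w p q * npf t w' (Suc n) Y) =
    w p q * (w p q * (\<Sum>y\<in>V. w' x y * ?P y * npf t w' n (V - {y})))"
    using npf_insert[OF sym', of V x n t] V by (simp add: Y)
  also have "\<dots> = (\<Sum>y\<in>V. (w p q * w' x y) * ?P y * ?N y)"
    by (simp add: sum_distrib_left N mult_ac)
  also have "\<dots> = (\<Sum>y\<in>V. w p q * (w x y * (phi t x p * phi t y p * phi t x q * phi t y q) * ?P y * ?N y)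
    + phi t p q * phi t x y * (w p x * w q y * phi t p y * phi t x q) * ?P y * ?N y
    - phi t p q * phi t x y * (w q x * w p y * phi t q y * phi t x p) * ?P y * ?N y)"
  proof (intro sum.cong refl)
    fix y assume "y \<in> V"
    then have *: "w p q * w' x y =
      w p q * w x y * (phi t x p * phi t y p * phi t x q * phi t y q) +
      phi t p q * phi t x y * (w p x * w q y * phi t p y * phi t x q - w p y * w q x * phi t p x * phi t y q)"
      using V by (intro Suc.prems(5)) (auto simp: Y)
    show "(w p q * w' x y) * ?P y * ?N y = w p q * (w x y * (phi t x p * phi t y p * phi t x q * phi t y q) * ?P y * ?N y)
      + phi t p q * phi t x y * (w p x * w q y * phi t p y * phi t x q) * ?P y * ?N y
      - phi t p q * phi t x y * (w q x * w p y * phi t q y * phi t x p) * ?P y * ?N y"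
      unfolding * by (simp add: phi_antisym[of t q y] phi_antisym[of t x p] algebra_simps)
  qed
  also have "\<dots> = w p q * ((\<Sum>y\<in>V. w x y * (phi t x p * phi t y p * phi t x q * phi t y q) * ?P y * ?N y)
      + w x p * (phi t x q * phi t p q * (\<Prod>z\<in>V. phi t x z * phi t p z)) * npf t w (Suc n) (insert q V)
      + w x q * (phi t x p * phi t q p * (\<Prod>z\<in>V. phi t x z * phi t q z)) * npf t w (Suc n) (insert p V))"
    unfolding sum.distrib sum_subtractf corr[of q p, OF insert_commute pq(1)[symmetric]] corr[of p q, OF refl pq(1)]
    by (simp add: sum_distrib_left phi_antisym[of t q p] algebra_simps)
  also have "(\<Sum>y\<in>V. w x y * (phi t x p * phi t y p * phi t x q * phi t y q) * ?P y * ?N y)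
      + w x p * (phi t x q * phi t p q * (\<Prod>z\<in>V. phi t x z * phi t p z)) * npf t w (Suc n) (insert q V)
      + w x q * (phi t x p * phi t q p * (\<Prod>z\<in>V. phi t x z * phi t q z)) * npf t w (Suc n) (insert p V)
    = npf t w (Suc (Suc n)) (insert x (insert p (insert q V)))"
  proof -
    let ?Z = "insert p (insert q V)"
    have "npf t w (Suc (Suc n)) (insert x ?Z) =
      (\<Sum>y\<in>?Z. w x y * (\<Prod>z\<in>?Z - {y}. phi t x z * phi t y z) * npf t w (Suc n) (?Z - {y}))"
      using V pq xpq by (intro npf_insert[OF sym]) auto
    moreover have "?Z - {p} = insert q V" "?Z - {q} = insert p V"
      using V pq by auto
    moreover have "(\<Sum>y\<in>V. w x y * (\<Prod>z\<in>?Z - {y}. phi t x z * phi t y z) * npf t w (Suc n) (?Z - {y})) =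
      (\<Sum>y\<in>V. w x y * (phi t x p * phi t y p * phi t x q * phi t y q) * ?P y * ?N y)"
    proof (intro sum.cong refl)
      fix y assume "y \<in> V"
      then have "?Z - {y} = insert p (insert q (V - {y}))"
        using V by auto
      then show "w x y * (\<Prod>z\<in>?Z - {y}. phi t x z * phi t y z) * npf t w (Suc n) (?Z - {y}) =
        w x y * (phi t x p * phi t y p * phi t x q * phi t y q) * ?P y * ?N y"
        using V pq by (simp add: mult_ac)
    qed
    moreover have "sum f ?Z = f p + (f q + sum f V)" for f :: "complex \<Rightarrow> complex"
      using V pq by simp
    ultimately show ?thesis
      using V pq by (simp add: add_ac)
  qed
  finally have "w p q * (w p q * npf t w' (Suc n) Y) = w p q * npf t w (Suc (Suc n)) (insert x (insert p (insert q V)))" .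
  then have "w p q * npf t w' (Suc n) Y = npf t w (Suc (Suc n)) (insert x (insert p (insert q V)))"
    by (rule mult_left_cancel[OF pq(2), THEN iffD1])
  moreover have "insert p (insert q Y) = insert x (insert p (insert q V))"
    by (auto simp: Y)
  ultimately show ?case
    by (simp only:)
qed

subsection \<open>Polynomial functions\<close>

definition polyfn :: "nat \<Rightarrow> (complex \<Rightarrow> complex) \<Rightarrow> bool" where
  "polyfn d f \<longleftrightarrow> (\<exists>p. degree p \<le> d \<and> f = poly p)"

lemma polyfn_const [intro]: "polyfn d (\<lambda>x. c)"
  unfolding polyfn_def by (intro exI[of _ "[:c:]"]) auto

lemma polyfn_linear [intro]: "polyfn 1 (\<lambda>x. x - c)" "polyfn 1 (\<lambda>x. c - a * x)" "polyfn 1 (\<lambda>x. 1 - x * c)"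
  unfolding polyfn_def
  by (rule exI[of _ "[:- c, 1:]"], force, rule exI[of _ "[:c, - a:]"], force simp: mult.commute,
      rule exI[of _ "[:1, - c:]"], force)

lemma polyfn_mono: "polyfn d f \<Longrightarrow> d \<le> e \<Longrightarrow> polyfn e f"
  unfolding polyfn_def using order_trans by blast

lemma polyfn_add: "polyfn d f \<Longrightarrow> polyfn d g \<Longrightarrow> polyfn d (\<lambda>x. f x + g x)"
  unfolding polyfn_def
proof clarify
  fix p q :: "complex poly" assume "degree p \<le> d" "degree q \<le> d"
  then show "\<exists>r. degree r \<le> d \<and> (\<lambda>x. poly p x + poly q x) = poly r"
    by (intro exI[of _ "p + q"]) (auto intro: degree_add_le)
qed

lemma polyfn_mult: "polyfn d f \<Longrightarrow> polyfn e g \<Longrightarrow> polyfn (d + e) (\<lambda>x. f x * g x)"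
  unfolding polyfn_def
proof clarify
  fix p q :: "complex poly" assume "degree p \<le> d" "degree q \<le> e"
  then show "\<exists>r. degree r \<le> d + e \<and> (\<lambda>x. poly p x * poly q x) = poly r"
    using degree_mult_le[of p q] by (intro exI[of _ "p * q"]) auto
qed

lemma polyfn_cmult: "polyfn d f \<Longrightarrow> polyfn d (\<lambda>x. c * f x)"
  using polyfn_mult[of 0 "\<lambda>x. c" d f] by auto

lemma polyfn_diff: "polyfn d f \<Longrightarrow> polyfn d g \<Longrightarrow> polyfn d (\<lambda>x. f x - g x)"
  using polyfn_add[OF _ polyfn_cmult[of d g "- 1"], of f] by simp

lemma polyfn_sum: "(\<And>i. i \<in> A \<Longrightarrow> polyfn d (f i)) \<Longrightarrow> polyfn d (\<lambda>x. \<Sum>i\<in>A. f i x)"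
  by (induction A rule: infinite_finite_induct) (auto intro: polyfn_add)

lemma polyfn_prod: "(\<And>i. i \<in> A \<Longrightarrow> polyfn d (f i)) \<Longrightarrow> polyfn (card A * d) (\<lambda>x. \<Prod>i\<in>A. f i x)"
  by (induction A rule: infinite_finite_induct) (auto intro: polyfn_mult)

lemma polyfn_eq_0:
  assumes "polyfn d f" "finite S" "card S > d" "\<And>x. x \<in> S \<Longrightarrow> f x = 0"
  shows "f x = 0"
proof -
  obtain p where p: "degree p \<le> d" "f = poly p"
    using assms(1) by (auto simp: polyfn_def)
  have "p = 0"
  proof (rule ccontr)
    assume "p \<noteq> 0"
    then have "card S \<le> card {x. poly p x = 0}"
      using assms p by (intro card_mono) (auto simp: poly_roots_finite)
    also have "\<dots> \<le> degree p"
      using \<open>p \<noteq> 0\<close> by (rule card_poly_roots_bound)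
    finally show False
      using assms p by simp
  qed
  then show ?thesis
    by (simp add: p)
qed

lemma sum_Pow_insert:
  assumes "finite A" "a \<notin> A"
  shows "(\<Sum>I\<in>Pow (insert a A). f I) = (\<Sum>I\<in>Pow A. f I) + (\<Sum>I\<in>Pow A. f (insert a I))"
proof -
  have "inj_on (insert a) (Pow A)"
    using assms(2) by (auto simp: inj_on_def)
  then show ?thesis
    using assms unfolding Pow_insert
    by (subst sum.union_disjoint) (auto simp: sum.reindex)
qed

subsection \<open>The two sides of the splitting identity\<close>

text \<open>The factor of the spin Hall-Littlewood symmetrisation for a variable \<open>y\<close>
  placed before \<open>x\<close>. Its zero at \<open>y = t x\<close> is what singles out the point
  \<open>t (g s)\<close>.\<close>

definition theta :: "complex \<Rightarrow> complex \<Rightarrow> complex \<Rightarrow> complex" where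
  "theta t y x = (y - t * x) / (y - x)"

definition refined_weight :: "complex \<Rightarrow> complex \<Rightarrow> complex \<Rightarrow> complex \<Rightarrow> complex \<Rightarrow> complex" where
  "refined_weight t g s x y =
     (1 - t) * (x - g * s) * (y - g * s) / (1 - x * y) + (1 - g * t) * (1 - g * s\<^sup>2)"

text \<open>The weight for \<open>\<gamma> = 1\<close> without its factors
  \<open>(1 - s x) (1 - s y)\<close>.\<close>

definition littlewood_weight :: "complex \<Rightarrow> complex \<Rightarrow> complex \<Rightarrow> complex" where
  "littlewood_weight t x y = (1 - t) / (1 - x * y)"

abbreviation littlewood :: "complex \<Rightarrow> complex set \<Rightarrow> complex" where
  "littlewood t X \<equiv> npf t (littlewood_weight t) (card X div 2) X"

text \<open>The coefficient of \<open>2 k\<close> zero parts, once \<open>qpoch t t (2 k)\<close>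
  from symmetrising over their variables is included; see \<open>qpoch_zero_coeff\<close>.\<close>

definition zero_coeff :: "complex \<Rightarrow> complex \<Rightarrow> complex \<Rightarrow> nat \<Rightarrow> complex" where
  "zero_coeff t g s k = (\<Prod>j<k. (1 - g * t ^ (2 * j + 1)) * (1 - g * s\<^sup>2 * t ^ (2 * j)))"

text \<open>The rounding in \<open>(card I + 1) div 2\<close> makes \<open>split_coeff\<close> usable for odd \<open>I\<close> as well, where one more
  variable is about to join \<open>I\<close>.\<close>
definition split_coeff :: "complex \<Rightarrow> complex \<Rightarrow> complex \<Rightarrow> complex set \<Rightarrow> complex set \<Rightarrow> complex" where
  "split_coeff t g s I J =
     zero_coeff t g s ((card I + 1) div 2) * (\<Prod>y\<in>J. y - g * s) * (\<Prod>y\<in>J. \<Prod>x\<in>I. theta t y x)"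

definition split_sum :: "complex \<Rightarrow> complex \<Rightarrow> complex \<Rightarrow> complex set \<Rightarrow> complex" where
  "split_sum t g s X =
     (\<Sum>I\<in>Pow X. if even (card I) then split_coeff t g s I (X - I) * littlewood t (X - I) else 0)"

lemma refined_weight_sym: "refined_weight t g s x y = refined_weight t g s y x"
  by (simp add: refined_weight_def mult_ac)

lemma littlewood_weight_sym: "littlewood_weight t x y = littlewood_weight t y x"
  by (simp add: littlewood_weight_def mult_ac)

lemma prod_minus: "(\<Prod>x\<in>A. - f x :: complex) = (- 1) ^ card A * (\<Prod>x\<in>A. f x)"
  using prod.distrib[of "\<lambda>_. - 1" f A] by simp

subsection \<open>Clearing the denominators in one variable\<close>

text \<open>\<open>W x y\<close> is to be \<open>(1 - x y) w x y\<close>, without the pole.\<close>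
definition npf_poly ::
  "complex \<Rightarrow> (complex \<Rightarrow> complex \<Rightarrow> complex) \<Rightarrow> (complex \<Rightarrow> complex \<Rightarrow> complex) \<Rightarrow> complex set \<Rightarrow> complex \<Rightarrow> complex" where
  "npf_poly t w W Y x = (\<Sum>y\<in>Y. W x y * (x - y) *
     (\<Prod>z\<in>Y - {y}. (1 - t * x * z) * (1 - x * z) * phi t y z) * npf t w (card Y div 2) (Y - {y}))"

lemma npf_poly_eq:
  assumes sym: "\<And>x y. w x y = w y x"
    and Y: "finite Y" "x \<notin> Y" "odd (card Y)"
    and W: "\<And>y. y \<in> Y \<Longrightarrow> W x y = (1 - x * y) * w x y"
  shows "npf_poly t w W Y x =
    (\<Prod>z\<in>Y. (1 - x * z) * (x - z)) * npf t w (card (insert x Y) div 2) (insert x Y)"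
proof -
  obtain n where n: "card Y = 2 * n + 1"
    using Y(3) by (rule oddE)
  have "W x y * (x - y) * (\<Prod>z\<in>Y - {y}. (1 - t * x * z) * (1 - x * z) * phi t y z) * npf t w (card Y div 2) (Y - {y}) =
    (\<Prod>z\<in>Y. (1 - x * z) * (x - z)) * (w x y * (\<Prod>z\<in>Y - {y}. phi t x z * phi t y z) * npf t w n (Y - {y}))"
    if y: "y \<in> Y" for y
  proof -
    have "(\<Prod>z\<in>Y - {y}. (1 - t * x * z) * (1 - x * z) * phi t y z) =
      (\<Prod>z\<in>Y - {y}. (1 - x * z) * (x - z)) * (\<Prod>z\<in>Y - {y}. phi t x z * phi t y z)"
      using Y unfolding prod.distrib[symmetric] by (intro prod.cong refl) (auto simp: phi_def)
    moreover have "(\<Prod>z\<in>Y. (1 - x * z) * (x - z)) = (1 - x * y) * (x - y) * (\<Prod>z\<in>Y - {y}. (1 - x * z) * (x - z))"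
      using y Y(1) by (simp add: prod.remove)
    ultimately show ?thesis
      using W[OF y] n by (simp add: mult_ac)
  qed
  then have "npf_poly t w W Y x = (\<Sum>y\<in>Y. (\<Prod>z\<in>Y. (1 - x * z) * (x - z)) *
    (w x y * (\<Prod>z\<in>Y - {y}. phi t x z * phi t y z) * npf t w n (Y - {y})))"
    unfolding npf_poly_def by (intro sum.cong refl)
  also have "\<dots> = (\<Prod>z\<in>Y. (1 - x * z) * (x - z)) * npf t w (Suc n) (insert x Y)"
    unfolding sum_distrib_left[symmetric] using npf_insert[of w Y x n t, OF sym] Y n by simp
  finally show ?thesis
    using Y n by simp
qed

text \<open>This says that the pole at \<open>x = q\<close> is removable: for \<open>x = q\<close>
  the row of \<open>q\<close> occurs twice, so \<open>npf_alternating\<close> applies.\<close>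

lemma npf_poly_at_member:
  assumes sym: "\<And>x y. w x y = w y x"
    and Y: "finite Y" "q \<in> Y" "odd (card Y)"
    and W: "\<And>y. y \<in> Y \<Longrightarrow> W q y = (1 - q * y) * w q y"
  shows "npf_poly t w W Y q = 0"
proof -
  obtain n where n: "card Y = 2 * n + 1"
    using Y(3) by (rule oddE)
  define V where "V = Y - {q}"
  have V: "finite V" "q \<notin> V" "card V = 2 * n" and YV: "Y = insert q V"
    using Y n by (auto simp: V_def)
  let ?c = "- (\<Prod>z\<in>Y. (1 - t * q * z) * (1 - q * z))"
  have "W q y * (q - y) * (\<Prod>z\<in>Y - {y}. (1 - t * q * z) * (1 - q * z) * phi t y z) * npf t w (card Y div 2) (Y - {y}) =
    ?c * (w q y * (\<Prod>z\<in>V - {y}. phi t y z) * npf t w n (insert q (V - {y})))" if y: "y \<in> V" for y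
  proof -
    have "Y - {y} = insert q (V - {y})" "y \<noteq> q" "q \<notin> V - {y}"
      using y V by (auto simp: YV)
    moreover have phi: "(q - y) * phi t y q = - (1 - t * q * y)"
      using \<open>y \<noteq> q\<close> by (simp add: phi_def divide_simps) (simp add: algebra_simps)
    moreover have W': "W q y = (1 - q * y) * w q y"
      using y by (intro W) (auto simp: YV)
    ultimately have "W q y * (q - y) * (\<Prod>z\<in>Y - {y}. (1 - t * q * z) * (1 - q * z) * phi t y z) * npf t w (card Y div 2) (Y - {y})
      = w q y * (1 - q * y) * ((q - y) * phi t y q) * (1 - t * q * q) * (1 - q * q) *
        (\<Prod>z\<in>V - {y}. (1 - t * q * z) * (1 - q * z)) * (\<Prod>z\<in>V - {y}. phi t y z) * npf t w n (insert q (V - {y}))"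
      using V n by (simp add: YV prod.distrib mult_ac)
    also have "\<dots> = - ((1 - t * q * q) * (1 - q * q) * ((1 - t * q * y) * (1 - q * y) * (\<Prod>z\<in>V - {y}. (1 - t * q * z) * (1 - q * z)))) *
       (w q y * (\<Prod>z\<in>V - {y}. phi t y z) * npf t w n (insert q (V - {y})))"
      unfolding phi by (simp only: mult_minus_left mult_minus_right mult_ac)
    also have "(1 - t * q * y) * (1 - q * y) * (\<Prod>z\<in>V - {y}. (1 - t * q * z) * (1 - q * z)) =
      (\<Prod>z\<in>V. (1 - t * q * z) * (1 - q * z))"
      using y V(1) by (simp add: prod.remove)
    also have "(1 - t * q * q) * (1 - q * q) * \<dots> = (\<Prod>z\<in>Y. (1 - t * q * z) * (1 - q * z))"
      using V by (simp add: YV)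
    finally show ?thesis .
  qed
  then have "npf_poly t w W Y q = ?c * (\<Sum>y\<in>V. w q y * (\<Prod>z\<in>V - {y}. phi t y z) * npf t w n (insert q (V - {y})))"
    using V unfolding npf_poly_def sum_distrib_left by (subst YV, subst sum.insert) auto
  then show ?thesis
    using npf_alternating[of w V q n t, OF sym V] by simp
qed

text \<open>The residue at \<open>x q = 1\<close>: every summand with \<open>y \<noteq> q\<close>
  contains the factor \<open>1 - x q\<close>.\<close>

lemma npf_poly_at_inverse:
  assumes Y: "finite Y" "q \<in> Y" "x * q = 1"
  shows "npf_poly t w W Y x = W x q * (x - q) *
    (\<Prod>z\<in>Y - {q}. (1 - t * x * z) * (1 - x * z) * phi t q z) * npf t w (card Y div 2) (Y - {q})"
proof -
  have "W x y * (x - y) * (\<Prod>z\<in>Y - {y}. (1 - t * x * z) * (1 - x * z) * phi t y z) * npf t w (card Y div 2) (Y - {y}) = 0"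
    if "y \<in> Y - {q}" for y
  proof -
    have "q \<in> Y - {y}"
      using that Y by auto
    then have "(\<Prod>z\<in>Y - {y}. (1 - t * x * z) * (1 - x * z) * phi t y z) = 0"
      using Y by (intro prod_zero) auto
    then show ?thesis
      by simp
  qed
  then have "(\<Sum>y\<in>Y - {q}. W x y * (x - y) *
    (\<Prod>z\<in>Y - {y}. (1 - t * x * z) * (1 - x * z) * phi t y z) * npf t w (card Y div 2) (Y - {y})) = 0"
    by (intro sum.neutral ballI)
  then show ?thesis
    unfolding npf_poly_def sum.remove[OF Y(1,2)] by simp
qed

lemma polyfn_npf_poly:
  assumes "finite Y" "\<And>y. polyfn d (\<lambda>x. W x y)"
  shows "polyfn (d + 2 * card Y - 1) (npf_poly t w W Y)"
  unfolding npf_poly_def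
proof (rule polyfn_sum)
  fix y assume y: "y \<in> Y"
  have "polyfn (d + 1 + card (Y - {y}) * (1 + 1 + 0) + 0) (\<lambda>x. W x y * (x - y) *
     (\<Prod>z\<in>Y - {y}. (1 - t * x * z) * (1 - x * z) * phi t y z) * npf t w (card Y div 2) (Y - {y}))"
  proof (intro polyfn_mult polyfn_prod assms(2) polyfn_linear polyfn_const)
    show "polyfn 1 (\<lambda>x. 1 - t * x * z)" for z
      using polyfn_linear(2)[of 1 "t * z"] by (simp add: mult_ac)
  qed
  moreover have "card Y \<ge> 1"
    using y assms(1) by (metis One_nat_def Suc_leI card_gt_0_iff empty_iff)
  ultimately show "polyfn (d + 2 * card Y - 1) (\<lambda>x. W x y * (x - y) *
     (\<Prod>z\<in>Y - {y}. (1 - t * x * z) * (1 - x * z) * phi t y z) * npf t w (card Y div 2) (Y - {y}))"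
    using y assms(1) by (elim polyfn_mono) (simp add: card_Diff_singleton)
qed

text \<open>Here \<open>I\<close> is the selected set without \<open>x\<close>: for odd
  \<open>I\<close> the variable \<open>x\<close> joins \<open>I\<close>, for even \<open>I\<close>
  it joins the complement.\<close>

definition split_poly :: "complex \<Rightarrow> complex \<Rightarrow> complex \<Rightarrow> complex set \<Rightarrow> complex \<Rightarrow> complex" where
  "split_poly t g s Y x = (\<Sum>I\<in>Pow Y. split_coeff t g s I (Y - I) *
     (if odd (card I)
      then (\<Prod>y\<in>Y - I. y - t * x) * (\<Prod>i\<in>I. x - i) * (\<Prod>y\<in>Y. 1 - x * y) * littlewood t (Y - I)
      else (x - g * s) * (\<Prod>i\<in>I. (x - t * i) * (1 - x * i)) * npf_poly t (littlewood_weight t) (\<lambda>_ _. 1 - t) (Y - I) x))"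

lemma card_Diff_Pow: "finite Y \<Longrightarrow> I \<in> Pow Y \<Longrightarrow> card (Y - I) + card I = card Y"
  by (metis PowD add.commute card_Diff_subset card_mono finite_subset le_add_diff_inverse)

text \<open>With \<open>J = Y - I\<close>, odd \<open>I\<close> give degree
  \<open>|J| + |I| + |Y|\<close> and even \<open>I\<close> give
  \<open>1 + 2 |I| + (2 |J| - 1)\<close>. Both are \<open>2 |Y|\<close>, the degree of the clearing
  product.\<close>

lemma polyfn_split_poly:
  assumes Y: "finite Y" "odd (card Y)"
  shows "polyfn (2 * card Y) (split_poly t g s Y)"
  unfolding split_poly_def
proof (intro polyfn_sum polyfn_cmult)
  fix I assume I: "I \<in> Pow Y"
  have c: "card (Y - I) + card I = card Y"
    using Y I by (intro card_Diff_Pow)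
  have fin: "finite (Y - I)"
    using Y by simp
  show "polyfn (2 * card Y) (\<lambda>x. if odd (card I)
      then (\<Prod>y\<in>Y - I. y - t * x) * (\<Prod>i\<in>I. x - i) * (\<Prod>y\<in>Y. 1 - x * y) * littlewood t (Y - I)
      else (x - g * s) * (\<Prod>i\<in>I. (x - t * i) * (1 - x * i)) * npf_poly t (littlewood_weight t) (\<lambda>_ _. 1 - t) (Y - I) x)"
  proof (cases "odd (card I)")
    case True
    have "polyfn (card (Y - I) * 1 + card I * 1 + card Y * 1 + 0)
      (\<lambda>x. (\<Prod>y\<in>Y - I. y - t * x) * (\<Prod>i\<in>I. x - i) * (\<Prod>y\<in>Y. 1 - x * y) * littlewood t (Y - I))"
      by (intro polyfn_mult polyfn_prod polyfn_linear polyfn_const)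
    then show ?thesis
      using True c by (auto elim: polyfn_mono)
  next
    case False
    have "card (Y - I) \<ge> 1"
      using False c Y(2) by (metis One_nat_def Suc_leI add_0 gr0I)
    moreover have "polyfn (1 + card I * (1 + 1) + (0 + 2 * card (Y - I) - 1))
      (\<lambda>x. (x - g * s) * (\<Prod>i\<in>I. (x - t * i) * (1 - x * i)) * npf_poly t (littlewood_weight t) (\<lambda>_ _. 1 - t) (Y - I) x)"
      by (intro polyfn_mult polyfn_prod polyfn_linear polyfn_const polyfn_npf_poly fin)
    ultimately show ?thesis
      using False c by (auto elim!: polyfn_mono)
  qed
qed

lemma split_poly_eq:
  assumes Y: "finite Y" "x \<notin> Y" "odd (card Y)" and x: "\<And>y. y \<in> Y \<Longrightarrow> x * y \<noteq> 1"
  shows "split_poly t g s Y x = (\<Prod>z\<in>Y. (1 - x * z) * (x - z)) * split_sum t g s (insert x Y)"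
proof -
  let ?Q = "\<Prod>z\<in>Y. (1 - x * z) * (x - z)"
  have "split_sum t g s (insert x Y) =
    (\<Sum>I\<in>Pow Y. (if even (card I) then split_coeff t g s I (insert x Y - I) * littlewood t (insert x Y - I) else 0) +
      (if even (card (insert x I)) then split_coeff t g s (insert x I) (insert x Y - insert x I) * littlewood t (insert x Y - insert x I) else 0))"
    unfolding split_sum_def sum_Pow_insert[OF Y(1,2)] sum.distrib ..
  also have "\<dots> = (\<Sum>I\<in>Pow Y. if odd (card I)
      then split_coeff t g s (insert x I) (Y - I) * littlewood t (Y - I)
      else split_coeff t g s I (insert x (Y - I)) * littlewood t (insert x (Y - I)))"
  proof (intro sum.cong refl)
    fix I assume I: "I \<in> Pow Y"
    then have "x \<notin> I" "finite I"
      using Y finite_subset[of I Y] by auto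
    moreover from this have "insert x Y - insert x I = Y - I" "insert x Y - I = insert x (Y - I)"
      using Y(2) by auto
    ultimately show "(if even (card I) then split_coeff t g s I (insert x Y - I) * littlewood t (insert x Y - I) else 0) +
      (if even (card (insert x I)) then split_coeff t g s (insert x I) (insert x Y - insert x I) * littlewood t (insert x Y - insert x I) else 0)
      = (if odd (card I)
      then split_coeff t g s (insert x I) (Y - I) * littlewood t (Y - I)
      else split_coeff t g s I (insert x (Y - I)) * littlewood t (insert x (Y - I)))"
      by (simp)
  qed
  finally have eq: "split_sum t g s (insert x Y) = (\<Sum>I\<in>Pow Y. if odd (card I)
      then split_coeff t g s (insert x I) (Y - I) * littlewood t (Y - I)
      else split_coeff t g s I (insert x (Y - I)) * littlewood t (insert x (Y - I)))" .
  show ?thesis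
    unfolding eq split_poly_def sum_distrib_left
  proof (intro sum.cong refl)
    fix I assume I: "I \<in> Pow Y"
    have c: "card (Y - I) + card I = card Y"
      using Y I by (intro card_Diff_Pow)
    have fin: "finite I" "finite (Y - I)" and nin: "x \<notin> I" "x \<notin> Y - I"
      using Y I finite_subset[of I Y] by auto
    have Q: "?Q = (\<Prod>z\<in>I. (1 - x * z) * (x - z)) * (\<Prod>z\<in>Y - I. (1 - x * z) * (x - z))"
      using prod.subset_diff[of I Y "\<lambda>z. (1 - x * z) * (x - z)"] I Y by (simp add: mult.commute)
    show "split_coeff t g s I (Y - I) *
     (if odd (card I)
      then (\<Prod>y\<in>Y - I. y - t * x) * (\<Prod>i\<in>I. x - i) * (\<Prod>y\<in>Y. 1 - x * y) * littlewood t (Y - I)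
      else (x - g * s) * (\<Prod>i\<in>I. (x - t * i) * (1 - x * i)) * npf_poly t (littlewood_weight t) (\<lambda>_ _. 1 - t) (Y - I) x) =
      ?Q * (if odd (card I)
      then split_coeff t g s (insert x I) (Y - I) * littlewood t (Y - I)
      else split_coeff t g s I (insert x (Y - I)) * littlewood t (insert x (Y - I)))"
    proof (cases "odd (card I)")
      case True
      have "even (card (Y - I))"
        using True c Y(3) by presburger
      \<comment> \<open>The denominators of \<open>theta t y x\<close> are \<open>y - x\<close>, the
        clearing factors are \<open>x - y\<close>; the sign disappears because \<open>Y - I\<close>
        has even size.\<close>
      then have "(\<Prod>z\<in>Y - I. x - z) * (\<Prod>y\<in>Y - I. theta t y x) = (\<Prod>y\<in>Y - I. y - t * x)"
        using nin prod_minus[of "\<lambda>z. z - x" "Y - I"]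
        by (simp add: prod.distrib[symmetric] theta_def) (auto simp: prod.distrib[symmetric] intro!: prod.cong)
      moreover have "split_coeff t g s (insert x I) (Y - I) = split_coeff t g s I (Y - I) * (\<Prod>y\<in>Y - I. theta t y x)"
        using True fin nin by (simp add: split_coeff_def prod.distrib)
      moreover have "?Q = (\<Prod>y\<in>Y. 1 - x * y) * (\<Prod>z\<in>I. x - z) * (\<Prod>z\<in>Y - I. x - z)"
        using prod.subset_diff[of I Y "\<lambda>z. x - z"] I Y by (simp add: prod.distrib mult_ac)
      ultimately show ?thesis
        using True by (simp add: mult_ac)
    next
      case False
      have "odd (card (Y - I))"
        using False c Y(3) by presburger
      then have "npf_poly t (littlewood_weight t) (\<lambda>_ _. 1 - t) (Y - I) x =
        (\<Prod>z\<in>Y - I. (1 - x * z) * (x - z)) * littlewood t (insert x (Y - I))"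
        using x nin fin by (intro npf_poly_eq littlewood_weight_sym) (auto simp: littlewood_weight_def)
      moreover have "split_coeff t g s I (insert x (Y - I)) = split_coeff t g s I (Y - I) * (x - g * s) * (\<Prod>i\<in>I. theta t x i)"
        using fin nin by (simp add: split_coeff_def mult_ac)
      moreover have "(\<Prod>i\<in>I. (x - t * i) * (1 - x * i)) = (\<Prod>i\<in>I. theta t x i) * (\<Prod>z\<in>I. (1 - x * z) * (x - z))"
        using nin unfolding prod.distrib[symmetric] by (intro prod.cong) (auto simp: theta_def)
      ultimately show ?thesis
        using False Q by (simp add: mult_ac)
    qed
  qed
qed

text \<open>Pair each \<open>I\<close> not containing \<open>q\<close> with
  \<open>insert q I\<close>. For even \<open>I\<close> both terms vanish, by
  \<open>npf_poly_at_member\<close> and by the factor \<open>q - q\<close>. For odd \<open>I\<close>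
  the two terms exchange the places of the coinciding variables \<open>x\<close> and
  \<open>q\<close>, and the odd size of the rest \<open>J\<close> makes their signs
  opposite.\<close>

lemma split_poly_at_member:
  assumes Y: "finite Y" "q \<in> Y" "odd (card Y)" and q: "\<And>y. y \<in> Y \<Longrightarrow> q * y \<noteq> 1"
  shows "split_poly t g s Y q = 0"
proof -
  define V where "V = Y - {q}"
  have V: "finite V" "q \<notin> V" "even (card V)" and YV: "Y = insert q V"
    using Y by (auto simp: V_def)
  let ?f = "\<lambda>I. split_coeff t g s I (Y - I) *
     (if odd (card I)
      then (\<Prod>y\<in>Y - I. y - t * q) * (\<Prod>i\<in>I. q - i) * (\<Prod>y\<in>Y. 1 - q * y) * littlewood t (Y - I)
      else (q - g * s) * (\<Prod>i\<in>I. (q - t * i) * (1 - q * i)) * npf_poly t (littlewood_weight t) (\<lambda>_ _. 1 - t) (Y - I) q)"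
  have "?f I + ?f (insert q I) = 0" if I: "I \<in> Pow V" for I
  proof -
    define J where "J = V - I"
    have c: "card J + card I = card V"
      unfolding J_def using V I by (intro card_Diff_Pow)
    have fin: "finite I" "finite J" and nin: "q \<notin> I" "q \<notin> J" and J: "Y - I = insert q J" "Y - insert q I = J"
      using I V finite_subset[of I V] by (auto simp: J_def YV)
    have J_q: "q * y \<noteq> 1" if "y \<in> insert q J" for y
      using that by (intro q) (auto simp: J_def YV)
    show ?thesis
    proof (cases "odd (card I)")
      case False
      have "odd (card (insert q J))"
        using False c V(3) fin nin by simp presburger
      then have "npf_poly t (littlewood_weight t) (\<lambda>_ _. 1 - t) (insert q J) q = 0"
        using J_q fin by (intro npf_poly_at_member littlewood_weight_sym) (auto simp: littlewood_weight_def)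
      then show ?thesis
        using False fin nin by (simp add: J)
    next
      case True
      then have oJ: "odd (card J)"
        using c V(3) by presburger
      have "npf_poly t (littlewood_weight t) (\<lambda>_ _. 1 - t) J q =
        (\<Prod>z\<in>J. (1 - q * z) * (q - z)) * littlewood t (insert q J)"
        using J_q fin nin oJ by (intro npf_poly_eq littlewood_weight_sym) (auto simp: littlewood_weight_def)
      moreover have "(\<Prod>i\<in>I. theta t q i) * (\<Prod>i\<in>I. q - i) = (\<Prod>i\<in>I. q - t * i)"
        using nin unfolding prod.distrib[symmetric] by (intro prod.cong) (auto simp: theta_def)
      moreover have "(\<Prod>y\<in>J. y - t * q) = - ((\<Prod>y\<in>J. theta t y q) * (\<Prod>z\<in>J. q - z))"
      proof -
        have "(\<Prod>y\<in>J. theta t y q) * (\<Prod>z\<in>J. q - z) = (\<Prod>y\<in>J. - (y - t * q))"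
          using nin unfolding prod.distrib[symmetric]
          by (intro prod.cong refl) (auto simp: theta_def divide_simps, simp add: algebra_simps)
        then show ?thesis
          unfolding prod_minus using oJ by simp
      qed
      moreover have "(\<Prod>y\<in>Y. 1 - q * y) = (1 - q * q) * (\<Prod>i\<in>I. 1 - q * i) * (\<Prod>y\<in>J. 1 - q * y)"
        using prod.subset_diff[of I V "\<lambda>y. 1 - q * y"] I V by (simp add: YV J_def mult_ac)
      moreover have "(card I + 1) div 2 = (card (insert q I) + 1) div 2"
        using True fin nin by (simp add: odd_iff_mod_2_eq_one)
      ultimately show ?thesis
        using True fin nin by (simp add: J split_coeff_def prod.distrib mult_ac)
    qed
  qed
  then show ?thesis
    unfolding split_poly_def YV sum_Pow_insert[OF V(1,2)] sum.distrib[symmetric] by (intro sum.neutral ballI) (simp add: YV)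
qed

text \<open>The factor \<open>1 - x q\<close> removes all odd sets and all sets containing
  \<open>q\<close>; in what is left, \<open>q\<close> must be matched with \<open>x\<close>. Since
  \<open>x q = 1\<close>, the product \<open>(x - t i) (q - t i)\<close> equals
  \<open>(1 - t x i) (1 - t q i)\<close>. Hence elements of \<open>I\<close> and of its complement
  contribute factors of the same shape, which come out of the sum.\<close>

lemma split_poly_at_inverse:
  assumes Y: "finite Y" "q \<in> Y" "odd (card Y)" and xq: "x * q = 1"
  shows "split_poly t g s Y x = (1 - t) * (x - g * s) * (q - g * s) * (x - q) *
    (\<Prod>z\<in>Y - {q}. (1 - t * x * z) * (1 - x * z) * phi t q z) * split_sum t g s (Y - {q})"
proof -
  define V where "V = Y - {q}"
  have V: "finite V" "q \<notin> V" "even (card V)" and YV: "Y = insert q V"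
    using Y by (auto simp: V_def)
  let ?f = "\<lambda>I. split_coeff t g s I (Y - I) *
     (if odd (card I)
      then (\<Prod>y\<in>Y - I. y - t * x) * (\<Prod>i\<in>I. x - i) * (\<Prod>y\<in>Y. 1 - x * y) * littlewood t (Y - I)
      else (x - g * s) * (\<Prod>i\<in>I. (x - t * i) * (1 - x * i)) * npf_poly t (littlewood_weight t) (\<lambda>_ _. 1 - t) (Y - I) x)"
  let ?F = "\<lambda>A. \<Prod>z\<in>A. (1 - t * x * z) * (1 - x * z) * phi t q z"
  have zero: "(\<Prod>y\<in>Y. 1 - x * y) = 0"
    using Y xq by (intro prod_zero) auto
  have f_I: "?f I = (1 - t) * (x - g * s) * (q - g * s) * (x - q) * ?F V *
      (if even (card I) then split_coeff t g s I (V - I) * littlewood t (V - I) else 0)" if I: "I \<in> Pow V" for I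
  proof (cases "odd (card I)")
    case True
    then show ?thesis
      using zero by simp
  next
    case False
    define J where "J = V - I"
    have c: "card J + card I = card V"
      unfolding J_def using V I by (intro card_Diff_Pow)
    have fin: "finite I" "finite J" and nin: "q \<notin> I" "q \<notin> J" and J: "Y - I = insert q J" "V - I = J"
      using I V finite_subset[of I V] by (auto simp: J_def YV)
    have eJ: "even (card J)"
      using False c V(3) by presburger
    have "npf_poly t (littlewood_weight t) (\<lambda>_ _. 1 - t) (insert q J) x = (1 - t) * (x - q) * ?F J * littlewood t J"
      using npf_poly_at_inverse[of "insert q J" q x t "littlewood_weight t" "\<lambda>_ _. 1 - t"] fin nin xq eJ
      by (simp)
    moreover have "split_coeff t g s I (insert q J) = (q - g * s) * (\<Prod>i\<in>I. theta t q i) * split_coeff t g s I J"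
      using fin nin by (simp add: split_coeff_def mult_ac)
    moreover have "(\<Prod>i\<in>I. theta t q i) * (\<Prod>i\<in>I. (x - t * i) * (1 - x * i)) = ?F I"
      unfolding prod.distrib[symmetric]
    proof (intro prod.cong refl)
      fix i
      have "(x - t * i) * (q - t * i) = (1 - t * x * i) * (1 - t * q * i)"
        using xq by algebra
      then show "theta t q i * ((x - t * i) * (1 - x * i)) = (1 - t * x * i) * (1 - x * i) * phi t q i"
        by (simp add: theta_def phi_def mult_ac)
    qed
    moreover have "?F V = ?F I * ?F J"
      using prod.subset_diff[of I V "\<lambda>z. (1 - t * x * z) * (1 - x * z) * phi t q z"] I V by (simp add: J_def mult_ac)
    ultimately show ?thesis
      using False by (simp add: J mult_ac)
  qed
  have "?f (insert q I) = 0" if I: "I \<in> Pow V" for I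
  proof -
    have "finite I"
      using I V(1) finite_subset by auto
    then have "(\<Prod>i\<in>insert q I. (x - t * i) * (1 - x * i)) = 0"
      using xq by (intro prod_zero) auto
    then show ?thesis
      using zero by simp
  qed
  then have "(\<Sum>I\<in>Pow V. ?f (insert q I)) = 0"
    by (intro sum.neutral ballI)
  moreover have "(\<Sum>I\<in>Pow V. ?f I) = (1 - t) * (x - g * s) * (q - g * s) * (x - q) * ?F V * split_sum t g s V"
    unfolding split_sum_def sum_distrib_left by (intro sum.cong refl f_I)
  moreover have "split_poly t g s Y x = (\<Sum>I\<in>Pow V. ?f I) + (\<Sum>I\<in>Pow V. ?f (insert q I))"
    unfolding split_poly_def using sum_Pow_insert[OF V(1,2), of ?f] by (simp only: YV)
  ultimately show ?thesis
    by (simp add: V_def)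
qed

subsection \<open>The splitting identity\<close>

text \<open>Let \<open>E\<close> be the difference in question, \<open>Q\<close> the clearing
  product, and \<open>D\<close> the polynomial equal to \<open>Q E\<close> away from the zeros of
  \<open>Q\<close>. Both \<open>D\<close> and \<open>Q\<close> vanish on \<open>Y\<close>, where
  poles cancel, and on the inverses of \<open>Y\<close>, where residues agree by \<open>IH\<close>.
  Then \<open>Q b D - D b Q\<close> vanishes there and at \<open>b\<close>: one zero more than its
  degree allows.\<close>

lemma npf_minus_split_sum_const:
  assumes Y: "finite Y" "odd (card Y)" "0 \<notin> Y" "\<And>x y. x \<in> Y \<Longrightarrow> y \<in> Y \<Longrightarrow> x * y \<noteq> 1"
    and IH: "\<And>q. q \<in> Y \<Longrightarrow> npf t (refined_weight t g s) (card Y div 2) (Y - {q}) = split_sum t g s (Y - {q})"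
    and a: "a \<notin> Y" "\<And>y. y \<in> Y \<Longrightarrow> a * y \<noteq> 1"
    and b: "b \<notin> Y" "\<And>y. y \<in> Y \<Longrightarrow> b * y \<noteq> 1"
  shows "npf t (refined_weight t g s) (card (insert a Y) div 2) (insert a Y) - split_sum t g s (insert a Y) =
    npf t (refined_weight t g s) (card (insert b Y) div 2) (insert b Y) - split_sum t g s (insert b Y)"
proof -
  let ?w = "refined_weight t g s"
  \<comment> \<open>The weight times \<open>1 - x y\<close>: of degree one in \<open>x\<close>, and
    only its first part survives at \<open>x y = 1\<close>.\<close>
  define W where "W x y = (1 - t) * (x - g * s) * (y - g * s) + (1 - g * t) * (1 - g * s\<^sup>2) * (1 - x * y)" for x y
  define D where "D x = npf_poly t ?w W Y x - split_poly t g s Y x" for x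
  define Q where "Q x = (\<Prod>z\<in>Y. (1 - x * z) * (x - z))" for x
  define E where "E x = npf t ?w (card (insert x Y) div 2) (insert x Y) - split_sum t g s (insert x Y)" for x
  have W: "W x y = (1 - x * y) * ?w x y" if "x * y \<noteq> 1" for x y
    using that by (simp add: W_def refined_weight_def field_simps)
  have "polyfn 1 (\<lambda>x. W x y)" for y
  proof -
    have "polyfn (1 + 0) (\<lambda>x. ((x - g * s) * ((1 - t) * (y - g * s))))"
      by (intro polyfn_mult polyfn_linear polyfn_const)
    moreover have "polyfn 1 (\<lambda>x. (1 - g * t) * (1 - g * s\<^sup>2) * (1 - x * y))"
      by (intro polyfn_cmult polyfn_linear)
    ultimately show ?thesis
      unfolding W_def by (auto intro!: polyfn_add simp: mult_ac)
  qed
  then have pD: "polyfn (2 * card Y) D"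
    unfolding D_def using polyfn_npf_poly[OF Y(1), of 1 W t ?w] polyfn_split_poly[OF Y(1,2), of t g s]
    by (intro polyfn_diff) auto
  have "polyfn (card Y * (1 + 1)) Q"
    unfolding Q_def by (intro polyfn_prod polyfn_mult polyfn_linear)
  then have pQ: "polyfn (2 * card Y) Q"
    by (simp add: mult_2)
  have D_E: "D x = Q x * E x" if "x \<notin> Y" "\<And>y. y \<in> Y \<Longrightarrow> x * y \<noteq> 1" for x
    unfolding D_def E_def Q_def
    using npf_poly_eq[of ?w Y x W t, OF refined_weight_sym Y(1) that(1) Y(2) W[OF that(2)]]
      split_poly_eq[OF Y(1) that(1) Y(2) that(2), of t g s]
    by (simp add: right_diff_distrib)
  have Q_nz: "Q x \<noteq> 0" if "x \<notin> Y" "\<And>y. y \<in> Y \<Longrightarrow> x * y \<noteq> 1" for x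
    using that Y(1) by (auto simp: Q_def)
  have Y_inv: "q * inverse q = 1" "inverse q * q = 1" if "q \<in> Y" for q
  proof -
    have "q \<noteq> 0"
      using that Y(3) by auto
    then show "q * inverse q = 1" "inverse q * q = 1"
      by simp_all
  qed
  have root1: "D q = 0 \<and> Q q = 0" if q: "q \<in> Y" for q
  proof -
    have "npf_poly t ?w W Y q = 0"
      using npf_poly_at_member[of ?w Y q W t, OF refined_weight_sym Y(1) q Y(2)] W Y(4)[OF q] by blast
    moreover have "split_poly t g s Y q = 0"
      using split_poly_at_member[OF Y(1) q Y(2)] Y(4)[OF q] by blast
    ultimately show ?thesis
      using q Y(1) by (auto simp: D_def Q_def)
  qed
  have root2: "D (inverse q) = 0 \<and> Q (inverse q) = 0" if q: "q \<in> Y" for q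
  proof -
    have "W (inverse q) q = (1 - t) * (inverse q - g * s) * (q - g * s)"
      unfolding W_def Y_inv[OF q] by simp
    then have "npf_poly t ?w W Y (inverse q) = split_poly t g s Y (inverse q)"
      unfolding npf_poly_at_inverse[OF Y(1) q Y_inv(2)[OF q]] split_poly_at_inverse[OF Y(1) q Y(2) Y_inv(2)[OF q]] IH[OF q]
      by simp
    moreover have "Q (inverse q) = 0"
      unfolding Q_def using q Y(1) Y_inv[OF q] by (intro prod_zero) auto
    ultimately show ?thesis
      by (simp add: D_def)
  qed
  define S where "S = insert b (Y \<union> inverse ` Y)"
  have "card S = Suc (card (Y \<union> inverse ` Y))"
    unfolding S_def using Y(1) b Y_inv by (intro card_insert_disjoint) auto
  also have "card (Y \<union> inverse ` Y) = card Y + card (inverse ` Y)"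
    using Y Y_inv by (intro card_Un_disjoint) auto
  also have "card (inverse ` Y) = card Y"
    by (intro card_image) (auto simp: inj_on_def)
  finally have cS: "card S > 2 * card Y"
    by simp
  have "polyfn (2 * card Y) (\<lambda>x. Q b * D x - D b * Q x)"
    by (intro polyfn_diff polyfn_cmult pD pQ)
  then have "Q b * D a - D b * Q a = 0"
    by (rule polyfn_eq_0[OF _ _ cS]) (use Y(1) root1 root2 in \<open>auto simp: S_def mult.commute\<close>)
  then have "Q a * Q b * (E a - E b) = 0"
    using D_E[OF a] D_E[OF b] by (simp add: algebra_simps)
  then have "E a = E b"
    using Q_nz[OF a] Q_nz[OF b] by simp
  then show ?thesis
    by (simp add: E_def)
qed

text \<open>The hypothesis of \<open>npf_schur_complement\<close> for \<open>p = b\<close>, \<open>q = t b\<close>, divided by \<open>K\<close>: the row of \<open>b\<close> is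
  constant equal to \<open>K\<close>.\<close>
lemma refined_weight_schur:
  fixes t g s x y :: complex
  defines "b \<equiv> g * s" and "K \<equiv> (1 - g * t) * (1 - g * s\<^sup>2)"
  assumes nz: "b \<noteq> 0" "t \<noteq> 1" "x \<noteq> y" "x \<noteq> b" "y \<noteq> b" "x \<noteq> t * b" "y \<noteq> t * b"
    and den: "x * y \<noteq> 1" "t * b * x \<noteq> 1" "t * b * y \<noteq> 1"
  shows "refined_weight t (t\<^sup>2 * g) s x y =
    refined_weight t g s x y * (phi t x b * phi t y b * phi t x (t * b) * phi t y (t * b)) +
    phi t b (t * b) * phi t x y * (refined_weight t g s (t * b) y * phi t b y * phi t x (t * b) -
      refined_weight t g s (t * b) x * phi t b x * phi t y (t * b))"
proof -
  \<comment> \<open>This is \<open>1 - t (t b)^2\<close>, which up to sign is left in the numerator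
    of \<open>phi t x (t b) - phi t y (t b)\<close> besides \<open>x - y\<close>.\<close>
  define c where "c = 1 - t ^ 3 * b\<^sup>2"
  let ?p = "phi t x b * phi t y b * phi t x (t * b) * phi t y (t * b)"
  have nz': "x - b \<noteq> 0" "y - b \<noteq> 0" "x - t * b \<noteq> 0" "y - t * b \<noteq> 0" "1 - x * y \<noteq> 0" "x - y \<noteq> 0" "b - x \<noteq> 0" "b - y \<noteq> 0"
    "b * (1 - t) \<noteq> 0" "1 - t * b * x \<noteq> 0" "1 - t * b * y \<noteq> 0"
    using nz den by auto
  \<comment> \<open>The pole of the weight at \<open>t b z = 1\<close> cancels against the numerator
    of \<open>phi t b z\<close>.\<close>
  have row: "refined_weight t g s (t * b) z * phi t b z = (1 - t)\<^sup>2 * b + K * phi t b z"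
    if "z - b \<noteq> 0" "1 - t * b * z \<noteq> 0" for z
  proof -
    have "(1 - t) * (t * b - b) * (z - b) / (1 - t * b * z) * phi t b z = (1 - t)\<^sup>2 * b"
    proof -
      have "b - z \<noteq> 0"
        using that by auto
      then have "(1 - t) * (t * b - b) * (z - b) / (1 - t * b * z) * phi t b z = (1 - t) * (t * b - b) * (z - b) / (b - z)"
        using that by (simp add: phi_def)
      also have "\<dots> = (1 - t)\<^sup>2 * b"
        using \<open>b - z \<noteq> 0\<close> by (simp add: divide_simps) (simp add: power2_eq_square algebra_simps)
      finally show ?thesis .
    qed
    then show ?thesis
      by (simp add: refined_weight_def K_def b_def distrib_right)
  qed
  have phi_pq: "phi t b (t * b) = (1 - t\<^sup>2 * b\<^sup>2) / (b * (1 - t))"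
    by (simp add: phi_def algebra_simps power2_eq_square)
  \<comment> \<open>The identity is affine in \<open>K\<close>: this is the coefficient of
    \<open>K\<close>, and \<open>const_part\<close> is the rest. Correspondingly, \<open>K'\<close>
    below writes the constant for \<open>t^2 g\<close> as
    \<open>t^2 K + (1 - t^2) c\<close>.\<close>
  have K_part: "?p + phi t b (t * b) * phi t x y * (phi t b y * phi t x (t * b) - phi t b x * phi t y (t * b)) = t\<^sup>2"
  proof -
    let ?m = "(x - b) * (y - b) * (x - t * b) * (y - t * b)"
    let ?n = "(1 - t * b * x) * (1 - t\<^sup>2 * b * y) * (b - y) * (x - t * b) - (1 - t * b * y) * (1 - t\<^sup>2 * b * x) * (b - x) * (y - t * b)"
    have phis: "phi t b y * phi t x (t * b) - phi t b x * phi t y (t * b) = - ?n / ?m"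
      using nz' by (simp add: phi_def divide_simps) (simp add: algebra_simps power2_eq_square)
    have p: "?p = (1 - t * b * x) * (1 - t * b * y) * (1 - t\<^sup>2 * b * x) * (1 - t\<^sup>2 * b * y) / ?m"
      by (simp add: phi_def power2_eq_square mult_ac)
    have clear: "M / m + d / e * (f / h) * (n / m) = r"
      if "M * (e * h) + d * f * n = r * (m * (e * h))" "m \<noteq> 0" "e \<noteq> 0" "h \<noteq> 0" for M m d e f h n r :: complex
      using that by (simp add: field_simps)
    have "(1 - t * b * x) * (1 - t * b * y) * (1 - t\<^sup>2 * b * x) * (1 - t\<^sup>2 * b * y) * (b * (1 - t) * (x - y)) +
      (1 - t\<^sup>2 * b\<^sup>2) * (1 - t * x * y) * (- ?n) = t\<^sup>2 * (?m * (b * (1 - t) * (x - y)))"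
      by algebra
    then show ?thesis
      unfolding phis p phi_pq unfolding phi_def by (rule clear) (use nz' in simp_all)
  qed
  have const_part: "(1 - t) * (x - b) * (y - b) / (1 - x * y) * ?p + (1 - t) * (1 - t\<^sup>2 * b\<^sup>2) * phi t x y * (phi t x (t * b) - phi t y (t * b))
    = (1 - t) * (x - t\<^sup>2 * b) * (y - t\<^sup>2 * b) / (1 - x * y) + (1 - t\<^sup>2) * c"
  proof -
    let ?m = "(x - t * b) * (y - t * b)"
    have p: "(1 - t) * (x - b) * (y - b) / (1 - x * y) * ?p =
      (1 - t) * (1 - t * b * x) * (1 - t * b * y) * (1 - t\<^sup>2 * b * x) * (1 - t\<^sup>2 * b * y) / (?m * (1 - x * y))"
      using nz' by (simp add: phi_def power2_eq_square mult_ac)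
    have "phi t x y * (phi t x (t * b) - phi t y (t * b)) = - ((1 - t * x * y) * c / ?m)"
      using nz' by (simp add: phi_def c_def divide_simps) (simp add: algebra_simps power2_eq_square power3_eq_cube)
    then have phis: "(1 - t) * (1 - t\<^sup>2 * b\<^sup>2) * phi t x y * (phi t x (t * b) - phi t y (t * b)) =
      (1 - t) * (1 - t\<^sup>2 * b\<^sup>2) * - ((1 - t * x * y) * c / ?m)"
      by (simp only: mult.assoc)
    have clear: "A / (m * e) + k * - (d / m) = r / e + h"
      if "A - k * d * e = r * m + h * e * m" "m \<noteq> 0" "e \<noteq> 0" for A m e k d r h :: complex
      using that by (simp add: field_simps)
    have "(1 - t) * (1 - t * b * x) * (1 - t * b * y) * (1 - t\<^sup>2 * b * x) * (1 - t\<^sup>2 * b * y) -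
        (1 - t) * (1 - t\<^sup>2 * b\<^sup>2) * ((1 - t * x * y) * c) * (1 - x * y) =
      (1 - t) * (x - t\<^sup>2 * b) * (y - t\<^sup>2 * b) * ?m + (1 - t\<^sup>2) * c * (1 - x * y) * ?m"
      unfolding c_def by algebra
    then show ?thesis
      unfolding p phis by (rule clear) (use nz' in simp_all)
  qed
  have w: "refined_weight t g s x y = (1 - t) * (x - b) * (y - b) / (1 - x * y) + K"
    by (simp add: refined_weight_def K_def b_def)
  have K': "(1 - t\<^sup>2 * g * t) * (1 - t\<^sup>2 * g * s\<^sup>2) = t\<^sup>2 * K + (1 - t\<^sup>2) * c"
    unfolding K_def c_def b_def by algebra
  have w': "refined_weight t (t\<^sup>2 * g) s x y =
    (1 - t) * (x - t\<^sup>2 * b) * (y - t\<^sup>2 * b) / (1 - x * y) + (t\<^sup>2 * K + (1 - t\<^sup>2) * c)"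
    unfolding refined_weight_def K' by (simp add: b_def mult.assoc)
  have "refined_weight t g s x y * ?p +
    phi t b (t * b) * phi t x y * (refined_weight t g s (t * b) y * phi t b y * phi t x (t * b) -
      refined_weight t g s (t * b) x * phi t b x * phi t y (t * b)) =
    K * (?p + phi t b (t * b) * phi t x y * (phi t b y * phi t x (t * b) - phi t b x * phi t y (t * b))) +
    ((1 - t) * (x - b) * (y - b) / (1 - x * y) * ?p + (1 - t)\<^sup>2 * b * phi t b (t * b) * phi t x y * (phi t x (t * b) - phi t y (t * b)))"
    unfolding row[OF nz'(1,10)] row[OF nz'(2,11)] w by (simp add: algebra_simps)
  also have "(1 - t)\<^sup>2 * b * phi t b (t * b) = (1 - t) * (1 - t\<^sup>2 * b\<^sup>2)"
    unfolding phi_pq using nz' by (simp add: power2_eq_square)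
  finally show ?thesis
    unfolding K_part const_part w' by (simp add: algebra_simps)
qed

lemma zero_coeff_Suc: "zero_coeff t g s (Suc k) = (1 - g * t) * (1 - g * s\<^sup>2) * zero_coeff t (t\<^sup>2 * g) s k"
  unfolding zero_coeff_def prod.lessThan_Suc_shift by (simp add: power2_eq_square mult_ac)

text \<open>Put \<open>b = g s\<close>. A set without \<open>b\<close> is killed by the factor
  \<open>y - g s\<close> at \<open>y = b\<close>, a set with \<open>b\<close> but without
  \<open>t b\<close> by \<open>theta t (t b) b = 0\<close>. For a set containing both,
  \<open>(y - b) theta t y b theta t y (t b) = y - t^2 b\<close>, which is the factor belonging to
  \<open>t^2 g\<close>.\<close>

lemma split_sum_shift:
  assumes Y: "finite Y" "g * s \<notin> Y" "t * (g * s) \<notin> Y" and ne: "t * (g * s) \<noteq> g * s"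
  shows "split_sum t g s (insert (g * s) (insert (t * (g * s)) Y)) =
    (1 - g * t) * (1 - g * s\<^sup>2) * split_sum t (t\<^sup>2 * g) s Y"
proof -
  define b where "b = g * s"
  define X where "X = insert b (insert (t * b) Y)"
  have nin: "b \<notin> Y" "t * b \<notin> Y" "t * b \<noteq> b"
    using assms by (simp_all add: b_def)
  let ?f = "\<lambda>I. if even (card I) then split_coeff t g s I (X - I) * littlewood t (X - I) else 0"
  have 1: "split_coeff t g s I J = 0" if "b \<in> J" "finite J" for I J
  proof -
    have "(\<Prod>y\<in>J. y - g * s) = 0"
      using that by (intro prod_zero) (auto simp: b_def)
    then show ?thesis
      by (simp add: split_coeff_def)
  qed
  have 2: "split_coeff t g s I J = 0" if "t * b \<in> J" "b \<in> I" "finite I" "finite J" for I J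
  proof -
    have "(\<Prod>x\<in>I. theta t (t * b) x) = 0"
      using that by (intro prod_zero) (auto simp: theta_def)
    then have "(\<Prod>y\<in>J. \<Prod>x\<in>I. theta t y x) = 0"
      using that by (intro prod_zero) auto
    then show ?thesis
      by (simp add: split_coeff_def)
  qed
  have "split_sum t g s X = (\<Sum>I\<in>Pow Y. ?f I) + (\<Sum>I\<in>Pow Y. ?f (insert (t * b) I)) +
    ((\<Sum>I\<in>Pow Y. ?f (insert b I)) + (\<Sum>I\<in>Pow Y. ?f (insert b (insert (t * b) I))))"
    unfolding split_sum_def
    using sum_Pow_insert[of "insert (t * b) Y" b ?f] sum_Pow_insert[of Y "t * b" ?f]
      sum_Pow_insert[of Y "t * b" "\<lambda>I. ?f (insert b I)"] Y nin
    by (simp add: X_def)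
  moreover have "(\<Sum>I\<in>Pow Y. ?f I) = 0"
    using nin Y(1) by (intro sum.neutral ballI) (auto intro!: 1 simp: X_def)
  moreover have "(\<Sum>I\<in>Pow Y. ?f (insert (t * b) I)) = 0"
    using nin Y(1) by (intro sum.neutral ballI) (auto intro!: 1 simp: X_def)
  moreover have "(\<Sum>I\<in>Pow Y. ?f (insert b I)) = 0"
  proof (intro sum.neutral ballI)
    fix I assume I: "I \<in> Pow Y"
    have "split_coeff t g s (insert b I) (X - insert b I) = 0"
      using I nin Y(1) finite_subset[of I Y] by (intro 2) (auto simp: X_def)
    then show "?f (insert b I) = 0"
      by simp
  qed
  moreover have "?f (insert b (insert (t * b) I)) = (1 - g * t) * (1 - g * s\<^sup>2) *
    (if even (card I) then split_coeff t (t\<^sup>2 * g) s I (Y - I) * littlewood t (Y - I) else 0)" if I: "I \<in> Pow Y" for I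
  proof -
    have fin: "finite I" and nI: "b \<notin> I" "t * b \<notin> I"
      using I Y(1) nin finite_subset by auto
    have X_I: "X - insert b (insert (t * b) I) = Y - I"
      using nin by (auto simp: X_def)
    have c: "card (insert b (insert (t * b) I)) = Suc (Suc (card I))"
      using fin nI nin by simp
    have "(\<Prod>y\<in>Y - I. y - g * s) * (\<Prod>y\<in>Y - I. \<Prod>x\<in>insert b (insert (t * b) I). theta t y x) =
      (\<Prod>y\<in>Y - I. y - t\<^sup>2 * g * s) * (\<Prod>y\<in>Y - I. \<Prod>x\<in>I. theta t y x)"
      unfolding prod.distrib[symmetric]
    proof (intro prod.cong refl)
      fix y assume "y \<in> Y - I"
      then have "y - b \<noteq> 0" "y - t * b \<noteq> 0"
        using nin by auto
      then have "(y - b) * (theta t y b * theta t y (t * b)) = y - t\<^sup>2 * g * s"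
        by (simp add: theta_def b_def power2_eq_square mult_ac)
      then show "(y - g * s) * (\<Prod>x\<in>insert b (insert (t * b) I). theta t y x) = (y - t\<^sup>2 * g * s) * (\<Prod>x\<in>I. theta t y x)"
        using fin nI nin by (simp add: b_def[symmetric] mult.assoc[symmetric])
    qed
    then have "split_coeff t g s (insert b (insert (t * b) I)) (Y - I) =
      (1 - g * t) * (1 - g * s\<^sup>2) * split_coeff t (t\<^sup>2 * g) s I (Y - I)"
      unfolding split_coeff_def c using zero_coeff_Suc[of t g s "(card I + 1) div 2"] by (simp add: mult.assoc)
    then show ?thesis
      by (simp add: X_I c)
  qed
  ultimately show ?thesis
    by (simp add: X_def[symmetric] b_def[symmetric] split_sum_def sum_distrib_left)
qed

text \<open>Two applications of \<open>npf_minus_split_sum_const\<close> move \<open>x\<close> to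
  \<open>b\<close> and \<open>y\<close> to \<open>t b\<close>. There
  \<open>npf_schur_complement\<close> and \<open>split_sum_shift\<close> lead to
  \<open>t^2 g\<close>, which is why \<open>IH\<close> is quantified over \<open>g\<close>.\<close>

lemma npf_eq_split_sum_generic:
  assumes t: "t \<noteq> 0" "t \<noteq> 1"
    and X: "finite X" "card X = 2 * Suc n" "\<And>x y. x \<in> X \<Longrightarrow> y \<in> X \<Longrightarrow> x * y \<noteq> 1"
    and IH: "\<And>g X. g \<noteq> 0 \<Longrightarrow> finite X \<Longrightarrow> card X = 2 * n \<Longrightarrow> (\<And>x y. x \<in> X \<Longrightarrow> y \<in> X \<Longrightarrow> x * y \<noteq> 1) \<Longrightarrow>
      npf t (refined_weight t g s) n X = split_sum t g s X"
    and g: "g \<noteq> 0"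
    and b: "b = g * s" "b \<noteq> 0" "b \<notin> X" "t * b \<notin> X" "b * b \<noteq> 1" "t * b * b \<noteq> 1"
      "\<And>x. x \<in> X \<Longrightarrow> b * x \<noteq> 1" "\<And>x. x \<in> X \<Longrightarrow> t * b * x \<noteq> 1"
  shows "npf t (refined_weight t g s) (Suc n) X = split_sum t g s X"
proof -
  let ?w = "refined_weight t g s"
  \<comment> \<open>If 0 is among the variables, it is moved first, so that it never belongs to the
    fixed set \<open>Y\<close>.\<close>
  obtain x where x: "x \<in> X" "0 \<in> X \<Longrightarrow> x = 0"
    using X(2) by (metis card.empty ex_in_conv nat.simps(3) mult_eq_0_iff zero_neq_numeral)
  have "card (X - {x}) \<noteq> 0"
    using x X by simp
  then obtain y where y: "y \<in> X" "y \<noteq> x"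
    by (metis card.empty ex_in_conv DiffE insertI1)
  define V where "V = X - {x, y}"
  have V: "finite V" "card V = 2 * n" "x \<notin> V" "y \<notin> V" "b \<notin> V" "t * b \<notin> V" and XV: "X = insert x (insert y V)"
    and nz: "0 \<notin> V" "y \<noteq> 0"
    using X x y b by (auto simp: V_def)
  have tb: "t * b \<noteq> b"
    using t b by simp
  define E where "E Z = npf t ?w (card Z div 2) Z - split_sum t g s Z" for Z
  have IH': "npf t ?w (card Y div 2) (Y - {q}) = split_sum t g s (Y - {q})"
    if "finite Y" "card Y = 2 * n + 1" "q \<in> Y" "\<And>x y. x \<in> Y \<Longrightarrow> y \<in> Y \<Longrightarrow> x * y \<noteq> 1" for Y q
    using that IH[OF g, of "Y - {q}"] by simp
  have XV': "p * q \<noteq> 1" if "p \<in> X \<union> {b}" "q \<in> X \<union> {b}" for p q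
    using that X(3)[of p q] b(5) b(7)[of p] b(7)[of q] by (auto simp: mult.commute)
  have "E (insert x (insert y V)) = E (insert b (insert y V))"
    unfolding E_def
  proof (rule npf_minus_split_sum_const)
    show "npf t ?w (card (insert y V) div 2) (insert y V - {q}) = split_sum t g s (insert y V - {q})"
      if "q \<in> insert y V" for q
      using that V by (intro IH' XV') (auto simp: XV)
  qed (use V nz y b XV' in \<open>auto simp: XV\<close>)
  also have "\<dots> = E (insert y (insert b V))"
    by (simp add: insert_commute)
  also have "\<dots> = E (insert (t * b) (insert b V))"
    unfolding E_def
  proof (rule npf_minus_split_sum_const)
    show "npf t ?w (card (insert b V) div 2) (insert b V - {q}) = split_sum t g s (insert b V - {q})"
      if "q \<in> insert b V" for q
      using that V by (intro IH' XV') (auto simp: XV)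
  qed (use V nz y b XV' tb in \<open>auto simp: XV\<close>)
  also have "\<dots> = E (insert b (insert (t * b) V))"
    by (simp add: insert_commute)
  also have "\<dots> = 0"
  proof -
    let ?Z = "insert b (insert (t * b) V)"
    define K where "K = (1 - g * t) * (1 - g * s\<^sup>2)"
    have w_b: "?w b z = K" for z
      by (simp add: refined_weight_def b(1) K_def)
    have "npf t ?w (Suc n) ?Z = K * npf t (refined_weight t (t\<^sup>2 * g) s) n V"
    \<comment> \<open>For \<open>K = 0\<close> no Schur complement can be formed, but then the row
      of \<open>b\<close> vanishes and both sides are 0.\<close>
    proof (cases "K = 0")
      case True
      have "npf t ?w (Suc n) ?Z = (\<Sum>y\<in>insert (t * b) V. ?w b y *
        (\<Prod>z\<in>insert (t * b) V - {y}. phi t b z * phi t y z) * npf t ?w n (insert (t * b) V - {y}))"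
        using V tb by (intro npf_insert refined_weight_sym) auto
      then show ?thesis
        by (simp add: w_b True)
    next
      case False
      have "npf t ?w (Suc n) ?Z = ?w b (t * b) * npf t (refined_weight t (t\<^sup>2 * g) s) n V"
      proof (rule npf_schur_complement[OF refined_weight_sym refined_weight_sym])
        fix p q assume pq: "p \<in> V" "q \<in> V" "p \<noteq> q"
        then have schur: "refined_weight t (t\<^sup>2 * g) s p q =
          ?w p q * (phi t p b * phi t q b * phi t p (t * b) * phi t q (t * b)) +
          phi t b (t * b) * phi t p q * (?w (t * b) q * phi t b q * phi t p (t * b) -
            ?w (t * b) p * phi t b p * phi t q (t * b))"
          using V b t X(3)[of p q] unfolding b(1)
          by (intro refined_weight_schur) (auto simp: XV b(1)[symmetric])
        show "?w b (t * b) * refined_weight t (t\<^sup>2 * g) s p q =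
          ?w b (t * b) * ?w p q * (phi t p b * phi t q b * phi t p (t * b) * phi t q (t * b)) +
          phi t b (t * b) * phi t p q * (?w b p * ?w (t * b) q * phi t b q * phi t p (t * b) -
            ?w b q * ?w (t * b) p * phi t b p * phi t q (t * b))"
          unfolding w_b schur by (simp add: algebra_simps)
      qed (use V tb w_b False in auto)
      then show ?thesis
        by (simp add: w_b)
    qed
    also have "npf t (refined_weight t (t\<^sup>2 * g) s) n V = split_sum t (t\<^sup>2 * g) s V"
      using V t g X(3) by (intro IH) (auto simp: XV)
    also have "K * split_sum t (t\<^sup>2 * g) s V = split_sum t g s ?Z"
      unfolding K_def b(1) by (rule split_sum_shift[symmetric]) (use V tb in \<open>auto simp: b(1)\<close>)
    finally have "npf t ?w (Suc n) ?Z = split_sum t g s ?Z" .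
    moreover have "card ?Z = 2 * Suc n"
      using V tb by simp
    ultimately show ?thesis
      by (simp add: E_def)
  qed
  finally show ?thesis
    using X(2) by (simp add: E_def XV)
qed

section \<open>Removing the genericity assumptions\<close>

lemma continuous_on_npf:
  assumes "\<And>x y. continuous_on A (\<lambda>s. w s x y)"
  shows "continuous_on A (\<lambda>s. npf t (w s) n X)"
  by (induction n arbitrary: X)
    (auto simp: npf.simps(2) simp del: of_nat_Suc intro!: continuous_intros assms)

text \<open>Both sides are continuous in \<open>s\<close>, which removes the genericity assumptions.\<close>
lemma npf_eq_split_sum:
  assumes t: "t \<noteq> 0" "t \<noteq> 1" and g: "g \<noteq> 0"
    and X: "finite X" "card X = 2 * n" "\<And>x y. x \<in> X \<Longrightarrow> y \<in> X \<Longrightarrow> x * y \<noteq> 1"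
  shows "npf t (refined_weight t g s) n X = split_sum t g s X"
  using g X
proof (induction n arbitrary: g s X)
  case 0
  then show ?case
    by (simp add: split_sum_def split_coeff_def zero_coeff_def)
next
  case (Suc n)
  define f where "f s = npf t (refined_weight t g s) (Suc n) X - split_sum t g s X" for s
  \<comment> \<open>The values of \<open>g s\<close> excluded in
    \<open>npf_eq_split_sum_generic\<close>. They are finitely many, so the remaining
    \<open>s\<close> are dense.\<close>
  define B where "B = {0} \<union> X \<union> (\<lambda>x. x / t) ` X \<union> inverse ` X \<union> (\<lambda>x. inverse (t * x)) ` X \<union> {b. b ^ 2 = 1} \<union> {b. b ^ 2 = 1 / t}"
  define A where "A = - ((\<lambda>b. b / g) ` B)"
  have "finite B"
    unfolding B_def using Suc.prems by (intro finite_UnI finite_imageI finite_nth_roots) auto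
  then have "finite ((\<lambda>b. b / g) ` B)"
    by simp
  then have "closure A = UNIV"
    unfolding A_def closure_complement by (simp add: empty_interior_finite)
  moreover have "f s = 0" if s: "s \<in> A" for s
  proof -
    have nB: "g * s \<notin> B"
    proof
      assume "g * s \<in> B"
      then have "g * s / g \<in> (\<lambda>b. b / g) ` B"
        by blast
      then show False
        using s Suc.prems(1) by (simp add: A_def)
    qed
    have inv: "g * s * x \<noteq> 1" "t * (g * s) * x \<noteq> 1" if "x \<in> X" for x
    proof -
      have "g * s \<noteq> inverse x" "g * s \<noteq> inverse (t * x)"
        using nB that by (auto simp: B_def)
      then show "g * s * x \<noteq> 1" "t * (g * s) * x \<noteq> 1"
        using inverse_unique[of x "g * s"] inverse_unique[of "t * x" "g * s"] by (auto simp: mult_ac)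
    qed
    have "g * s \<notin> (\<lambda>x. x / t) ` X"
      using nB by (simp add: B_def)
    then have "t * (g * s) \<notin> X"
      using t(1) by (auto simp: image_iff)
    moreover have "t * (g * s) * (g * s) \<noteq> 1"
      using nB t(1) by (auto simp: B_def power2_eq_square field_simps)
    ultimately have "npf t (refined_weight t g s) (Suc n) X = split_sum t g s X"
      using nB inv Suc.prems t
      by (intro npf_eq_split_sum_generic[where b = "g * s"] Suc.IH) (auto simp: B_def power2_eq_square)
    then show ?thesis
      by (simp add: f_def)
  qed
  moreover have "continuous_on UNIV f"
  proof -
    have "continuous_on UNIV (\<lambda>s. refined_weight t g s x y)" for x y
      unfolding refined_weight_def divide_inverse by (intro continuous_intros)
    moreover have "continuous_on UNIV (\<lambda>s. split_sum t g s X)"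
      unfolding split_sum_def
    proof (intro continuous_on_sum)
      fix I
      show "continuous_on UNIV (\<lambda>s. if even (card I) then split_coeff t g s I (X - I) * littlewood t (X - I) else 0)"
        by (cases "even (card I)") (auto simp: split_coeff_def zero_coeff_def intro!: continuous_intros)
    qed
    ultimately show ?thesis
      unfolding f_def by (intro continuous_intros continuous_on_npf)
  qed
  ultimately have "f s = 0"
    using continuous_constant_on_closure[of A f 0 s] by auto
  then show ?case
    by (simp add: f_def)
qed

subsection \<open>Sums over orderings of a finite set\<close>

definition index_pairs :: "nat \<Rightarrow> (nat \<times> nat) set" where
  "index_pairs N = (SIGMA j:{..<N}. {..<j})"

lemma finite_index_pairs [simp]: "finite (index_pairs N)"
  by (simp add: index_pairs_def)

lemma prod_index_pairs: "(\<Prod>j<N. \<Prod>i<j. f i j) = (\<Prod>(j, i)\<in>index_pairs N. f i j)"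
  unfolding index_pairs_def by (rule prod.Sigma) auto

text \<open>The sign in the form in which it arises from permuting an antisymmetric product;
  \<open>inversion_sign_eq_sign\<close> identifies it with \<open>sign\<close>.\<close>

definition inversion_sign :: "nat \<Rightarrow> (nat \<Rightarrow> nat) \<Rightarrow> int" where
  "inversion_sign N p = (\<Prod>(j, i)\<in>index_pairs N. sgn (int (p j) - int (p i)))"

text \<open>The map \<open>h\<close> sends a pair to its image, put back in order. It permutes the
  index pairs, and every pair whose order is reversed costs a factor -1.\<close>

lemma prod_index_pairs_permute:
  fixes f :: "nat \<Rightarrow> nat \<Rightarrow> 'a::comm_ring_1"
  assumes p: "p permutes {..<N}" and anti: "\<And>i j. f j i = - f i j"
  shows "(\<Prod>(j, i)\<in>index_pairs N. f (p i) (p j)) = of_int (inversion_sign N p) * (\<Prod>(j, i)\<in>index_pairs N. f i j)"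
proof -
  define h where "h = (\<lambda>(j, i). (max (p j) (p i), min (p j) (p i)))"
  have inj: "p i = p j \<longleftrightarrow> i = j" for i j
    using permutes_inj[OF p] by (auto dest: injD)
  have "inj_on h (index_pairs N)"
  proof (rule inj_onI)
    fix x y assume *: "x \<in> index_pairs N" "y \<in> index_pairs N" "h x = h y"
    obtain j i j' i' where xy: "x = (j, i)" "y = (j', i')"
      by fastforce
    then have "{p j, p i} = {p j', p i'}"
      using *(3) by (auto simp: h_def max_def min_def split: if_splits)
    then have "j = j' \<and> i = i' \<or> j = i' \<and> i = j'"
      by (auto simp: doubleton_eq_iff inj)
    then show "x = y"
      using *(1,2) by (auto simp: xy index_pairs_def)
  qed
  moreover have "h ` index_pairs N \<subseteq> index_pairs N"
  proof (rule image_subsetI)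
    fix x assume x: "x \<in> index_pairs N"
    obtain a b where ab: "x = (a, b)"
      by fastforce
    then have "a < N" "b < N" "p a \<noteq> p b"
      using x by (auto simp: index_pairs_def inj)
    moreover have "p a < N" "p b < N"
      using permutes_in_image[OF p, of a] permutes_in_image[OF p, of b] calculation by auto
    ultimately show "h x \<in> index_pairs N"
      by (auto simp: ab h_def index_pairs_def)
  qed
  ultimately have bij: "bij_betw h (index_pairs N) (index_pairs N)"
    using endo_inj_surj[of "index_pairs N" h] by (simp add: bij_betw_def)
  have "(\<Prod>(j, i)\<in>index_pairs N. f (p i) (p j)) =
    (\<Prod>(j, i)\<in>index_pairs N. of_int (sgn (int (p j) - int (p i))) * (case h (j, i) of (b, a) \<Rightarrow> f a b))"
  proof (intro prod.cong refl, clarify)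
    fix j i assume "(j, i) \<in> index_pairs N"
    then have "p i \<noteq> p j"
      by (auto simp: index_pairs_def inj)
    then consider "p i < p j" | "p j < p i"
      by linarith
    then show "f (p i) (p j) = of_int (sgn (int (p j) - int (p i))) * (case h (j, i) of (b, a) \<Rightarrow> f a b)"
    proof cases
      case 1
      then show ?thesis
        by (simp add: h_def)
    next
      case 2
      then show ?thesis
        by (simp add: h_def anti[of "p j" "p i"])
    qed
  qed
  also have "\<dots> = of_int (inversion_sign N p) * (\<Prod>x\<in>index_pairs N. case h x of (b, a) \<Rightarrow> f a b)"
    by (simp add: inversion_sign_def prod.distrib case_prod_unfold)
  also have "(\<Prod>x\<in>index_pairs N. case h x of (b, a) \<Rightarrow> f a b) = (\<Prod>(j, i)\<in>index_pairs N. f i j)"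
    by (rule prod.reindex_bij_betw[OF bij])
  finally show ?thesis .
qed

text \<open>The function \<open>sgn (q j - q i)\<close> is itself antisymmetric, so the preceding
  lemma applies to it.\<close>

lemma inversion_sign_compose:
  assumes "p permutes {..<N}"
  shows "inversion_sign N (q \<circ> p) = inversion_sign N p * inversion_sign N q"
proof -
  have "sgn (int (q i) - int (q j)) = - sgn (int (q j) - int (q i))" for i j
    by (simp add: sgn_if)
  note * = prod_index_pairs_permute[where f = "\<lambda>i j. sgn (int (q j) - int (q i))", OF assms this]
  show ?thesis
    using * by (simp add: inversion_sign_def)
qed

text \<open>All transpositions are conjugate to that of 0 and 1, whose only inversion is the pair
  \<open>(1, 0)\<close>. By multiplicativity the conjugating \<open>\<pi>\<close> cancels.\<close>

lemma inversion_sign_transpose: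
  assumes ab: "a < N" "b < N" "a \<noteq> b"
  shows "inversion_sign N (Transposition.transpose a b) = - 1"
proof -
  let ?t = "Transposition.transpose :: nat \<Rightarrow> nat \<Rightarrow> nat \<Rightarrow> nat"
  \<comment> \<open>\<open>\<pi>\<close> has to send 0 to \<open>a\<close> and 1 to
    \<open>b\<close>. The first transposition takes 1 to \<open>c\<close>; the second corrects this
    to \<open>b\<close> and fixes \<open>a\<close>.\<close>
  define c where "c = ?t 0 a 1"
  define \<pi> where "\<pi> = ?t c b \<circ> ?t 0 a"
  have N: "0 < N" "1 < N"
    using ab by auto
  then have cN: "c < N" "c \<noteq> a"
    using ab by (auto simp: c_def Transposition.transpose_def)
  have \<pi>: "\<pi> permutes {..<N}"
    unfolding \<pi>_def using N cN ab by (intro permutes_compose permutes_swap_id) auto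
  have "\<pi> 0 = a"
    using cN ab by (simp add: \<pi>_def Transposition.transpose_def)
  moreover have "\<pi> 1 = b"
    unfolding \<pi>_def comp_apply c_def[symmetric] by (simp add: Transposition.transpose_def)
  ultimately have "?t a b \<circ> \<pi> = \<pi> \<circ> ?t 0 1"
    using permutes_inj[OF \<pi>] by (auto simp: fun_eq_iff Transposition.transpose_def dest: injD)
  moreover have t01: "?t 0 1 permutes {..<N}"
    using N by (intro permutes_swap_id) auto
  ultimately have "inversion_sign N \<pi> * inversion_sign N (?t a b) = inversion_sign N (?t 0 1) * inversion_sign N \<pi>"
    using inversion_sign_compose[OF \<pi>, of "?t a b"] inversion_sign_compose[OF t01, of \<pi>] by simp
  moreover have "inversion_sign N \<pi> \<noteq> 0"
    using permutes_inj[OF \<pi>] by (auto simp: inversion_sign_def index_pairs_def sgn_if dest: injD)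
  moreover have "inversion_sign N (?t 0 1) = - 1"
  proof -
    have "inversion_sign N (?t 0 1) = (\<Prod>(j, i)\<in>index_pairs N. if (j, i) = (1, 0) then - 1 else 1)"
      unfolding inversion_sign_def
      by (intro prod.cong refl) (auto simp: index_pairs_def Transposition.transpose_def sgn_if)
    also have "\<dots> = - 1"
      using N by (subst prod.remove[of _ "(1, 0)"]) (auto simp: index_pairs_def intro!: prod.neutral split: if_splits)
    finally show ?thesis .
  qed
  ultimately show ?thesis
    by (simp add: mult.commute)
qed

lemma inversion_sign_eq_sign:
  assumes "p permutes {..<N}"
  shows "inversion_sign N p = sign p"
  using assms finite_lessThan
proof (induction rule: permutes_induct)
  case id
  show ?case
    unfolding inversion_sign_def sign_id by (intro prod.neutral) (auto simp: index_pairs_def)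
next
  case (swap a b p)
  have "sign (Transposition.transpose a b \<circ> p) = sign (Transposition.transpose a b) * sign p"
    by (intro sign_compose permutation_swap_id) (use swap in \<open>auto simp: permutation_permutes\<close>)
  moreover have "inversion_sign N (Transposition.transpose a b \<circ> p) = inversion_sign N p * inversion_sign N (Transposition.transpose a b)"
    using swap by (intro inversion_sign_compose)
  moreover have "inversion_sign N (Transposition.transpose a b) = - 1"
    using swap by (intro inversion_sign_transpose) auto
  moreover have "sign (Transposition.transpose a b) = - 1"
    using swap by (simp add: sign_swap_id)
  ultimately show ?case
    using swap(5) by (simp only: mult.commute)
qed

text \<open>Passes from indices to the set of values, on which \<open>npf\<close> and
  \<open>split_sum\<close> are defined. The map is injective between finite sets of equal size,
  hence bijective.\<close>

lemma sum_permutes_eq_orderings: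
  fixes u :: "nat \<Rightarrow> 'a" and f :: "'a list \<Rightarrow> 'b::comm_monoid_add"
  assumes u: "inj_on u {..<N}"
  shows "(\<Sum>\<sigma> | \<sigma> permutes {..<N}. f (map (\<lambda>i. u (\<sigma> i)) [0..<N])) = (\<Sum>xs\<in>permutations_of_set (u ` {..<N}). f xs)"
proof -
  let ?h = "\<lambda>\<sigma>. map (\<lambda>i. u (\<sigma> i)) [0..<N]" and ?S = "{\<sigma>. \<sigma> permutes {..<N}}"
  have "inj_on ?h ?S"
  proof (rule inj_onI, clarify)
    fix \<sigma> \<tau> assume st: "\<sigma> permutes {..<N}" "\<tau> permutes {..<N}" "?h \<sigma> = ?h \<tau>"
    have "\<sigma> i = \<tau> i" for i
    proof (cases "i < N")
      case True
      then have "u (\<sigma> i) = u (\<tau> i)"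
        using st(3) by (simp add: list_eq_iff_nth_eq)
      moreover have "\<sigma> i < N" "\<tau> i < N"
        using permutes_in_image[OF st(1), of i] permutes_in_image[OF st(2), of i] True by auto
      ultimately show ?thesis
        using u by (auto dest: inj_onD)
    next
      case False
      then show ?thesis
        using st by (auto simp: permutes_def)
    qed
    then show "\<sigma> = \<tau>"
      by blast
  qed
  moreover have "?h ` ?S \<subseteq> permutations_of_set (u ` {..<N})"
  proof clarify
    fix \<sigma> assume s: "\<sigma> permutes {..<N}"
    have "inj_on (u \<circ> \<sigma>) {..<N}"
      using u permutes_inj_on[OF s] permutes_image[OF s] by (intro comp_inj_on) auto
    moreover have "(u \<circ> \<sigma>) ` {..<N} = u ` {..<N}"
      unfolding image_comp[symmetric] permutes_image[OF s] ..
    ultimately show "?h \<sigma> \<in> permutations_of_set (u ` {..<N})"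
      by (intro permutations_of_setI) (auto simp: distinct_map atLeast0LessThan comp_def)
  qed
  moreover have "card ?S = card (permutations_of_set (u ` {..<N}))"
    using u by (simp add: card_permutations card_image)
  ultimately have "bij_betw ?h ?S (permutations_of_set (u ` {..<N}))"
    using card_subset_eq[of "permutations_of_set (u ` {..<N})" "?h ` ?S"]
    by (intro bij_betw_imageI) (simp_all only: card_image finite_permutations_of_set)
  then show ?thesis
    by (rule sum.reindex_bij_betw)
qed

lemma sum_orderings_Cons:
  assumes "finite A" "A \<noteq> {}"
  shows "(\<Sum>xs\<in>permutations_of_set A. f xs) = (\<Sum>x\<in>A. \<Sum>xs\<in>permutations_of_set (A - {x}). f (x # xs))"
  unfolding permutations_of_set_nonempty[OF assms(2)]
  using assms(1) by (subst sum.UNION_disjoint) (auto simp: sum.reindex)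

section \<open>Products over pairs of entries and the Pfaffian\<close>

definition pair_prod :: "('a \<Rightarrow> 'a \<Rightarrow> complex) \<Rightarrow> 'a list \<Rightarrow> complex" where
  "pair_prod f xs = (\<Prod>j<length xs. \<Prod>i<j. f (xs ! i) (xs ! j))"

lemma pair_prod_Nil [simp]: "pair_prod f [] = 1"
  by (simp add: pair_prod_def)

lemma pair_prod_Cons:
  assumes "distinct xs"
  shows "pair_prod f (x # xs) = (\<Prod>z\<in>set xs. f x z) * pair_prod f xs"
proof -
  have "pair_prod f (x # xs) = (\<Prod>j<length xs. f x (xs ! j) * (\<Prod>i<j. f (xs ! i) (xs ! j)))"
    by (simp only: pair_prod_def list.size add_0_right add_Suc_right prod.lessThan_Suc_shift) simp
  also have "(\<Prod>j<length xs. f x (xs ! j)) = (\<Prod>z\<in>set xs. f x z)"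
    using assms by (intro prod.reindex_bij_betw bij_betw_nth) auto
  then have "(\<Prod>j<length xs. f x (xs ! j) * (\<Prod>i<j. f (xs ! i) (xs ! j))) = (\<Prod>z\<in>set xs. f x z) * pair_prod f xs"
    by (simp add: prod.distrib pair_prod_def)
  finally show ?thesis .
qed

text \<open>Read as \<open>n\<close> consecutive pairs, the orderings give every perfect matching
  \<open>2^n n!\<close> times. The \<open>phi\<close> inside the pairs turn matrix entries
  \<open>v\<close> into weights \<open>w\<close>; the others are those of
  \<open>npf\<close>.\<close>

lemma sum_orderings_npf:
  assumes phi: "\<And>x y. x \<in> X \<Longrightarrow> y \<in> X \<Longrightarrow> x \<noteq> y \<Longrightarrow> phi t x y * v x y = w x y"
    and X: "finite X" "card X = 2 * n"
  shows "(\<Sum>xs\<in>permutations_of_set X. pair_prod (phi t) xs * (\<Prod>i<n. v (xs ! (2 * i)) (xs ! (2 * i + 1)))) =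
    2 ^ n * fact n * npf t w n X"
  using assms
proof (induction n arbitrary: X)
  case 0
  then show ?case
    by simp
next
  case (Suc n)
  let ?F = "\<lambda>n xs. pair_prod (phi t) xs * (\<Prod>i<n. v (xs ! (2 * i)) (xs ! (2 * i + 1)))"
  have "(\<Sum>xs\<in>permutations_of_set X. ?F (Suc n) xs) =
    (\<Sum>x\<in>X. \<Sum>y\<in>X - {x}. \<Sum>xs\<in>permutations_of_set (X - {x} - {y}). ?F (Suc n) (x # y # xs))"
  proof -
    have "X - {x} \<noteq> {}" if "x \<in> X" for x
    proof
      assume "X - {x} = {}"
      then have "X = {x}"
        using that by auto
      then show False
        using Suc.prems(3) by simp
    qed
    moreover have "X \<noteq> {}"
      using Suc.prems by auto
    ultimately show ?thesis
      using Suc.prems(2)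
      by (subst sum_orderings_Cons, simp_all only: finite_Diff not_False_eq_True)
        (rule sum.cong[OF refl], rule sum_orderings_Cons, auto)
  qed
  also have "\<dots> = (\<Sum>x\<in>X. \<Sum>y\<in>X - {x}. 2 ^ n * fact n *
    (w x y * (\<Prod>z\<in>X - {x, y}. phi t x z * phi t y z) * npf t w n (X - {x, y})))"
  proof (intro sum.cong refl)
    fix x y assume xy: "x \<in> X" "y \<in> X - {x}"
    define V where "V = X - {x, y}"
    have V: "finite V" "card V = 2 * n" and XV: "X - {x} - {y} = V"
      using xy Suc.prems by (auto simp: V_def)
    have "?F (Suc n) (x # y # xs) = w x y * (\<Prod>z\<in>V. phi t x z * phi t y z) * ?F n xs" if "xs \<in> permutations_of_set V" for xs
    proof -
      have xs: "set xs = V" "distinct xs"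
        using that by (auto dest: permutations_of_setD)
      then have 1: "pair_prod (phi t) (x # y # xs) = phi t x y * (\<Prod>z\<in>V. phi t x z * phi t y z) * pair_prod (phi t) xs"
        using V xy by (simp add: pair_prod_Cons V_def prod.distrib)
      have 2: "(\<Prod>i<Suc n. v ((x # y # xs) ! (2 * i)) ((x # y # xs) ! (2 * i + 1))) =
        v x y * (\<Prod>i<n. v (xs ! (2 * i)) (xs ! (2 * i + 1)))"
        unfolding prod.lessThan_Suc_shift by simp
      have 3: "w x y = phi t x y * v x y"
        using Suc.prems(1)[of x y] xy by auto
      show ?thesis
        unfolding 1 2 3 by (simp only: mult_ac)
    qed
    then have "(\<Sum>xs\<in>permutations_of_set V. ?F (Suc n) (x # y # xs)) =
      w x y * (\<Prod>z\<in>V. phi t x z * phi t y z) * (\<Sum>xs\<in>permutations_of_set V. ?F n xs)"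
      unfolding sum_distrib_left by (rule sum.cong[OF refl])
    also have "(\<Sum>xs\<in>permutations_of_set V. ?F n xs) = 2 ^ n * fact n * npf t w n V"
      using V Suc.prems(1) by (intro Suc.IH) (auto simp: V_def)
    finally show "(\<Sum>xs\<in>permutations_of_set (X - {x} - {y}). ?F (Suc n) (x # y # xs)) = 2 ^ n * fact n *
      (w x y * (\<Prod>z\<in>X - {x, y}. phi t x z * phi t y z) * npf t w n (X - {x, y}))"
      unfolding XV V_def[symmetric] by (simp only: mult_ac)
  qed
  also have "\<dots> = 2 ^ n * fact n * (2 * of_nat (Suc n) * npf t w (Suc n) X)"
  proof -
    have "2 * of_nat (Suc n) * npf t w (Suc n) X =
      (\<Sum>x\<in>X. \<Sum>y\<in>X - {x}. w x y * (\<Prod>z\<in>X - {x, y}. phi t x z * phi t y z) * npf t w n (X - {x, y}))"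
      unfolding npf.simps(2) times_divide_eq_right
      by (rule nonzero_mult_div_cancel_left) (simp del: of_nat_Suc)
    then show ?thesis
      by (simp only: sum_distrib_left)
  qed
  also have "\<dots> = 2 ^ Suc n * fact (Suc n) * npf t w (Suc n) X"
    unfolding fact_Suc by (simp add: mult_ac del: of_nat_Suc)
  finally show ?case .
qed

text \<open>Permuting the arguments of the prefactor by \<open>\<sigma>\<close> produces
  \<open>sign \<sigma>\<close>, so each term of the Pfaffian becomes a signless term indexed by an
  ordering of the variables.\<close>

lemma prod_phi_pfaffian:
  assumes u: "inj_on u {..<2 * n}"
    and phi: "\<And>i j. i < 2 * n \<Longrightarrow> j < 2 * n \<Longrightarrow> i \<noteq> j \<Longrightarrow> phi t (u i) (u j) \<noteq> 0"
    and sym: "\<And>x y. w x y = w y x"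
    and a: "\<And>i j. i < j \<Longrightarrow> j < 2 * n \<Longrightarrow> a i j = w (u i) (u j) / phi t (u i) (u j)"
  shows "(\<Prod>j<2 * n. \<Prod>i<j. phi t (u i) (u j)) * pfaffian n a = npf t w n (u ` {..<2 * n})"
proof -
  let ?N = "2 * n"
  define v where "v x y = w x y / phi t x y" for x y
  have anti: "antisym_matrix a i j = v (u i) (u j)" if "i < ?N" "j < ?N" "i \<noteq> j" for i j
    using that a[of i j] a[of j i] sym[of "u i" "u j"] phi_antisym[of t "u i" "u j"]
    by (auto simp: antisym_matrix_def v_def)
  have "(\<Prod>j<?N. \<Prod>i<j. phi t (u i) (u j)) * (of_int (sign \<sigma>) * (\<Prod>i<n. antisym_matrix a (\<sigma> (2 * i)) (\<sigma> (2 * i + 1)))) =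
    pair_prod (phi t) (map (\<lambda>i. u (\<sigma> i)) [0..<?N]) *
      (\<Prod>i<n. v (map (\<lambda>i. u (\<sigma> i)) [0..<?N] ! (2 * i)) (map (\<lambda>i. u (\<sigma> i)) [0..<?N] ! (2 * i + 1)))"
    if s: "\<sigma> permutes {..<?N}" for \<sigma>
  proof -
    have "(\<Prod>j<?N. \<Prod>i<j. phi t (u (\<sigma> i)) (u (\<sigma> j))) = of_int (sign \<sigma>) * (\<Prod>j<?N. \<Prod>i<j. phi t (u i) (u j))"
      unfolding prod_index_pairs inversion_sign_eq_sign[OF s, symmetric]
      by (rule prod_index_pairs_permute[OF s]) (rule phi_antisym)
    moreover have "pair_prod (phi t) (map (\<lambda>i. u (\<sigma> i)) [0..<?N]) = (\<Prod>j<?N. \<Prod>i<j. phi t (u (\<sigma> i)) (u (\<sigma> j)))"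
      by (simp add: pair_prod_def)
    moreover have "(\<Prod>i<n. antisym_matrix a (\<sigma> (2 * i)) (\<sigma> (2 * i + 1))) =
      (\<Prod>i<n. v (map (\<lambda>i. u (\<sigma> i)) [0..<?N] ! (2 * i)) (map (\<lambda>i. u (\<sigma> i)) [0..<?N] ! (2 * i + 1)))"
    proof (intro prod.cong refl)
      fix i assume "i \<in> {..<n}"
      then have i: "2 * i < ?N" "2 * i + 1 < ?N"
        by auto
      moreover have "\<sigma> (2 * i) \<noteq> \<sigma> (2 * i + 1)"
        using inj_eq[OF permutes_inj[OF s], of "2 * i" "2 * i + 1"] by simp
      moreover have "\<sigma> (2 * i) < ?N" "\<sigma> (2 * i + 1) < ?N"
        using i permutes_in_image[OF s, of "2 * i"] permutes_in_image[OF s, of "2 * i + 1"] by auto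
      ultimately show "antisym_matrix a (\<sigma> (2 * i)) (\<sigma> (2 * i + 1)) =
        v (map (\<lambda>i. u (\<sigma> i)) [0..<?N] ! (2 * i)) (map (\<lambda>i. u (\<sigma> i)) [0..<?N] ! (2 * i + 1))"
        using anti[of "\<sigma> (2 * i)" "\<sigma> (2 * i + 1)"] by simp
    qed
    ultimately show ?thesis
      by (simp only: mult_ac)
  qed
  then have "(\<Prod>j<?N. \<Prod>i<j. phi t (u i) (u j)) *
      (\<Sum>\<sigma> | \<sigma> permutes {..<?N}. of_int (sign \<sigma>) * (\<Prod>i<n. antisym_matrix a (\<sigma> (2 * i)) (\<sigma> (2 * i + 1)))) =
    (\<Sum>\<sigma> | \<sigma> permutes {..<?N}. pair_prod (phi t) (map (\<lambda>i. u (\<sigma> i)) [0..<?N]) *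
      (\<Prod>i<n. v (map (\<lambda>i. u (\<sigma> i)) [0..<?N] ! (2 * i)) (map (\<lambda>i. u (\<sigma> i)) [0..<?N] ! (2 * i + 1))))"
    unfolding sum_distrib_left by (intro sum.cong refl) blast
  also have "\<dots> = (\<Sum>xs\<in>permutations_of_set (u ` {..<?N}). pair_prod (phi t) xs * (\<Prod>i<n. v (xs ! (2 * i)) (xs ! (2 * i + 1))))"
    by (rule sum_permutes_eq_orderings[OF u])
  also have "\<dots> = 2 ^ n * fact n * npf t w n (u ` {..<?N})"
  proof (rule sum_orderings_npf)
    fix x y assume xy: "x \<in> u ` {..<?N}" "y \<in> u ` {..<?N}" "x \<noteq> y"
    then have "phi t x y \<noteq> 0"
      using phi by fastforce
    then show "phi t x y * v x y = w x y"
      by (simp add: v_def)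
  qed (use u in \<open>auto simp: card_image\<close>)
  finally show ?thesis
    by (simp add: pfaffian_def)
qed

subsection \<open>Splitting off the vanishing parts of a signature\<close>

text \<open>The mechanism of the splitting identity again: multiplied by \<open>Q z\<close>, the sum
  becomes a polynomial of degree at most \<open>|Y|\<close> in the inserted element
  \<open>z\<close>. It vanishes on \<open>Y\<close>, so it is proportional to
  \<open>Q\<close>.\<close>

lemma sum_prod_theta_insert:
  assumes Y: "finite Y" and a: "a \<notin> Y" and b: "b \<notin> Y"
  shows "(\<Sum>x\<in>insert a Y. \<Prod>w\<in>insert a Y - {x}. theta t x w) = (\<Sum>x\<in>insert b Y. \<Prod>w\<in>insert b Y - {x}. theta t x w)"
proof -
  define S where "S z = (\<Sum>x\<in>insert z Y. \<Prod>w\<in>insert z Y - {x}. theta t x w)" for z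
  define Q where "Q z = (\<Prod>y\<in>Y. z - y)" for z
  define D where "D z = (\<Prod>y\<in>Y. z - t * y) - (\<Sum>y\<in>Y. (y - t * z) * (\<Prod>w\<in>Y - {y}. theta t y w * (z - w)))" for z
  have D_S: "D z = Q z * S z" if z: "z \<notin> Y" for z
  proof -
    have "S z = (\<Prod>y\<in>Y. theta t z y) + (\<Sum>y\<in>Y. \<Prod>w\<in>insert z Y - {y}. theta t y w)"
      unfolding S_def using Y z by simp
    moreover have "Q z * (\<Prod>y\<in>Y. theta t z y) = (\<Prod>y\<in>Y. z - t * y)"
      unfolding Q_def prod.distrib[symmetric] using z by (intro prod.cong) (auto simp: theta_def)
    moreover have "Q z * (\<Prod>w\<in>insert z Y - {y}. theta t y w) = - ((y - t * z) * (\<Prod>w\<in>Y - {y}. theta t y w * (z - w)))"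
      if y: "y \<in> Y" for y
    proof -
      have "insert z Y - {y} = insert z (Y - {y})" "z \<noteq> y"
        using y z by auto
      moreover have "(z - y) * theta t y z = - (y - t * z)"
        using \<open>z \<noteq> y\<close> by (simp add: theta_def divide_simps) (simp add: algebra_simps)
      moreover have "Q z = (z - y) * (\<Prod>w\<in>Y - {y}. z - w)"
        unfolding Q_def using Y y by (rule prod.remove)
      ultimately have "Q z * (\<Prod>w\<in>insert z Y - {y}. theta t y w) =
          ((z - y) * theta t y z) * ((\<Prod>w\<in>Y - {y}. z - w) * (\<Prod>w\<in>Y - {y}. theta t y w))"
        using Y z by simp
      also have "\<dots> = - ((y - t * z) * (\<Prod>w\<in>Y - {y}. theta t y w * (z - w)))"
        unfolding \<open>(z - y) * theta t y z = _\<close> by (simp only: prod.distrib mult_minus_left mult_ac)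
      finally show ?thesis .
    qed
    ultimately show ?thesis
      by (simp add: D_def distrib_left sum_distrib_left sum_negf)
  qed
  have D_0: "D q = 0" if q: "q \<in> Y" for q
  proof -
    have "(\<Sum>y\<in>Y. (y - t * q) * (\<Prod>w\<in>Y - {y}. theta t y w * (q - w))) =
      (q - t * q) * (\<Prod>w\<in>Y - {q}. theta t q w * (q - w))"
    proof -
      have "(\<Prod>w\<in>Y - {y}. theta t y w * (q - w)) = 0" if "y \<in> Y - {q}" for y
        using that q Y by (intro prod_zero) auto
      then have "(\<Sum>y\<in>Y - {q}. (y - t * q) * (\<Prod>w\<in>Y - {y}. theta t y w * (q - w))) = 0"
        by (intro sum.neutral ballI) (simp only: mult_zero_right)
      then show ?thesis
        unfolding sum.remove[OF Y q] by simp
    qed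
    also have "(\<Prod>w\<in>Y - {q}. theta t q w * (q - w)) = (\<Prod>w\<in>Y - {q}. q - t * w)"
      by (intro prod.cong refl) (auto simp: theta_def)
    also have "(q - t * q) * \<dots> = (\<Prod>w\<in>Y. q - t * w)"
      using Y q by (simp add: prod.remove)
    finally show ?thesis
      by (simp add: D_def)
  qed
  have "polyfn (card Y) D"
    unfolding D_def
  proof (intro polyfn_diff polyfn_sum)
    show "polyfn (card Y) (\<lambda>z. \<Prod>y\<in>Y. z - t * y)"
    proof -
      have "polyfn (card Y * 1) (\<lambda>z. \<Prod>y\<in>Y. z - t * y)"
        by (intro polyfn_prod polyfn_linear)
      then show ?thesis
        by simp
    qed
    fix y assume y: "y \<in> Y"
    have "polyfn (1 + card (Y - {y}) * (0 + 1)) (\<lambda>z. (y - t * z) * (\<Prod>w\<in>Y - {y}. theta t y w * (z - w)))"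
      by (intro polyfn_mult polyfn_prod polyfn_linear polyfn_const)
    moreover have "1 + card (Y - {y}) = card Y"
      using Y y card_Suc_Diff1[of Y y] by simp
    ultimately show "polyfn (card Y) (\<lambda>z. (y - t * z) * (\<Prod>w\<in>Y - {y}. theta t y w * (z - w)))"
      by simp
  qed
  moreover have "polyfn (card Y) Q"
  proof -
    have "polyfn (card Y * 1) Q"
      unfolding Q_def by (intro polyfn_prod polyfn_linear)
    then show ?thesis
      by simp
  qed
  ultimately have "polyfn (card Y) (\<lambda>z. Q b * D z - D b * Q z)"
    by (intro polyfn_diff polyfn_cmult)
  moreover have "Q q = 0" if "q \<in> Y" for q
    unfolding Q_def using that Y by (intro prod_zero) auto
  ultimately have "Q b * D a - D b * Q a = 0"
    using Y b D_0 by (elim polyfn_eq_0[of _ _ "insert b Y"]) auto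
  then have "Q a * Q b * (S a - S b) = 0"
    by (simp add: D_S[OF a] D_S[OF b] algebra_simps)
  moreover have "Q z \<noteq> 0" if "z \<notin> Y" for z
    using that Y by (auto simp: Q_def)
  ultimately show ?thesis
    using a b unfolding S_def by auto
qed

text \<open>Any one element may be replaced by 0 (if 0 is present, it is the one chosen). For
  nonzero \<open>w\<close> and \<open>x\<close>, \<open>theta t 0 w = t\<close> and
  \<open>theta t x 0 = 1\<close>, so a further element next to \<open>n\<close> others adds
  \<open>t^n\<close> to the sum.\<close>

lemma sum_prod_theta:
  assumes t: "t \<noteq> 1" and "finite X"
  shows "(\<Sum>x\<in>X. \<Prod>w\<in>X - {x}. theta t x w) = (1 - t ^ card X) / (1 - t)"
  using assms(2)
proof (induction "card X" arbitrary: X)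
  case 0
  then show ?case
    by simp
next
  case (Suc n)
  obtain x where x: "x \<in> X" "0 \<in> X \<Longrightarrow> x = 0"
    using Suc.hyps(2) by (metis card.empty ex_in_conv nat.simps(3))
  define Y where "Y = X - {x}"
  have Y: "finite Y" "x \<notin> Y" "0 \<notin> Y" "card Y = n" and XY: "X = insert x Y"
    using Suc x by (auto simp: Y_def)
  have "(\<Sum>x\<in>X. \<Prod>w\<in>X - {x}. theta t x w) = (\<Sum>x\<in>insert 0 Y. \<Prod>w\<in>insert 0 Y - {x}. theta t x w)"
    unfolding XY using Y by (intro sum_prod_theta_insert)
  also have "\<dots> = (\<Prod>w\<in>Y. theta t 0 w) + (\<Sum>x\<in>Y. \<Prod>w\<in>insert 0 Y - {x}. theta t x w)"
    using Y by simp
  also have "(\<Prod>w\<in>Y. theta t 0 w) = (\<Prod>w\<in>Y. t)"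
    using Y by (intro prod.cong refl) (auto simp: theta_def)
  also have "(\<Sum>x\<in>Y. \<Prod>w\<in>insert 0 Y - {x}. theta t x w) = (\<Sum>x\<in>Y. \<Prod>w\<in>Y - {x}. theta t x w)"
  proof (intro sum.cong refl)
    fix x assume x: "x \<in> Y"
    then have "insert 0 Y - {x} = insert 0 (Y - {x})" "x \<noteq> 0"
      using Y by auto
    then show "(\<Prod>w\<in>insert 0 Y - {x}. theta t x w) = (\<Prod>w\<in>Y - {x}. theta t x w)"
      using Y by (simp add: theta_def)
  qed
  also have "\<dots> = (1 - t ^ n) / (1 - t)"
    using Suc.hyps(1)[of Y] Y by simp
  finally show ?case
    using Y t Suc.hyps(2)[symmetric] by (simp add: field_simps)
qed

text \<open>The classical normalisation of Hall-Littlewood polynomials, a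
  \<open>t\<close>-factorial, by induction on the first entry of the ordering.\<close>

lemma sum_orderings_theta:
  assumes t: "t \<noteq> 1" and "finite X"
  shows "(\<Sum>xs\<in>permutations_of_set X. pair_prod (theta t) xs) = qpoch t t (card X) / (1 - t) ^ card X"
  using assms(2)
proof (induction "card X" arbitrary: X)
  case 0
  then show ?case
    by (simp add: qpoch_def)
next
  case (Suc n)
  then have "X \<noteq> {}"
    by auto
  then have "(\<Sum>xs\<in>permutations_of_set X. pair_prod (theta t) xs) =
    (\<Sum>x\<in>X. \<Sum>xs\<in>permutations_of_set (X - {x}). pair_prod (theta t) (x # xs))"
    using Suc.prems by (intro sum_orderings_Cons)
  also have "\<dots> = (\<Sum>x\<in>X. (\<Prod>w\<in>X - {x}. theta t x w) * (qpoch t t n / (1 - t) ^ n))"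
  proof (intro sum.cong refl)
    fix x assume x: "x \<in> X"
    have "(\<Sum>xs\<in>permutations_of_set (X - {x}). pair_prod (theta t) (x # xs)) =
      (\<Sum>xs\<in>permutations_of_set (X - {x}). (\<Prod>w\<in>X - {x}. theta t x w) * pair_prod (theta t) xs)"
      by (intro sum.cong refl) (auto simp: pair_prod_Cons permutations_of_setD)
    also have "\<dots> = (\<Prod>w\<in>X - {x}. theta t x w) * (qpoch t t n / (1 - t) ^ n)"
    proof -
      have c: "card (X - {x}) = n"
        using Suc.hyps(2) Suc.prems x by simp
      then show ?thesis
        using Suc.hyps(1)[OF c[symmetric]] Suc.prems by (simp only: sum_distrib_left[symmetric] c finite_Diff)
    qed
    finally show "(\<Sum>xs\<in>permutations_of_set (X - {x}). pair_prod (theta t) (x # xs)) =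
      (\<Prod>w\<in>X - {x}. theta t x w) * (qpoch t t n / (1 - t) ^ n)" .
  qed
  also have "\<dots> = (1 - t ^ Suc n) / (1 - t) * (qpoch t t n / (1 - t) ^ n)"
    unfolding sum_distrib_right[symmetric] sum_prod_theta[OF t Suc.prems] Suc.hyps(2)[symmetric] ..
  also have "\<dots> = qpoch t t (Suc n) / (1 - t) ^ Suc n"
    by (simp add: qpoch_def mult_ac)
  finally show ?case
    by (simp only: Suc.hyps(2)[symmetric])
qed

section \<open>Spin Hall-Littlewood functions as sums over orderings\<close>

definition HL_weight :: "complex \<Rightarrow> (nat \<Rightarrow> complex) \<Rightarrow> nat \<Rightarrow> complex \<Rightarrow> complex" where
  "HL_weight t s k x = (1 - t) / (1 - s k * x) * (\<Prod>j<k. (x - s j) / (1 - s j * x))"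

definition HL_set :: "complex \<Rightarrow> (nat \<Rightarrow> complex) \<Rightarrow> nat list \<Rightarrow> complex set \<Rightarrow> complex" where
  "HL_set t s lam X =
     (\<Sum>xs\<in>permutations_of_set X. pair_prod (theta t) xs * (\<Prod>i<length lam. HL_weight t s (lam ! i) (xs ! i)))"

lemma spin_HL_eq_HL_set:
  assumes "inj_on u {..<length lam}"
  shows "spin_HL t s lam u = HL_set t s lam (u ` {..<length lam})"
proof -
  have "spin_HL t s lam u = (\<Sum>\<sigma> | \<sigma> permutes {..<length lam}.
    pair_prod (theta t) (map (\<lambda>i. u (\<sigma> i)) [0..<length lam]) *
    (\<Prod>i<length lam. HL_weight t s (lam ! i) (map (\<lambda>i. u (\<sigma> i)) [0..<length lam] ! i)))"
    unfolding spin_HL_def pair_prod_def theta_def HL_weight_def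
    by (intro sum.cong refl arg_cong2[where f = "(*)"] prod.cong) auto
  also have "\<dots> = HL_set t s lam (u ` {..<length lam})"
    unfolding HL_set_def by (rule sum_permutes_eq_orderings[OF assms])
  finally show ?thesis .
qed

lemma pair_prod_append:
  "distinct (ys @ zs) \<Longrightarrow> pair_prod f (ys @ zs) =
    pair_prod f ys * pair_prod f zs * (\<Prod>y\<in>set ys. \<Prod>z\<in>set zs. f y z)"
  by (induction ys) (auto simp: pair_prod_Cons prod.union_disjoint mult_ac)

text \<open>\<open>I\<close> collects the last \<open>m\<close> entries; in a decreasing signature
  with \<open>m\<close> zeros these are the variables carrying the zero parts.\<close>

lemma sum_orderings_append:
  fixes f :: "'a list \<Rightarrow> 'b::comm_monoid_add"
  assumes X: "finite X" "m \<le> card X"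
  shows "(\<Sum>xs\<in>permutations_of_set X. f xs) =
    (\<Sum>I | I \<subseteq> X \<and> card I = m. \<Sum>ys\<in>permutations_of_set (X - I). \<Sum>zs\<in>permutations_of_set I. f (ys @ zs))"
proof -
  let ?k = "card X - m"
  let ?P = "\<lambda>I. permutations_of_set (X - I) \<times> permutations_of_set I"
  have "(\<Sum>I | I \<subseteq> X \<and> card I = m. \<Sum>ys\<in>permutations_of_set (X - I). \<Sum>zs\<in>permutations_of_set I. f (ys @ zs)) =
    (\<Sum>I | I \<subseteq> X \<and> card I = m. \<Sum>(ys, zs)\<in>?P I. f (ys @ zs))"
    by (simp add: sum.cartesian_product)
  also have "\<dots> = (\<Sum>(I, ys, zs)\<in>(SIGMA I:{I. I \<subseteq> X \<and> card I = m}. ?P I). f (ys @ zs))"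
    using X(1) by (subst sum.Sigma) auto
  also have "\<dots> = (\<Sum>xs\<in>permutations_of_set X. f xs)"
  proof (rule sum.reindex_bij_witness[where i = "\<lambda>xs. (set (drop ?k xs), take ?k xs, drop ?k xs)"
        and j = "\<lambda>(I, ys, zs). ys @ zs"])
    fix a assume "a \<in> (SIGMA I:{I. I \<subseteq> X \<and> card I = m}. ?P I)"
    then obtain I ys zs where a: "a = (I, ys, zs)" "I \<subseteq> X" "card I = m"
      "ys \<in> permutations_of_set (X - I)" "zs \<in> permutations_of_set I"
      by auto
    have "length ys = ?k"
      using a X by (simp add: length_finite_permutations_of_set card_Diff_subset finite_subset)
    then show "(set (drop ?k (case a of (I, ys, zs) \<Rightarrow> ys @ zs)), take ?k (case a of (I, ys, zs) \<Rightarrow> ys @ zs),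
        drop ?k (case a of (I, ys, zs) \<Rightarrow> ys @ zs)) = a"
      using a by (simp add: permutations_of_setD)
    show "(case a of (I, ys, zs) \<Rightarrow> ys @ zs) \<in> permutations_of_set X"
      using a by (auto simp: permutations_of_set_def)
    show "f (case a of (I, ys, zs) \<Rightarrow> ys @ zs) = (case a of (I, ys, zs) \<Rightarrow> f (ys @ zs))"
      by (simp add: a)
  next
    fix xs assume xs: "xs \<in> permutations_of_set X"
    then have s: "set xs = X" "distinct xs" "length xs = card X"
      using length_finite_permutations_of_set[OF xs] by (auto dest: permutations_of_setD)
    show "(case (set (drop ?k xs), take ?k xs, drop ?k xs) of (I, ys, zs) \<Rightarrow> ys @ zs) = xs"
      by simp
    have "set (drop ?k xs) \<subseteq> X"
      using s set_drop_subset by fastforce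
    moreover have "card (set (drop ?k xs)) = m"
      using s X by (simp add: distinct_card distinct_drop)
    moreover have "set (take ?k xs) = X - set (drop ?k xs)"
      using s set_take_disj_set_drop_if_distinct[of xs ?k ?k] append_take_drop_id[of ?k xs]
      by (metis Diff_cancel Un_Diff Un_empty_right Diff_triv order_refl set_append)
    ultimately show "(set (drop ?k xs), take ?k xs, drop ?k xs) \<in> (SIGMA I:{I. I \<subseteq> X \<and> card I = m}. ?P I)"
      using s by (auto simp: permutations_of_set_def distinct_take distinct_drop)
  qed
  finally show ?thesis ..
qed

lemma prod_lessThan_add:
  fixes f :: "nat \<Rightarrow> 'a::comm_monoid_mult"
  shows "(\<Prod>i<a + b. f i) = (\<Prod>i<a. f i) * (\<Prod>i<b. f (a + i))"
  by (induction b) (simp_all add: mult.assoc)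

lemma prod_nth_permutations_of_set:
  assumes "xs \<in> permutations_of_set X" "length xs = k"
  shows "(\<Prod>i<k. f (xs ! i)) = (\<Prod>x\<in>X. f x)"
  using assms by (intro prod.reindex_bij_betw bij_betw_nth) (auto dest: permutations_of_setD)

text \<open>A nonzero part gives off the factor \<open>(y - s 0) / (1 - s 0 y)\<close> and otherwise
  sees the shifted parameters. The orderings of \<open>I\<close> are summed by
  \<open>sum_orderings_theta\<close>, whose denominator \<open>(1 - t)^m\<close> cancels against the
  weights of the zero parts.\<close>

lemma HL_set_append_zeros:
  assumes t: "t \<noteq> 1" and X: "finite X" "card X = length mu + m"
  shows "HL_set t s (map Suc mu @ replicate m 0) X = qpoch t t m * (\<Sum>I | I \<subseteq> X \<and> card I = m.
    (\<Prod>x\<in>I. 1 / (1 - s 0 * x)) * (\<Prod>y\<in>X - I. (y - s 0) / (1 - s 0 * y)) *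
    (\<Prod>y\<in>X - I. \<Prod>x\<in>I. theta t y x) * HL_set t (s \<circ> Suc) mu (X - I))"
proof -
  let ?k = "length mu"
  let ?lam = "map Suc mu @ replicate m 0"
  have shift: "HL_weight t s (Suc j) y = (y - s 0) / (1 - s 0 * y) * HL_weight t (s \<circ> Suc) j y" for j y
    unfolding HL_weight_def prod.lessThan_Suc_shift by (simp add: mult_ac)
  have split: "(\<Sum>ys\<in>permutations_of_set (X - I). \<Sum>zs\<in>permutations_of_set I. pair_prod (theta t) (ys @ zs) *
      (\<Prod>i<length ?lam. HL_weight t s (?lam ! i) ((ys @ zs) ! i))) =
    qpoch t t m * ((\<Prod>x\<in>I. 1 / (1 - s 0 * x)) * (\<Prod>y\<in>X - I. (y - s 0) / (1 - s 0 * y)) *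
      (\<Prod>y\<in>X - I. \<Prod>x\<in>I. theta t y x) * HL_set t (s \<circ> Suc) mu (X - I))"
    if I: "I \<subseteq> X" "card I = m" for I
  proof -
    let ?A = "(1 - t) ^ m * (\<Prod>x\<in>I. 1 / (1 - s 0 * x))"
    let ?B = "(\<Prod>y\<in>X - I. (y - s 0) / (1 - s 0 * y)) * (\<Prod>y\<in>X - I. \<Prod>x\<in>I. theta t y x)"
    let ?H = "\<lambda>ys. pair_prod (theta t) ys * (\<Prod>i<?k. HL_weight t (s \<circ> Suc) (mu ! i) (ys ! i))"
    have fin: "finite I"
      using I X finite_subset by blast
    have summand: "pair_prod (theta t) (ys @ zs) * (\<Prod>i<length ?lam. HL_weight t s (?lam ! i) ((ys @ zs) ! i)) =
      ?A * ?B * ?H ys * pair_prod (theta t) zs"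
      if ys: "ys \<in> permutations_of_set (X - I)" and zs: "zs \<in> permutations_of_set I" for ys zs
    proof -
      have len: "length ys = ?k" "length zs = m"
        using length_finite_permutations_of_set[OF ys] length_finite_permutations_of_set[OF zs] I X fin
        by (simp_all add: card_Diff_subset)
      have "distinct (ys @ zs)" "set ys = X - I" "set zs = I"
        using ys zs by (auto dest: permutations_of_setD)
      then have pp: "pair_prod (theta t) (ys @ zs) = pair_prod (theta t) ys * pair_prod (theta t) zs * (\<Prod>y\<in>X - I. \<Prod>x\<in>I. theta t y x)"
        by (simp only: pair_prod_append)
      have "(\<Prod>i<length ?lam. HL_weight t s (?lam ! i) ((ys @ zs) ! i)) =
        (\<Prod>i<?k. HL_weight t s (Suc (mu ! i)) (ys ! i)) * (\<Prod>i<m. HL_weight t s 0 (zs ! i))"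
        by (simp add: prod_lessThan_add nth_append len)
      also have "(\<Prod>i<m. HL_weight t s 0 (zs ! i)) = (\<Prod>x\<in>I. HL_weight t s 0 x)"
        using zs len by (intro prod_nth_permutations_of_set)
      also have "\<dots> = (\<Prod>x\<in>I. (1 - t) * (1 / (1 - s 0 * x)))"
        by (simp add: HL_weight_def)
      also have "\<dots> = ?A"
        unfolding prod.distrib using I by simp
      also have "(\<Prod>i<?k. HL_weight t s (Suc (mu ! i)) (ys ! i)) =
        (\<Prod>i<?k. (ys ! i - s 0) / (1 - s 0 * ys ! i)) * (\<Prod>i<?k. HL_weight t (s \<circ> Suc) (mu ! i) (ys ! i))"
        unfolding shift prod.distrib ..
      also have "(\<Prod>i<?k. (ys ! i - s 0) / (1 - s 0 * ys ! i)) = (\<Prod>y\<in>X - I. (y - s 0) / (1 - s 0 * y))"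
        using ys len by (intro prod_nth_permutations_of_set)
      finally show ?thesis
        unfolding pp by (simp only: mult_ac)
    qed
    have "(\<Sum>ys\<in>permutations_of_set (X - I). \<Sum>zs\<in>permutations_of_set I. pair_prod (theta t) (ys @ zs) *
      (\<Prod>i<length ?lam. HL_weight t s (?lam ! i) ((ys @ zs) ! i))) =
      (\<Sum>ys\<in>permutations_of_set (X - I). \<Sum>zs\<in>permutations_of_set I. ?A * ?B * ?H ys * pair_prod (theta t) zs)"
      by (intro sum.cong refl summand)
    also have "\<dots> = ?A * ?B * HL_set t (s \<circ> Suc) mu (X - I) * (\<Sum>zs\<in>permutations_of_set I. pair_prod (theta t) zs)"
      unfolding HL_set_def sum_distrib_left[symmetric] sum_distrib_right[symmetric] ..
    finally show ?thesis
      using t I by (simp add: sum_orderings_theta[OF t fin])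
  qed
  have "HL_set t s ?lam X = (\<Sum>I | I \<subseteq> X \<and> card I = m. \<Sum>ys\<in>permutations_of_set (X - I). \<Sum>zs\<in>permutations_of_set I.
    pair_prod (theta t) (ys @ zs) * (\<Prod>i<length ?lam. HL_weight t s (?lam ! i) ((ys @ zs) ! i)))"
    unfolding HL_set_def using X by (intro sum_orderings_append) auto
  also have "\<dots> = (\<Sum>I | I \<subseteq> X \<and> card I = m. qpoch t t m *
    ((\<Prod>x\<in>I. 1 / (1 - s 0 * x)) * (\<Prod>y\<in>X - I. (y - s 0) / (1 - s 0 * y)) *
      (\<Prod>y\<in>X - I. \<Prod>x\<in>I. theta t y x) * HL_set t (s \<circ> Suc) mu (X - I)))"
    by (intro sum.cong refl split) auto
  finally show ?thesis
    by (simp only: sum_distrib_left)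
qed

section \<open>Even signatures by their number of zeros\<close>

lemma count_list_replicate: "count_list (replicate n x) y = (if x = y then n else 0)"
  by (induction n) auto

lemma prod_nth_eq_prod_count:
  fixes f :: "'a \<Rightarrow> 'b::comm_monoid_mult"
  shows "(\<Prod>p<length xs. f (xs ! p)) = (\<Prod>x\<in>set xs. f x ^ count_list xs x)"
proof -
  have "(\<Prod>p<length xs. f (xs ! p)) = (\<Prod>x\<in>set xs. \<Prod>p | p \<in> {..<length xs} \<and> xs ! p = x. f (xs ! p))"
    by (rule prod.group[symmetric]) auto
  also have "\<dots> = (\<Prod>x\<in>set xs. f x ^ count_list xs x)"
  proof (rule prod.cong[OF refl])
    fix x
    have "card {p. p < length xs \<and> xs ! p = x} = count_list xs x"
      unfolding count_list_eq_length_filter length_filter_conv_card by (intro arg_cong[where f = card]) auto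
    then show "(\<Prod>p | p \<in> {..<length xs} \<and> xs ! p = x. f (xs ! p)) = f x ^ count_list xs x"
      by simp
  qed
  finally show ?thesis .
qed

text \<open>\<open>k\<close> counts pairs of zeros, as only even multiplicities occur. Raising the
  other parts by one matches the shift \<open>s \<circ> Suc\<close>.\<close>

definition add_zeros :: "nat \<Rightarrow> nat list \<Rightarrow> nat list" where
  "add_zeros k mu = map Suc mu @ replicate (2 * k) 0"

lemma length_add_zeros [simp]: "length (add_zeros k mu) = length mu + 2 * k"
  by (simp add: add_zeros_def)

lemma count_add_zeros_0 [simp]: "count_list (add_zeros k mu) 0 = 2 * k"
  by (simp add: add_zeros_def count_list_replicate count_list_0_iff)

lemma count_add_zeros_Suc [simp]: "count_list (add_zeros k mu) (Suc i) = count_list mu i"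
proof -
  have "count_list (map Suc mu) (Suc i) = count_list mu i"
    by (induction mu) auto
  then show ?thesis
    by (simp add: add_zeros_def count_list_replicate)
qed

lemma set_add_zeros: "set (add_zeros k mu) - {0} = Suc ` set mu"
  by (auto simp: add_zeros_def)

lemma sorted_desc_split_zeros:
  fixes lam :: "nat list"
  assumes "sorted_wrt (\<ge>) lam"
  shows "lam = filter (\<lambda>i. i > 0) lam @ replicate (count_list lam 0) 0"
  using assms
proof (induction lam)
  case (Cons x lam)
  show ?case
  proof (cases "x = 0")
    case True
    then have "\<forall>y\<in>set lam. y = 0"
      using Cons.prems by auto
    then have "lam = replicate (length lam) 0" "filter (\<lambda>i. i > 0) lam = []"
      by (auto simp: replicate_length_same filter_empty_conv)
    moreover have "filter ((=) 0) lam = lam"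
      using \<open>\<forall>y\<in>set lam. y = 0\<close> by (intro filter_True) auto
    then have "count_list lam 0 = length lam"
      by (simp add: count_list_eq_length_filter)
    ultimately show ?thesis
      using True by simp
  next
    case False
    then show ?thesis
      using Cons by simp
  qed
qed simp

lemma even_signatures_eq_UN:
  "even_signatures (2 * n) = (\<Union>k\<in>{..n}. add_zeros k ` even_signatures (2 * (n - k)))"
proof (intro equalityI subsetI)
  fix lam assume lam: "lam \<in> even_signatures (2 * n)"
  then have l: "length lam = 2 * n" "sorted_wrt (\<ge>) lam" "\<And>i. even (count_list lam i)"
    by (auto simp: even_signatures_def signatures_def)
  obtain k where k: "count_list lam 0 = 2 * k"
    using l(3)[of 0] by (rule evenE)
  define mu where "mu = map (\<lambda>i. i - 1) (filter (\<lambda>i. i > 0) lam)"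
  have "map Suc mu = filter (\<lambda>i. i > 0) lam"
    unfolding mu_def map_map by (rule map_idI) auto
  then have eq: "lam = add_zeros k mu"
    using sorted_desc_split_zeros[OF l(2)] by (simp add: add_zeros_def k)
  have "sorted_wrt (\<ge>) mu"
    unfolding mu_def sorted_wrt_map
    by (rule sorted_wrt_mono_rel[OF _ sorted_wrt_filter[OF l(2)]]) auto
  moreover have "even (count_list mu i)" for i
    using l(3)[of "Suc i"] by (simp add: eq)
  moreover have "length mu = 2 * (n - k)" "k \<le> n"
    using l(1) by (simp_all add: eq)
  ultimately show "lam \<in> (\<Union>k\<in>{..n}. add_zeros k ` even_signatures (2 * (n - k)))"
    unfolding eq by (auto simp: even_signatures_def signatures_def)
next
  fix lam assume "lam \<in> (\<Union>k\<in>{..n}. add_zeros k ` even_signatures (2 * (n - k)))"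
  then obtain k mu where k: "k \<le> n" "mu \<in> even_signatures (2 * (n - k))" "lam = add_zeros k mu"
    by auto
  then have m: "length mu = 2 * (n - k)" "sorted_wrt (\<ge>) mu" "\<And>i. even (count_list mu i)"
    by (auto simp: even_signatures_def signatures_def)
  have "sorted_wrt (\<ge>) (replicate i (0 :: nat))" for i
    by (induction i) auto
  then have "sorted_wrt (\<ge>) lam"
    using m(2) by (simp add: k(3) add_zeros_def sorted_wrt_append sorted_wrt_map)
  moreover have "even (count_list lam i)" for i
    using m(3) by (cases i) (simp_all add: k(3))
  moreover have "length lam = 2 * n"
    using k m(1) by simp
  ultimately show "lam \<in> even_signatures (2 * n)"
    by (simp add: even_signatures_def signatures_def)
qed

lemma inj_add_zeros: "inj (add_zeros k)"
  by (auto simp: inj_def add_zeros_def)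

lemma even_signatures_0: "even_signatures 0 = {[]}"
  by (auto simp: even_signatures_def signatures_def)

text \<open>\<open>P_summand\<close> as a function of the set of variables, and its specialisation to \<open>\<gamma> = 1\<close>.\<close>
definition P_term :: "complex \<Rightarrow> complex \<Rightarrow> (nat \<Rightarrow> complex) \<Rightarrow> complex set \<Rightarrow> nat list \<Rightarrow> complex" where
  "P_term t \<gamma> s X lam =
     qpoch (\<gamma> * t) t (count_list lam 0) / qpoch t t (count_list lam 0) *
     (\<Prod>j = 1..count_list lam 0 div 2.
        (1 - (s 0)\<^sup>2 * \<gamma> * t ^ (2 * j - 2)) / (1 - \<gamma> * t ^ (2 * j))) *
     (\<Prod>i \<in> set lam - {0}. \<Prod>j = 1..count_list lam i div 2.
        (1 - (s i)\<^sup>2 * t ^ (2 * j - 2)) / (1 - t ^ (2 * j))) *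
     (\<Prod>x\<in>X. (1 - \<gamma> * s 0 * x) / (1 - s 0 * x)) *
     HL_set t (s(0 := \<gamma> * s 0)) lam X"

definition S_term :: "complex \<Rightarrow> (nat \<Rightarrow> complex) \<Rightarrow> complex set \<Rightarrow> nat list \<Rightarrow> complex" where
  "S_term t s X lam =
     (\<Prod>i \<in> set lam. \<Prod>j = 1..count_list lam i div 2.
        (1 - (s i)\<^sup>2 * t ^ (2 * j - 2)) / (1 - t ^ (2 * j))) * HL_set t s lam X"

section \<open>The series after removal of the zero parts\<close>

lemma P_summand_eq_P_term:
  assumes "inj_on u {..<length lam}"
  shows "P_summand t \<gamma> s u lam = P_term t \<gamma> s (u ` {..<length lam}) lam"
  unfolding P_summand_def P_term_def spin_HL_eq_HL_set[OF assms] by (simp add: prod.reindex[OF assms])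

lemma qpoch_nonzero:
  assumes "\<And>i. 1 \<le> i \<Longrightarrow> t ^ i \<noteq> 1"
  shows "qpoch t t k \<noteq> 0"
  using assms[of "Suc _"] by (auto simp: qpoch_def)

text \<open>At \<open>\<gamma> = 1\<close> zero parts have the same coefficients as all others, so
  \<open>P_term_has_sum\<close> also splits the series of \<open>S_term\<close>.\<close>

lemma P_term_one:
  assumes t: "\<And>i. 1 \<le> i \<Longrightarrow> t ^ i \<noteq> 1" and s: "\<And>x. x \<in> X \<Longrightarrow> 1 - s 0 * x \<noteq> 0"
  shows "P_term t 1 s X lam = S_term t s X lam"
proof -
  let ?c = "\<lambda>i. \<Prod>j = 1..count_list lam i div 2. (1 - (s i)\<^sup>2 * t ^ (2 * j - 2)) / (1 - t ^ (2 * j))"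
  have "(\<Prod>i\<in>set lam. ?c i) = ?c 0 * (\<Prod>i\<in>set lam - {0}. ?c i)"
  proof (cases "0 \<in> set lam")
    case True
    then show ?thesis
      by (intro prod.remove) auto
  next
    case False
    then have "count_list lam 0 = 0" "set lam - {0} = set lam"
      by (simp_all add: count_list_0_iff)
    then show ?thesis
      by simp
  qed
  moreover have "(\<Prod>x\<in>X. (1 - 1 * s 0 * x) / (1 - s 0 * x)) = 1"
    using s by (intro prod.neutral) simp
  ultimately show ?thesis
    using qpoch_nonzero[OF t] by (simp add: P_term_def S_term_def)
qed

text \<open>The Pochhammer factors with even powers of \<open>t\<close> cancel the denominators;
  those with odd powers remain.\<close>

lemma qpoch_zero_coeff:
  assumes "\<And>j. 1 \<le> j \<Longrightarrow> j \<le> k \<Longrightarrow> 1 - \<gamma> * t ^ (2 * j) \<noteq> 0"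
  shows "qpoch (\<gamma> * t) t (2 * k) * (\<Prod>j = 1..k. (1 - s\<^sup>2 * \<gamma> * t ^ (2 * j - 2)) / (1 - \<gamma> * t ^ (2 * j))) = zero_coeff t \<gamma> s k"
  using assms
proof (induction k)
  case 0
  then show ?case
    by (simp add: qpoch_def zero_coeff_def)
next
  case (Suc k)
  let ?Z = "\<Prod>j = 1..k. (1 - s\<^sup>2 * \<gamma> * t ^ (2 * j - 2)) / (1 - \<gamma> * t ^ (2 * j))"
  let ?d = "1 - \<gamma> * t ^ (2 * Suc k)"
  have d: "?d \<noteq> 0"
    by (rule Suc.prems) auto
  have "qpoch (\<gamma> * t) t (2 * Suc k) = qpoch (\<gamma> * t) t (2 * k) * (1 - \<gamma> * t ^ (2 * k + 1)) * ?d"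
    by (simp add: qpoch_def mult_ac)
  moreover have "(\<Prod>j = 1..Suc k. (1 - s\<^sup>2 * \<gamma> * t ^ (2 * j - 2)) / (1 - \<gamma> * t ^ (2 * j))) =
    ?Z * ((1 - s\<^sup>2 * \<gamma> * t ^ (2 * k)) / ?d)"
    by simp
  moreover have "zero_coeff t \<gamma> s (Suc k) = zero_coeff t \<gamma> s k * ((1 - \<gamma> * t ^ (2 * k + 1)) * (1 - \<gamma> * s\<^sup>2 * t ^ (2 * k)))"
    by (simp add: zero_coeff_def)
  moreover have "qpoch (\<gamma> * t) t (2 * k) * ?Z = zero_coeff t \<gamma> s k"
    using Suc.prems by (intro Suc.IH) auto
  moreover have "A * p * ?d * (Z * (q / ?d)) = A * Z * (p * q)" for A p Z q :: complex
    using d by simp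
  ultimately show ?case
    by (simp only: mult.commute[of "s\<^sup>2" \<gamma>])
qed

lemma P_term_add_zeros:
  assumes t: "\<And>i. 1 \<le> i \<Longrightarrow> t ^ i \<noteq> 1" and X: "finite X" "card X = length mu + 2 * k"
    and \<gamma>: "\<And>j. 1 \<le> j \<Longrightarrow> j \<le> k \<Longrightarrow> 1 - \<gamma> * t ^ (2 * j) \<noteq> 0"
    and \<gamma>s: "\<And>x. x \<in> X \<Longrightarrow> 1 - \<gamma> * s 0 * x \<noteq> 0"
  shows "P_term t \<gamma> s X (add_zeros k mu) = (\<Sum>I | I \<subseteq> X \<and> card I = 2 * k.
    (\<Prod>x\<in>X. 1 / (1 - s 0 * x)) * split_coeff t \<gamma> (s 0) I (X - I) * S_term t (s \<circ> Suc) (X - I) mu)"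
proof -
  let ?lam = "add_zeros k mu"
  let ?s = "s(0 := \<gamma> * s 0)"
  let ?C = "\<Prod>i\<in>set mu. \<Prod>j = 1..count_list mu i div 2. (1 - ((s \<circ> Suc) i)\<^sup>2 * t ^ (2 * j - 2)) / (1 - t ^ (2 * j))"
  let ?Z = "\<Prod>j = 1..k. (1 - (s 0)\<^sup>2 * \<gamma> * t ^ (2 * j - 2)) / (1 - \<gamma> * t ^ (2 * j))"
  let ?W = "\<Prod>x\<in>X. (1 - \<gamma> * s 0 * x) / (1 - s 0 * x)"
  have "(\<Prod>i\<in>set ?lam - {0}. \<Prod>j = 1..count_list ?lam i div 2. (1 - (s i)\<^sup>2 * t ^ (2 * j - 2)) / (1 - t ^ (2 * j))) = ?C"
    unfolding set_add_zeros by (simp add: prod.reindex)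
  moreover have "HL_set t ?s ?lam X = qpoch t t (2 * k) * (\<Sum>I | I \<subseteq> X \<and> card I = 2 * k.
    (\<Prod>x\<in>I. 1 / (1 - \<gamma> * s 0 * x)) * (\<Prod>y\<in>X - I. (y - \<gamma> * s 0) / (1 - \<gamma> * s 0 * y)) *
    (\<Prod>y\<in>X - I. \<Prod>x\<in>I. theta t y x) * HL_set t (s \<circ> Suc) mu (X - I))"
  proof -
    have "?s \<circ> Suc = s \<circ> Suc"
      by auto
    moreover have "t \<noteq> 1"
      using t[of 1] by simp
    ultimately show ?thesis
      unfolding add_zeros_def using HL_set_append_zeros[of t X mu "2 * k" ?s] X by simp
  qed
  ultimately have "P_term t \<gamma> s X ?lam = qpoch (\<gamma> * t) t (2 * k) * ?Z * ?W * ?C * (\<Sum>I | I \<subseteq> X \<and> card I = 2 * k.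
    (\<Prod>x\<in>I. 1 / (1 - \<gamma> * s 0 * x)) * (\<Prod>y\<in>X - I. (y - \<gamma> * s 0) / (1 - \<gamma> * s 0 * y)) *
    (\<Prod>y\<in>X - I. \<Prod>x\<in>I. theta t y x) * HL_set t (s \<circ> Suc) mu (X - I))"
    using qpoch_nonzero[OF t, of "2 * k"] by (simp add: P_term_def)
  also have "qpoch (\<gamma> * t) t (2 * k) * ?Z = zero_coeff t \<gamma> (s 0) k"
    using \<gamma> by (rule qpoch_zero_coeff)
  also have "zero_coeff t \<gamma> (s 0) k * ?W * ?C * (\<Sum>I | I \<subseteq> X \<and> card I = 2 * k.
    (\<Prod>x\<in>I. 1 / (1 - \<gamma> * s 0 * x)) * (\<Prod>y\<in>X - I. (y - \<gamma> * s 0) / (1 - \<gamma> * s 0 * y)) *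
    (\<Prod>y\<in>X - I. \<Prod>x\<in>I. theta t y x) * HL_set t (s \<circ> Suc) mu (X - I)) =
    (\<Sum>I | I \<subseteq> X \<and> card I = 2 * k.
    (\<Prod>x\<in>X. 1 / (1 - s 0 * x)) * split_coeff t \<gamma> (s 0) I (X - I) * S_term t (s \<circ> Suc) (X - I) mu)"
    unfolding sum_distrib_left
  proof (intro sum.cong refl)
    fix I assume "I \<in> {I. I \<subseteq> X \<and> card I = 2 * k}"
    then have I: "I \<subseteq> X" "card I = 2 * k"
      by auto
    have "(\<Prod>x\<in>X. 1 - \<gamma> * s 0 * x) = (\<Prod>x\<in>I. 1 - \<gamma> * s 0 * x) * (\<Prod>x\<in>X - I. 1 - \<gamma> * s 0 * x)"
      using prod.subset_diff[OF I(1) X(1), of "\<lambda>x. 1 - \<gamma> * s 0 * x"] by (simp add: mult.commute)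
    moreover have "(\<Prod>x\<in>I. 1 - \<gamma> * s 0 * x) \<noteq> 0" "(\<Prod>x\<in>X - I. 1 - \<gamma> * s 0 * x) \<noteq> 0"
      using \<gamma>s I X finite_subset[OF I(1) X(1)] by auto
    \<comment> \<open>The prefactor of the summand cancels the denominators
      \<open>1 - \<gamma> s 0 x\<close> of the symmetrised function, over \<open>I\<close> and its
      complement alike.\<close>
    ultimately have W: "?W * ((\<Prod>x\<in>I. 1 / (1 - \<gamma> * s 0 * x)) * (\<Prod>y\<in>X - I. (y - \<gamma> * s 0) / (1 - \<gamma> * s 0 * y))) =
      (\<Prod>x\<in>X. 1 / (1 - s 0 * x)) * (\<Prod>y\<in>X - I. y - \<gamma> * s 0)"
      by (simp add: prod_dividef)
    have S: "split_coeff t \<gamma> (s 0) I (X - I) = zero_coeff t \<gamma> (s 0) k * (\<Prod>y\<in>X - I. y - \<gamma> * s 0) * (\<Prod>y\<in>X - I. \<Prod>x\<in>I. theta t y x)"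
      by (simp add: split_coeff_def I)
    have "zero_coeff t \<gamma> (s 0) k * ?W * ?C * ((\<Prod>x\<in>I. 1 / (1 - \<gamma> * s 0 * x)) * (\<Prod>y\<in>X - I. (y - \<gamma> * s 0) / (1 - \<gamma> * s 0 * y)) *
      (\<Prod>y\<in>X - I. \<Prod>x\<in>I. theta t y x) * HL_set t (s \<circ> Suc) mu (X - I)) =
      zero_coeff t \<gamma> (s 0) k * (?W * ((\<Prod>x\<in>I. 1 / (1 - \<gamma> * s 0 * x)) * (\<Prod>y\<in>X - I. (y - \<gamma> * s 0) / (1 - \<gamma> * s 0 * y)))) *
      (\<Prod>y\<in>X - I. \<Prod>x\<in>I. theta t y x) * (?C * HL_set t (s \<circ> Suc) mu (X - I))"
      by (simp only: mult_ac)
    also have "\<dots> = (\<Prod>x\<in>X. 1 / (1 - s 0 * x)) * split_coeff t \<gamma> (s 0) I (X - I) * S_term t (s \<circ> Suc) (X - I) mu"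
      unfolding W S S_term_def by (simp only: mult_ac)
    finally show "zero_coeff t \<gamma> (s 0) k * ?W * ?C * ((\<Prod>x\<in>I. 1 / (1 - \<gamma> * s 0 * x)) * (\<Prod>y\<in>X - I. (y - \<gamma> * s 0) / (1 - \<gamma> * s 0 * y)) *
      (\<Prod>y\<in>X - I. \<Prod>x\<in>I. theta t y x) * HL_set t (s \<circ> Suc) mu (X - I)) =
      (\<Prod>x\<in>X. 1 / (1 - s 0 * x)) * split_coeff t \<gamma> (s 0) I (X - I) * S_term t (s \<circ> Suc) (X - I) mu" .
  qed
  finally show ?thesis .
qed

lemma has_sum_sum:
  fixes f :: "'a \<Rightarrow> 'b \<Rightarrow> 'c::topological_comm_monoid_add"
  assumes "\<And>i. i \<in> I \<Longrightarrow> (f i has_sum a i) A"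
  shows "((\<lambda>x. \<Sum>i\<in>I. f i x) has_sum (\<Sum>i\<in>I. a i)) A"
  using assms by (induction I rule: infinite_finite_induct) (auto intro: has_sum_add)

text \<open>The sums \<open>A\<close> of the smaller series are kept arbitrary, because in the
  recursion for \<open>\<gamma> = 1\<close> the one belonging to \<open>I = {}\<close> is not yet
  known.\<close>

lemma P_term_has_sum:
  assumes t: "\<And>i. 1 \<le> i \<Longrightarrow> t ^ i \<noteq> 1" and X: "finite X" "card X = 2 * n"
    and \<gamma>: "\<And>j. 1 \<le> j \<Longrightarrow> j \<le> n \<Longrightarrow> 1 - \<gamma> * t ^ (2 * j) \<noteq> 0"
    and \<gamma>s: "\<And>x. x \<in> X \<Longrightarrow> 1 - \<gamma> * s 0 * x \<noteq> 0"
    and A: "\<And>I. I \<subseteq> X \<Longrightarrow> even (card I) \<Longrightarrow> (S_term t (s \<circ> Suc) (X - I) has_sum A (X - I)) (even_signatures (card (X - I)))"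
  shows "(P_term t \<gamma> s X has_sum (\<Prod>x\<in>X. 1 / (1 - s 0 * x)) *
    (\<Sum>I\<in>Pow X. if even (card I) then split_coeff t \<gamma> (s 0) I (X - I) * A (X - I) else 0)) (even_signatures (2 * n))"
proof -
  let ?c = "\<lambda>I. (\<Prod>x\<in>X. 1 / (1 - s 0 * x)) * split_coeff t \<gamma> (s 0) I (X - I)"
  have card: "card (X - I) = 2 * (n - k)" if "I \<subseteq> X" "card I = 2 * k" for I k
    using that X by (simp add: card_Diff_subset finite_subset diff_mult_distrib2)
  have "(P_term t \<gamma> s X has_sum (\<Sum>k\<le>n. \<Sum>I | I \<subseteq> X \<and> card I = 2 * k. ?c I * A (X - I)))
    (\<Union>k\<in>{..n}. add_zeros k ` even_signatures (2 * (n - k)))"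
  proof (rule sum_has_sum)
    fix k assume k: "k \<in> {..n}"
    have "((\<lambda>mu. \<Sum>I | I \<subseteq> X \<and> card I = 2 * k. ?c I * S_term t (s \<circ> Suc) (X - I) mu) has_sum
      (\<Sum>I | I \<subseteq> X \<and> card I = 2 * k. ?c I * A (X - I))) (even_signatures (2 * (n - k)))"
    proof (rule has_sum_sum)
      fix I assume "I \<in> {I. I \<subseteq> X \<and> card I = 2 * k}"
      then show "((\<lambda>mu. ?c I * S_term t (s \<circ> Suc) (X - I) mu) has_sum ?c I * A (X - I)) (even_signatures (2 * (n - k)))"
        using A[of I] card[of I k] by (intro has_sum_cmult_right) auto
    qed
    moreover have "P_term t \<gamma> s X (add_zeros k mu) = (\<Sum>I | I \<subseteq> X \<and> card I = 2 * k. ?c I * S_term t (s \<circ> Suc) (X - I) mu)"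
      if "mu \<in> even_signatures (2 * (n - k))" for mu
    proof (rule P_term_add_zeros[OF t])
      have "length mu = 2 * (n - k)"
        using that by (simp add: even_signatures_def signatures_def)
      then show "card X = length mu + 2 * k"
        using X k by auto
    qed (use X k \<gamma> \<gamma>s in auto)
    ultimately have "((P_term t \<gamma> s X \<circ> add_zeros k) has_sum
      (\<Sum>I | I \<subseteq> X \<and> card I = 2 * k. ?c I * A (X - I))) (even_signatures (2 * (n - k)))"
      by (simp cong: has_sum_cong)
    then show "(P_term t \<gamma> s X has_sum (\<Sum>I | I \<subseteq> X \<and> card I = 2 * k. ?c I * A (X - I)))
      (add_zeros k ` even_signatures (2 * (n - k)))"
      by (subst has_sum_reindex) (auto intro: inj_on_subset[OF inj_add_zeros])
  next
    fix k l :: nat assume "k \<noteq> l"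
    have "k = l" if "add_zeros k mu = add_zeros l nu" for mu nu
      using arg_cong[OF that, of "\<lambda>lam. count_list lam 0"] by simp
    with \<open>k \<noteq> l\<close> show "add_zeros k ` even_signatures (2 * (n - k)) \<inter> add_zeros l ` even_signatures (2 * (n - l)) = {}"
      by auto
  qed simp
  also have "(\<Sum>k\<le>n. \<Sum>I | I \<subseteq> X \<and> card I = 2 * k. ?c I * A (X - I)) =
    (\<Sum>k\<le>n. \<Sum>I | I \<in> {I \<in> Pow X. even (card I)} \<and> card I div 2 = k. ?c I * A (X - I))"
    by (intro sum.cong refl) auto
  also have "\<dots> = (\<Sum>I | I \<in> Pow X \<and> even (card I). ?c I * A (X - I))"
  proof (rule sum.group)
    show "(\<lambda>I. card I div 2) ` {I \<in> Pow X. even (card I)} \<subseteq> {..n}"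
    proof (rule image_subsetI)
      fix I assume "I \<in> {I \<in> Pow X. even (card I)}"
      then have "card I \<le> 2 * n"
        using X card_mono[of X I] by auto
      then show "card I div 2 \<in> {..n}"
        by simp
    qed
  qed (use X in auto)
  also have "\<dots> = (\<Sum>I\<in>Pow X. if even (card I) then ?c I * A (X - I) else 0)"
    using X by (intro sum.inter_filter) simp
  also have "\<dots> = (\<Prod>x\<in>X. 1 / (1 - s 0 * x)) *
    (\<Sum>I\<in>Pow X. if even (card I) then split_coeff t \<gamma> (s 0) I (X - I) * A (X - I) else 0)"
    unfolding sum_distrib_left by (intro sum.cong refl) (simp add: mult.assoc)
  finally show ?thesis
    by (subst even_signatures_eq_UN)
qed

subsection \<open>Convergence and the Littlewood identity\<close>

lemma sum_power_sum_list_le: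
  fixes r :: real
  assumes r: "0 \<le> r" "r < 1"
  shows "(\<Sum>lam | set lam \<subseteq> {..<K} \<and> length lam = N. r ^ sum_list lam) \<le> (1 / (1 - r)) ^ N"
proof (induction N)
  case 0
  have "{lam. set lam \<subseteq> {..<K} \<and> length lam = 0} = {[]}"
    by auto
  then show ?case
    by simp
next
  case (Suc N)
  let ?A = "\<lambda>N. {lam. set lam \<subseteq> {..<K} \<and> length lam = N}"
  have "(\<Sum>lam\<in>?A (Suc N). r ^ sum_list lam) = (\<Sum>(i, lam)\<in>{..<K} \<times> ?A N. r ^ i * r ^ sum_list lam)"
    by (rule sum.reindex_bij_witness[where i = "\<lambda>(i, lam). i # lam" and j = "\<lambda>lam. (hd lam, tl lam)"])
      (auto simp: length_Suc_conv power_add)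
  also have "\<dots> = (\<Sum>i<K. r ^ i) * (\<Sum>lam\<in>?A N. r ^ sum_list lam)"
    by (simp add: sum_product sum.cartesian_product)
  also have "\<dots> \<le> 1 / (1 - r) * (1 / (1 - r)) ^ N"
  proof (intro mult_mono Suc.IH)
    have "(\<Sum>i<K. r ^ i) = (1 - r ^ K) / (1 - r)"
      using r by (simp add: sum_gp_strict)
    also have "\<dots> \<le> 1 / (1 - r)"
      using r by (intro divide_right_mono) auto
    finally show "(\<Sum>i<K. r ^ i) \<le> 1 / (1 - r)" .
  qed (use r in \<open>auto intro!: sum_nonneg\<close>)
  finally show ?case
    by simp
qed

lemma summable_on_power_sum_list:
  fixes r :: real
  assumes r: "0 \<le> r" "r < 1"
  shows "(\<lambda>lam. r ^ sum_list lam) summable_on {lam. length lam = N}"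
proof (rule nonneg_bdd_above_summable_on)
  show "bdd_above (sum (\<lambda>lam. r ^ sum_list lam) ` {F. F \<subseteq> {lam. length lam = N} \<and> finite F})"
  proof (rule bdd_aboveI2)
    fix F :: "nat list set" assume F: "F \<in> {F. F \<subseteq> {lam. length lam = N} \<and> finite F}"
    have "finite (\<Union>lam\<in>F. set lam)"
      using F by auto
    then obtain K where K: "(\<Union>lam\<in>F. set lam) \<subseteq> {..<K}"
      using finite_nat_iff_bounded by blast
    have "(\<Sum>lam\<in>F. r ^ sum_list lam) \<le> (\<Sum>lam | set lam \<subseteq> {..<K} \<and> length lam = N. r ^ sum_list lam)"
      using F K r by (intro sum_mono2 finite_lists_length_eq) auto
    also have "\<dots> \<le> (1 / (1 - r)) ^ N"
      by (rule sum_power_sum_list_le[OF r])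
    finally show "(\<Sum>lam\<in>F. r ^ sum_list lam) \<le> (1 / (1 - r)) ^ N" .
  qed
qed (use r in auto)

text \<open>Nonvanishing is demanded separately because, with \<open>a / 0 = 0\<close>, a zero
  denominator would satisfy the bound for \<open>r \<ge> 0\<close>. Quantifying over all
  \<open>k\<close> makes the notion stable under shifts of \<open>s\<close>.\<close>

definition admissible :: "real \<Rightarrow> complex set \<Rightarrow> (nat \<Rightarrow> complex) \<Rightarrow> bool" where
  "admissible r X s \<longleftrightarrow> (\<forall>x\<in>X. \<forall>k. 1 - s k * x \<noteq> 0 \<and> cmod ((x - s k) / (1 - s k * x)) \<le> r)"

lemma admissible_shift: "admissible r X s \<Longrightarrow> admissible r X (\<lambda>i. s (i + k))"
  by (auto simp: admissible_def)

lemma admissible_subset: "admissible r X s \<Longrightarrow> Y \<subseteq> X \<Longrightarrow> admissible r Y s"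
  by (auto simp: admissible_def)

text \<open>If \<open>x y = 1\<close>, the two ratios in the hypothesis are inverse to each other.\<close>
lemma admissible_mult_neq_1:
  assumes s: "admissible r X s" and r: "r < 1" and xy: "x \<in> X" "y \<in> X"
  shows "x * y \<noteq> 1"
proof
  assume *: "x * y = 1"
  let ?a = "(x - s 0) / (1 - s 0 * x)" and ?b = "(y - s 0) / (1 - s 0 * y)"
  have nz: "1 - s 0 * x \<noteq> 0" "1 - s 0 * y \<noteq> 0" and le: "cmod ?a \<le> r" "cmod ?b \<le> r"
    using s xy by (auto simp: admissible_def)
  have "(x - s 0) * (y - s 0) = (1 - s 0 * x) * (1 - s 0 * y)"
    using * by algebra
  then have "?a * ?b = 1"
    using nz by simp
  then have "cmod ?a * cmod ?b = 1"
    by (metis norm_mult norm_one)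
  moreover have "cmod ?a * cmod ?b \<le> 1 * cmod ?b"
    using le r by (intro mult_right_mono) auto
  ultimately show False
    using le r by linarith
qed

text \<open>The parameters may be unbounded, so the numerators \<open>1 - s\<^sub>k\<^sup>2 t\<^sup>j\<close> have to be compared with the
  denominators \<open>1 - s\<^sub>k x\<close>; \<open>(1 - x\<^sup>2) (1 - s\<^sub>k\<^sup>2) = (1 - s\<^sub>k x)\<^sup>2 - (x - s\<^sub>k)\<^sup>2\<close> makes this possible.\<close>
lemma admissible_denominator_bound:
  assumes X: "finite X" "\<And>x. x \<in> X \<Longrightarrow> x * x \<noteq> 1"
  obtains D where "D > 0"
    and "\<And>s r k x. admissible r X s \<Longrightarrow> r < 1 \<Longrightarrow> x \<in> X \<Longrightarrow> sqrt (1 + cmod (1 - (s k)\<^sup>2)) \<le> D * cmod (1 - s k * x)"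
proof
  \<comment> \<open>The sum of the constants in estimates \<open>1\<close> and \<open>2\<close>
    below, which bound 1 and \<open>|1 - s_k^2|\<close> by multiples of
    \<open>|1 - s_k x|^2\<close>.\<close>
  define M where "M x = (1 + cmod x)\<^sup>2 / (cmod (1 - x * x))\<^sup>2 + 2 / cmod (1 - x * x)" for x
  let ?D = "1 + (\<Sum>x\<in>X. sqrt (M x))"
  have M: "M x \<ge> 0" for x
    by (simp add: M_def)
  then show "?D > 0"
    by (intro add_pos_nonneg sum_nonneg) auto
  fix s :: "nat \<Rightarrow> complex" and r :: real and k :: nat and x :: complex
  assume s: "admissible r X s" and r: "r < 1" and x: "x \<in> X"
  define m \<delta> where "m = cmod (1 - s k * x)" and "\<delta> = cmod (1 - x * x)"
  have nz: "1 - s k * x \<noteq> 0" and le_r: "cmod ((x - s k) / (1 - s k * x)) \<le> r"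
    using s x by (auto simp: admissible_def)
  then have m: "m > 0"
    by (simp add: m_def)
  have "cmod (x - s k) / m \<le> r"
    using le_r by (simp add: m_def norm_divide)
  then have "cmod (x - s k) \<le> r * m"
    using m by (simp add: pos_divide_le_eq)
  also have "\<dots> \<le> 1 * m"
    using m r by (intro mult_right_mono) auto
  finally have le: "cmod (x - s k) \<le> m"
    by simp
  have \<delta>: "\<delta> > 0"
    using X(2)[OF x] by (simp add: \<delta>_def)
  have "1 - x * x = (1 - s k * x) + x * (s k - x)"
    by (simp add: algebra_simps)
  then have "\<delta> \<le> m + cmod x * cmod (x - s k)"
    unfolding \<delta>_def m_def by (metis norm_triangle_ineq norm_mult norm_minus_commute)
  also have "\<dots> \<le> m + cmod x * m"
    using le by (intro add_left_mono mult_left_mono) auto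
  finally have "\<delta> \<le> (1 + cmod x) * m"
    by (simp add: algebra_simps)
  then have "\<delta>\<^sup>2 \<le> ((1 + cmod x) * m)\<^sup>2"
    using \<delta> by (intro power_mono) auto
  then have 1: "1 \<le> (1 + cmod x)\<^sup>2 / \<delta>\<^sup>2 * m\<^sup>2"
    using \<delta> by (simp add: power_mult_distrib divide_simps)
  have "(1 - x * x) * (1 - (s k)\<^sup>2) = (1 - s k * x)\<^sup>2 - (x - s k)\<^sup>2"
    by algebra
  then have "\<delta> * cmod (1 - (s k)\<^sup>2) = cmod ((1 - s k * x)\<^sup>2 - (x - s k)\<^sup>2)"
    unfolding \<delta>_def by (metis norm_mult)
  also have "\<dots> \<le> m\<^sup>2 + (cmod (x - s k))\<^sup>2"
    unfolding m_def norm_power[symmetric] by (rule norm_triangle_ineq4)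
  also have "\<dots> \<le> m\<^sup>2 + m\<^sup>2"
    using le by (intro add_left_mono power_mono) auto
  finally have 2: "cmod (1 - (s k)\<^sup>2) \<le> 2 / \<delta> * m\<^sup>2"
    using \<delta> by (simp add: divide_simps mult.commute)
  have "1 + cmod (1 - (s k)\<^sup>2) \<le> M x * m\<^sup>2"
    using 1 2 by (simp add: M_def \<delta>_def distrib_right)
  then have "sqrt (1 + cmod (1 - (s k)\<^sup>2)) \<le> sqrt (M x) * m"
    using m by (metis real_sqrt_le_iff real_sqrt_mult real_sqrt_abs abs_of_pos)
  also have "\<dots> \<le> ?D * m"
  proof (rule mult_right_mono)
    have "sqrt (M x) \<le> (\<Sum>x\<in>X. sqrt (M x))"
      using X(1) x M by (intro member_le_sum) auto
    then show "sqrt (M x) \<le> ?D"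
      by simp
  qed (use m in simp)
  finally show "sqrt (1 + cmod (1 - (s k)\<^sup>2)) \<le> ?D * cmod (1 - s k * x)"
    by (simp add: m_def)
qed

text \<open>\<open>C\<close> is chosen before \<open>s\<close>, since one bound has to serve all
  shifts of the parameters. Because multiplicities are even, the coefficient can be charged as
  \<open>b k / \<kappa>\<close> to every single part \<open>k\<close>; the weight of that part is at
  most \<open>D r^k / b k\<close>, and the possibly large \<open>b k\<close> cancels.\<close>

lemma S_term_bound:
  fixes t :: real
  assumes t: "0 < t" "t < 1" and X: "finite X" "card X = 2 * n" "\<And>x. x \<in> X \<Longrightarrow> x * x \<noteq> 1" and r: "0 \<le> r" "r < 1"
  obtains C where "\<And>s lam. admissible r X s \<Longrightarrow> lam \<in> even_signatures (2 * n) \<Longrightarrow>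
    cmod (S_term (of_real t) s X lam) \<le> C * r ^ sum_list lam"
proof -
  let ?t = "of_real t :: complex"
  obtain D where D: "D > 0"
    "\<And>s r k x. admissible r X s \<Longrightarrow> r < 1 \<Longrightarrow> x \<in> X \<Longrightarrow> sqrt (1 + cmod (1 - (s k)\<^sup>2)) \<le> D * cmod (1 - s k * x)"
    using admissible_denominator_bound[OF X(1,3)] by blast
  define \<kappa> where "\<kappa> = 1 - t\<^sup>2"
  have \<kappa>: "0 < \<kappa>" "\<kappa> \<le> 1"
    using t by (auto simp: \<kappa>_def power_less_one_iff abs_square_less_1)
  define T where "T = (\<Sum>xs\<in>permutations_of_set X. cmod (pair_prod (theta ?t) xs))"
  have "cmod (S_term ?t s X lam) \<le> T * (D / \<kappa>) ^ (2 * n) * r ^ sum_list lam"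
    if s: "admissible r X s" and lam: "lam \<in> even_signatures (2 * n)" for s lam
  proof -
    define b where "b k = sqrt (1 + cmod (1 - (s k)\<^sup>2))" for k
    have b: "b k \<ge> 1" "(b k)\<^sup>2 = 1 + cmod (1 - (s k)\<^sup>2)" for k
      by (simp_all add: b_def)
    then have b0: "b k > 0" for k
      using less_le_trans[OF zero_less_one] by blast
    have len: "length lam = 2 * n" and ev: "\<And>i. even (count_list lam i)"
      using lam by (auto simp: even_signatures_def signatures_def)
    have factor: "cmod ((1 - (s k)\<^sup>2 * ?t ^ (2 * j - 2)) / (1 - ?t ^ (2 * j))) \<le> (b k / \<kappa>)\<^sup>2" if j: "j \<ge> 1" for j k
    proof -
      define \<tau> where "\<tau> = t ^ (2 * j - 2)"
      have \<tau>: "0 \<le> \<tau>" "\<tau> \<le> 1"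
        using t by (auto simp: \<tau>_def power_le_one)
      have "1 - (s k)\<^sup>2 * of_real \<tau> = of_real (1 - \<tau>) + of_real \<tau> * (1 - (s k)\<^sup>2)"
        by (simp add: algebra_simps)
      then have "cmod (1 - (s k)\<^sup>2 * of_real \<tau>) \<le> cmod (of_real (1 - \<tau>)) + cmod (of_real \<tau> * (1 - (s k)\<^sup>2))"
        by (metis norm_triangle_ineq)
      also have "\<dots> = (1 - \<tau>) + \<tau> * cmod (1 - (s k)\<^sup>2)"
        using \<tau> unfolding norm_mult norm_of_real by simp
      also have "\<dots> \<le> 1 + 1 * cmod (1 - (s k)\<^sup>2)"
        using \<tau> by (intro add_mono mult_right_mono) auto
      finally have num: "cmod (1 - (s k)\<^sup>2 * ?t ^ (2 * j - 2)) \<le> (b k)\<^sup>2"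
        by (simp add: b \<tau>_def)
      have "t ^ (2 * j) \<le> t ^ 2"
        using t j by (intro power_decreasing) auto
      moreover have "cmod (1 - ?t ^ (2 * j)) = 1 - t ^ (2 * j)"
      proof -
        have "1 - ?t ^ (2 * j) = of_real (1 - t ^ (2 * j))"
          by simp
        moreover have "1 - t ^ (2 * j) \<ge> 0"
          using t by (simp add: power_le_one)
        ultimately show ?thesis
          by (simp only: norm_of_real abs_of_nonneg)
      qed
      ultimately have den: "cmod (1 - ?t ^ (2 * j)) \<ge> \<kappa>"
        by (simp add: \<kappa>_def)
      have "cmod ((1 - (s k)\<^sup>2 * ?t ^ (2 * j - 2)) / (1 - ?t ^ (2 * j))) \<le> (b k)\<^sup>2 / \<kappa>"
        unfolding norm_divide using num den \<kappa> by (intro frac_le) auto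
      \<comment> \<open>Weakened to a square: each factor belongs to a pair of equal parts, and the
        share of one part becomes \<open>b k / \<kappa>\<close>.\<close>
      also have "\<dots> \<le> (b k)\<^sup>2 / \<kappa>\<^sup>2"
        using \<kappa> by (intro divide_left_mono) (auto simp: power2_eq_square mult_le_one)
      finally show ?thesis
        by (simp add: power_divide)
    qed
    have "cmod (\<Prod>i \<in> set lam. \<Prod>j = 1..count_list lam i div 2. (1 - (s i)\<^sup>2 * ?t ^ (2 * j - 2)) / (1 - ?t ^ (2 * j)))
      \<le> (\<Prod>i\<in>set lam. \<Prod>j = 1..count_list lam i div 2. (b i / \<kappa>)\<^sup>2)"
      unfolding prod_norm[symmetric] by (intro prod_mono conjI prod_nonneg norm_ge_zero ballI factor) auto
    also have "\<dots> = (\<Prod>i\<in>set lam. (b i / \<kappa>) ^ count_list lam i)"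
    proof (intro prod.cong refl)
      fix i
      have "2 * (count_list lam i div 2) = count_list lam i"
        using ev[of i] by simp
      then show "(\<Prod>j = 1..count_list lam i div 2. (b i / \<kappa>)\<^sup>2) = (b i / \<kappa>) ^ count_list lam i"
        by (simp add: power_mult[symmetric] del: power_divide)
    qed
    also have "\<dots> = (\<Prod>p<2 * n. b (lam ! p) / \<kappa>)"
      unfolding len[symmetric] by (rule prod_nth_eq_prod_count[symmetric])
    finally have coeff: "cmod (\<Prod>i \<in> set lam. \<Prod>j = 1..count_list lam i div 2. (1 - (s i)\<^sup>2 * ?t ^ (2 * j - 2)) / (1 - ?t ^ (2 * j)))
      \<le> (\<Prod>p<2 * n. b (lam ! p) / \<kappa>)" .
    have weight: "cmod (HL_weight ?t s k x) \<le> D / b k * r ^ k" if x: "x \<in> X" for k x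
    proof -
      have "b k \<le> D * cmod (1 - s k * x)"
        unfolding b_def by (rule D(2)[OF s r(2) x])
      moreover have nz: "cmod (1 - s k * x) > 0"
        using s x by (auto simp: admissible_def)
      ultimately have "1 / cmod (1 - s k * x) \<le> D / b k"
        using b0[of k] by (simp add: divide_simps mult.commute)
      moreover have "cmod (1 - ?t) \<le> 1"
      proof -
        have "1 - ?t = of_real (1 - t)"
          by simp
        then show ?thesis
          using t by (simp only: norm_of_real)
      qed
      ultimately have "cmod (1 - ?t) * (1 / cmod (1 - s k * x)) \<le> 1 * (D / b k)"
        using nz by (intro mult_mono) auto
      moreover have "cmod (\<Prod>j<k. (x - s j) / (1 - s j * x)) \<le> r ^ k"
      proof -
        have "cmod (\<Prod>j<k. (x - s j) / (1 - s j * x)) \<le> (\<Prod>j<k. r)"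
          unfolding prod_norm[symmetric] using s x by (intro prod_mono) (auto simp: admissible_def)
        then show ?thesis
          by simp
      qed
      ultimately show ?thesis
        unfolding HL_weight_def norm_mult norm_divide using D(1) b0[of k]
        by (intro mult_mono) auto
    qed
    have "cmod (HL_set ?t s lam X) \<le> (\<Sum>xs\<in>permutations_of_set X. cmod (pair_prod (theta ?t) xs) *
      (\<Prod>p<2 * n. D / b (lam ! p) * r ^ (lam ! p)))"
      unfolding HL_set_def
    proof (rule sum_norm_le)
      fix xs assume xs: "xs \<in> permutations_of_set X"
      then have "length xs = 2 * n"
        using length_finite_permutations_of_set[OF xs] X by simp
      then have "xs ! p \<in> X" if "p < 2 * n" for p
        using nth_mem[of p xs] permutations_of_setD(1)[OF xs] that by simp
      then show "cmod (pair_prod (theta ?t) xs * (\<Prod>p<length lam. HL_weight ?t s (lam ! p) (xs ! p))) \<le>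
        cmod (pair_prod (theta ?t) xs) * (\<Prod>p<2 * n. D / b (lam ! p) * r ^ (lam ! p))"
        unfolding norm_mult prod_norm[symmetric] len
        by (intro mult_left_mono prod_mono conjI weight) auto
    qed
    also have "\<dots> = T * (\<Prod>p<2 * n. D / b (lam ! p) * r ^ (lam ! p))"
      by (simp add: T_def sum_distrib_right)
    finally have HL: "cmod (HL_set ?t s lam X) \<le> T * (\<Prod>p<2 * n. D / b (lam ! p) * r ^ (lam ! p))" .
    have "cmod (S_term ?t s X lam) \<le> (\<Prod>p<2 * n. b (lam ! p) / \<kappa>) * (T * (\<Prod>p<2 * n. D / b (lam ! p) * r ^ (lam ! p)))"
      unfolding S_term_def norm_mult using coeff HL \<kappa> b0
      by (intro mult_mono) (auto intro!: prod_nonneg less_imp_le[OF divide_pos_pos])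
    also have "\<dots> = T * (\<Prod>p<2 * n. (b (lam ! p) / \<kappa>) * (D / b (lam ! p) * r ^ (lam ! p)))"
      by (simp only: prod.distrib mult_ac)
    also have "(\<Prod>p<2 * n. (b (lam ! p) / \<kappa>) * (D / b (lam ! p) * r ^ (lam ! p))) = (\<Prod>p<2 * n. D / \<kappa> * r ^ (lam ! p))"
      using b0 by (intro prod.cong refl) (simp add: less_imp_neq[symmetric])
    also have "\<dots> = (D / \<kappa>) ^ (2 * n) * r ^ sum_list lam"
      unfolding prod.distrib power_sum[symmetric] using len by (simp add: sum_list_sum_nth atLeast0LessThan)
    finally show ?thesis
      by (simp only: mult.assoc)
  qed
  then show thesis
    by (rule that)
qed

section \<open>Independence of the parameters at \<open>\<gamma> = 1\<close>\<close>

lemma of_real_power_neq_1: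
  fixes t :: real
  assumes "0 < t" "t < 1" "1 \<le> i"
  shows "complex_of_real t ^ i \<noteq> 1"
proof -
  have "t ^ i < 1"
    using assms by (simp add: power_less_one_iff)
  then have "complex_of_real (t ^ i) \<noteq> 1"
    by (metis of_real_eq_1_iff less_irrefl)
  then show ?thesis
    by simp
qed

text \<open>Every variable lies on exactly one edge of a matching. With \<open>c = 1\<close> this is
  a congruence rule for weights that agree only on \<open>X\<close>.\<close>

lemma npf_scale:
  assumes "\<And>x y. x \<in> X \<Longrightarrow> y \<in> X \<Longrightarrow> x \<noteq> y \<Longrightarrow> w' x y = c x * c y * w x y"
    and "finite X" "card X = 2 * n"
  shows "npf t w' n X = (\<Prod>x\<in>X. c x) * npf t w n X"
  using assms
proof (induction n arbitrary: X)
  case 0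
  then show ?case
    by simp
next
  case (Suc n)
  have "w' x y * (\<Prod>z\<in>X - {x, y}. phi t x z * phi t y z) * npf t w' n (X - {x, y}) =
    (\<Prod>x\<in>X. c x) * (w x y * (\<Prod>z\<in>X - {x, y}. phi t x z * phi t y z) * npf t w n (X - {x, y}))"
    if xy: "x \<in> X" "y \<in> X - {x}" for x y
  proof -
    have "npf t w' n (X - {x, y}) = (\<Prod>z\<in>X - {x, y}. c z) * npf t w n (X - {x, y})"
      using xy Suc.prems by (intro Suc.IH) auto
    moreover have "(\<Prod>x\<in>X. c x) = c x * c y * (\<Prod>z\<in>X - {x, y}. c z)"
    proof -
      have "(\<Prod>x\<in>X. c x) = c x * (c y * (\<Prod>z\<in>X - {x} - {y}. c z))"
        using xy Suc.prems(2) by (simp add: prod.remove)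
      moreover have "X - {x} - {y} = X - {x, y}"
        by auto
      ultimately show ?thesis
        by (simp add: mult.assoc)
    qed
    moreover have "w' x y = c x * c y * w x y"
      using xy by (intro Suc.prems(1)) auto
    ultimately show ?thesis
      by (simp add: mult_ac)
  qed
  then show ?case
    unfolding npf.simps(2) times_divide_eq_right sum_distrib_left
    by (intro arg_cong2[where f = "(/)"] sum.cong refl)
qed

text \<open>At \<open>\<gamma> = 1\<close> the refined weight factors as
  \<open>(1 - s x) (1 - s y)\<close> times a weight free of \<open>s\<close>.\<close>

lemma littlewood_eq_split_sum:
  assumes t: "t \<noteq> 0" "t \<noteq> 1" and X: "finite X" "even (card X)" "\<And>x y. x \<in> X \<Longrightarrow> y \<in> X \<Longrightarrow> x * y \<noteq> 1"
    and s: "\<And>x. x \<in> X \<Longrightarrow> 1 - s * x \<noteq> 0"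
  shows "littlewood t X = (\<Prod>x\<in>X. 1 / (1 - s * x)) * split_sum t 1 s X"
proof -
  have c: "card X = 2 * (card X div 2)"
    using X(2) by simp
  have "npf t (refined_weight t 1 s) (card X div 2) X = (\<Prod>x\<in>X. 1 - s * x) * littlewood t X"
  proof (rule npf_scale[OF _ X(1) c])
    fix x y assume "x \<in> X" "y \<in> X"
    then have "1 - x * y \<noteq> 0"
      using X(3) by simp
    then have "refined_weight t 1 s x y = ((1 - t) * (x - s) * (y - s) + (1 - t) * (1 - s\<^sup>2) * (1 - x * y)) / (1 - x * y)"
      by (simp add: refined_weight_def add_divide_distrib)
    also have "(1 - t) * (x - s) * (y - s) + (1 - t) * (1 - s\<^sup>2) * (1 - x * y) = (1 - s * x) * (1 - s * y) * (1 - t)"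
      by algebra
    finally show "refined_weight t 1 s x y = (1 - s * x) * (1 - s * y) * littlewood_weight t x y"
      by (simp add: littlewood_weight_def)
  qed
  then have "split_sum t 1 s X = (\<Prod>x\<in>X. 1 - s * x) * littlewood t X"
    using npf_eq_split_sum[OF t _ X(1) c X(3), of 1 s] by simp
  moreover have "(\<Prod>x\<in>X. 1 - s * x) \<noteq> 0"
    using s X(1) by simp
  ultimately show ?thesis
    by (simp add: prod_dividef)
qed

text \<open>Splitting off the zero parts shows that the error of the claimed identity for the parameters
  \<open>s\<close> is the one for the shifted parameters \<open>s \<circ> Suc\<close> multiplied by a factor of modulus at most \<open>r\<close>.\<close>
lemma S_term_has_sum:
  fixes t :: real
  assumes t: "0 < t" "t < 1" and r: "0 \<le> r" "r < 1" and X: "finite X" "card X = 2 * n" and s: "admissible r X s"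
  shows "(S_term (of_real t) s X has_sum littlewood (of_real t) X) (even_signatures (2 * n))"
  using X s
proof (induction n arbitrary: X s rule: less_induct)
  case (less n)
  let ?t = "of_real t :: complex"
  note t_pow = of_real_power_neq_1[OF t]
  have X: "x * y \<noteq> 1" if "x \<in> X" "y \<in> X" for x y
    using admissible_mult_neq_1[OF less.prems(3) r(2) that] .
  show ?case
  proof (cases "n = 0")
    case True
    then have "X = {}"
      using less.prems by simp
    then show ?thesis
      using True by (intro has_sum_finiteI) (auto simp: even_signatures_0 S_term_def HL_set_def)
  next
    case False
    obtain C where C: "\<And>s lam. admissible r X s \<Longrightarrow> lam \<in> even_signatures (2 * n) \<Longrightarrow>
      cmod (S_term ?t s X lam) \<le> C * r ^ sum_list lam"
      using S_term_bound[OF t less.prems(1,2) X r] by blast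
    define B where "B = (\<Sum>\<^sub>\<infinity>lam\<in>even_signatures (2 * n). C * r ^ sum_list lam)"
    have sum_B: "(\<lambda>lam. C * r ^ sum_list lam) summable_on even_signatures (2 * n)"
    proof (rule summable_on_subset_banach)
      show "(\<lambda>lam. C * r ^ sum_list lam) summable_on {lam. length lam = 2 * n}"
        using r by (intro summable_on_cmult_right summable_on_power_sum_list)
    qed (auto simp: even_signatures_def signatures_def)
    have abs: "(\<lambda>lam. cmod (S_term ?t s X lam)) summable_on even_signatures (2 * n)" if "admissible r X s" for s
      by (rule summable_on_comparison_test[OF sum_B]) (erule C[OF that], rule norm_ge_zero)
    define A where "A s = infsum (S_term ?t s X) (even_signatures (2 * n))" for s
    have A_sum: "(S_term ?t s X has_sum A s) (even_signatures (2 * n))" if "admissible r X s" for s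
      unfolding A_def by (rule has_sum_infsum[OF abs_summable_summable[OF abs[OF that]]])
    have A_B: "cmod (A s) \<le> B" if "admissible r X s" for s
    proof -
      have "cmod (A s) \<le> (\<Sum>\<^sub>\<infinity>lam\<in>even_signatures (2 * n). cmod (S_term ?t s X lam))"
        unfolding A_def by (rule norm_infsum_bound[OF abs[OF that]])
      also have "\<dots> \<le> B"
        unfolding B_def using C[OF that] by (intro infsum_mono abs[OF that] sum_B)
      finally show ?thesis .
    qed
    let ?L = "littlewood ?t X"
    have step: "cmod (A s - ?L) \<le> r * cmod (A (s \<circ> Suc) - ?L)" if s: "admissible r X s" for s
    proof -
      have s': "admissible r X (s \<circ> Suc)"
        using admissible_shift[OF s, of 1] by (simp add: comp_def)
      have den: "1 - s 0 * x \<noteq> 0" if "x \<in> X" for x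
        using s that by (auto simp: admissible_def)
      \<comment> \<open>The actual sums of the shifted series: the Littlewood value on proper
        subsets, by induction, and the still unknown sum on \<open>X\<close> itself.\<close>
      define V where "V Z = (if Z = X then A (s \<circ> Suc) else littlewood ?t Z)" for Z
      let ?c = "\<Prod>x\<in>X. 1 / (1 - s 0 * x)"
      let ?f = "\<lambda>W I. if even (card I) then split_coeff ?t 1 (s 0) I (X - I) * W (X - I) else 0"
      have P_sum: "(P_term ?t 1 s X has_sum ?c * (\<Sum>I\<in>Pow X. ?f V I)) (even_signatures (2 * n))"
      proof (rule P_term_has_sum[OF t_pow less.prems(1,2)])
        show "1 - 1 * ?t ^ (2 * j) \<noteq> 0" if "1 \<le> j" for j
          using t_pow[of "2 * j"] that by simp
        fix I assume I: "I \<subseteq> X" "even (card I)"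
        show "(S_term ?t (s \<circ> Suc) (X - I) has_sum V (X - I)) (even_signatures (card (X - I)))"
        proof (cases "I = {}")
          case True
          then show ?thesis
            using A_sum[OF s'] less.prems(2) by (simp add: V_def)
        next
          case False
          then have "X - I \<noteq> X"
            using I by auto
          obtain k where k: "card I = 2 * k"
            using I(2) by (rule evenE)
          moreover have "card I > 0" "card I \<le> 2 * n"
            using False I less.prems finite_subset[OF I(1)] card_mono[OF less.prems(1) I(1)] by (auto simp: card_gt_0_iff)
          moreover have c: "card (X - I) = 2 * (n - k)"
            using I k less.prems by (simp add: card_Diff_subset finite_subset diff_mult_distrib2)
          ultimately have "(S_term ?t (s \<circ> Suc) (X - I) has_sum littlewood ?t (X - I)) (even_signatures (2 * (n - k)))"
            using less.prems(1) admissible_subset[OF s', of "X - I"] by (intro less.IH) (auto simp: comp_def)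
          then show ?thesis
            using \<open>X - I \<noteq> X\<close> by (simp only: c V_def if_False)
        qed
      qed (use den in auto)
      have P_eq: "P_term ?t 1 s X = S_term ?t s X"
        using P_term_one[of ?t X s, OF t_pow den] by blast
      have "A s = ?c * (\<Sum>I\<in>Pow X. ?f V I)"
        unfolding A_def by (rule infsumI[OF P_sum[unfolded P_eq]])
      moreover have "?L = ?c * (\<Sum>I\<in>Pow X. ?f (littlewood ?t) I)"
        using littlewood_eq_split_sum[of ?t X "s 0", OF _ _ less.prems(1) _ X den] t less.prems(2)
        by (simp add: split_sum_def)
      ultimately have "A s - ?L = ?c * (\<Sum>I\<in>Pow X. ?f V I - ?f (littlewood ?t) I)"
        by (simp add: sum_subtractf right_diff_distrib)
      \<comment> \<open>Only for \<open>I = {}\<close> can \<open>V\<close> differ from the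
        Littlewood value.\<close>
      also have "(\<Sum>I\<in>Pow X. ?f V I - ?f (littlewood ?t) I) = (\<Sum>I\<in>{{}}. ?f V I - ?f (littlewood ?t) I)"
        using less.prems(1) by (intro sum.mono_neutral_right) (auto simp: V_def)
      also have "\<dots> = (\<Prod>x\<in>X. x - s 0) * (A (s \<circ> Suc) - ?L)"
        by (simp add: V_def split_coeff_def zero_coeff_def right_diff_distrib)
      finally have "A s - ?L = (\<Prod>x\<in>X. (x - s 0) / (1 - s 0 * x)) * (A (s \<circ> Suc) - ?L)"
        by (simp add: prod_dividef)
      moreover have "cmod (\<Prod>x\<in>X. (x - s 0) / (1 - s 0 * x)) \<le> r"
      proof -
        have "cmod (\<Prod>x\<in>X. (x - s 0) / (1 - s 0 * x)) \<le> (\<Prod>x\<in>X. r)"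
          unfolding prod_norm[symmetric] using s by (intro prod_mono) (auto simp: admissible_def)
        also have "\<dots> \<le> r ^ 1"
          unfolding prod_constant using r False less.prems(2) by (intro power_decreasing) auto
        finally show ?thesis
          by simp
      qed
      ultimately show ?thesis
        by (simp add: norm_mult mult_right_mono)
    qed
    have iter: "cmod (A s - ?L) \<le> r ^ k * cmod (A (\<lambda>i. s (i + k)) - ?L)" if s: "admissible r X s" for s k
    proof (induction k)
      case (Suc k)
      have "cmod (A (\<lambda>i. s (i + k)) - ?L) \<le> r * cmod (A ((\<lambda>i. s (i + k)) \<circ> Suc) - ?L)"
        by (rule step[OF admissible_shift[OF s]])
      then have "r ^ k * cmod (A (\<lambda>i. s (i + k)) - ?L) \<le> r ^ k * (r * cmod (A ((\<lambda>i. s (i + k)) \<circ> Suc) - ?L))"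
        using r by (intro mult_left_mono) auto
      then show ?case
        using Suc by (simp add: comp_def mult_ac)
    qed simp
    have "(\<lambda>k. r ^ k * (B + cmod ?L)) \<longlonglongrightarrow> 0 * (B + cmod ?L)"
      using r by (intro tendsto_mult LIMSEQ_realpow_zero tendsto_const)
    moreover have "cmod (A s - ?L) \<le> r ^ k * (B + cmod ?L)" for k
    proof -
      have "cmod (A (\<lambda>i. s (i + k)) - ?L) \<le> B + cmod ?L"
        using norm_triangle_ineq4[of "A (\<lambda>i. s (i + k))" ?L] A_B[OF admissible_shift[OF less.prems(3), of k]] by linarith
      then have "r ^ k * cmod (A (\<lambda>i. s (i + k)) - ?L) \<le> r ^ k * (B + cmod ?L)"
        using r by (intro mult_left_mono) auto
      then show ?thesis
        using iter[OF less.prems(3), of k] by linarith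
    qed
    ultimately have "cmod (A s - ?L) \<le> 0"
      by (intro LIMSEQ_le_const[of "\<lambda>k. r ^ k * (B + cmod ?L)"]) auto
    then show ?thesis
      using A_sum[OF less.prems(3)] by simp
  qed
qed

theorem theorem3p3:
  fixes t \<epsilon> :: real and \<gamma> :: complex and s u :: "nat \<Rightarrow> complex" and n :: nat
  assumes t: "0 < t" "t < 1"
    and \<gamma>: "\<gamma> \<noteq> 0"
    and n: "n \<ge> 1"
    and \<epsilon>: "\<epsilon> > 0"
    and bound: "\<And>i x. i < 2 * n \<Longrightarrow> cmod ((u i - s x) / (1 - s x * u i)) \<le> 1 - \<epsilon>"
    \<comment> \<open>the denominators occurring in the hypotheses and in the claim do not vanish\<close>
    and den_s: "\<And>i x. i < 2 * n \<Longrightarrow> 1 - s x * u i \<noteq> 0"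
    and den_\<gamma>s: "\<And>i. i < 2 * n \<Longrightarrow> 1 - \<gamma> * s 0 * u i \<noteq> 0"
    and den_\<gamma>: "\<And>j. 1 \<le> j \<Longrightarrow> j \<le> n \<Longrightarrow> 1 - \<gamma> * complex_of_real t ^ (2 * j) \<noteq> 0"
    and den_u: "\<And>i j. i < j \<Longrightarrow> j < 2 * n \<Longrightarrow> u i - u j \<noteq> 0"
    and den_tu: "\<And>i j. i < j \<Longrightarrow> j < 2 * n \<Longrightarrow> 1 - complex_of_real t * u i * u j \<noteq> 0"
  shows "P_summand (complex_of_real t) \<gamma> s u summable_on even_signatures (2 * n) \<and>
    P_fun (2 * n) (complex_of_real t) \<gamma> s u =
      (\<Prod>j<2 * n. 1 / (1 - s 0 * u j)) *
      (\<Prod>j<2 * n. \<Prod>i<j. (1 - complex_of_real t * u i * u j) / (u i - u j)) *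
      pfaffian n (\<lambda>i j. Z2 (complex_of_real t) \<gamma> (s 0) (u i) (u j) * (u i - u j) /
        ((1 - u i * u j) * (1 - complex_of_real t * u i * u j)))"
proof -
  let ?t = "complex_of_real t"
  define X where "X = u ` {..<2 * n}"
  define r where "r = 1 - \<epsilon>"
  have inj: "inj_on u {..<2 * n}"
  proof (rule inj_onI)
    fix i j assume "i \<in> {..<2 * n}" "j \<in> {..<2 * n}" "u i = u j"
    then show "i = j"
      using den_u[of i j] den_u[of j i] by (cases i j rule: linorder_cases) auto
  qed
  have X: "finite X" "card X = 2 * n"
    using inj by (auto simp: X_def card_image)
  \<comment> \<open>\<open>n \<ge> 1\<close> provides the index 0, for which \<open>bound\<close>
    yields \<open>0 \<le> 1 - \<epsilon>\<close>.\<close>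
  have r: "0 \<le> r" "r < 1"
    using order_trans[OF norm_ge_zero bound[of 0 0]] n \<epsilon> by (auto simp: r_def)
  have adm: "admissible r X s"
    using bound den_s by (auto simp: admissible_def X_def r_def)
  have XX: "x * y \<noteq> 1" if "x \<in> X" "y \<in> X" for x y
    using admissible_mult_neq_1[OF adm r(2) that] .
  note t_pow = of_real_power_neq_1[OF t]
  have "(P_term ?t \<gamma> s X has_sum (\<Prod>x\<in>X. 1 / (1 - s 0 * x)) *
    (\<Sum>I\<in>Pow X. if even (card I) then split_coeff ?t \<gamma> (s 0) I (X - I) * littlewood ?t (X - I) else 0)) (even_signatures (2 * n))"
  proof (rule P_term_has_sum[OF t_pow X den_\<gamma>])
    fix I assume I: "I \<subseteq> X" "even (card I)"
    have "card (X - I) + card I = 2 * n"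
      using card_Diff_Pow[of X I] X I(1) by simp
    then have "even (card (X - I))"
      using I(2) by (metis dvd_triv_left even_add)
    then obtain k where k: "card (X - I) = 2 * k"
      by (rule evenE)
    have "admissible r (X - I) (s \<circ> Suc)"
      using admissible_subset[OF admissible_shift[OF adm, of 1], of "X - I"] by (simp add: comp_def)
    then have "(S_term ?t (s \<circ> Suc) (X - I) has_sum littlewood ?t (X - I)) (even_signatures (2 * k))"
      using X by (intro S_term_has_sum[OF t r _ k]) auto
    then show "(S_term ?t (s \<circ> Suc) (X - I) has_sum littlewood ?t (X - I)) (even_signatures (card (X - I)))"
      by (simp only: k)
  qed (use den_\<gamma>s in \<open>auto simp: X_def\<close>)
  then have "(P_term ?t \<gamma> s X has_sum (\<Prod>x\<in>X. 1 / (1 - s 0 * x)) * npf ?t (refined_weight ?t \<gamma> (s 0)) n X) (even_signatures (2 * n))"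
    using npf_eq_split_sum[of ?t \<gamma> X n "s 0", OF _ _ \<gamma> X XX] t by (simp add: split_sum_def)
  moreover have "P_term ?t \<gamma> s X lam = P_summand ?t \<gamma> s u lam" if "lam \<in> even_signatures (2 * n)" for lam
  proof -
    have "length lam = 2 * n"
      using that by (simp add: even_signatures_def signatures_def)
    then show ?thesis
      using P_summand_eq_P_term[of u lam ?t \<gamma> s] inj by (simp add: X_def)
  qed
  ultimately have sum: "(P_summand ?t \<gamma> s u has_sum (\<Prod>x\<in>X. 1 / (1 - s 0 * x)) * npf ?t (refined_weight ?t \<gamma> (s 0)) n X)
    (even_signatures (2 * n))"
    using has_sum_cong[of "even_signatures (2 * n)" "P_term ?t \<gamma> s X" "P_summand ?t \<gamma> s u"] by blast
  have "(\<Prod>j<2 * n. \<Prod>i<j. phi ?t (u i) (u j)) *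
      pfaffian n (\<lambda>i j. Z2 ?t \<gamma> (s 0) (u i) (u j) * (u i - u j) / ((1 - u i * u j) * (1 - ?t * u i * u j))) =
    npf ?t (\<lambda>x y. Z2 ?t \<gamma> (s 0) x y / (1 - x * y)) n (u ` {..<2 * n})"
  proof (rule prod_phi_pfaffian[OF inj])
    fix i j assume ij: "i < 2 * n" "j < 2 * n" "i \<noteq> j"
    have "u i - u j \<noteq> 0"
      using inj_onD[OF inj, of i j] ij by auto
    moreover have "1 - ?t * u i * u j \<noteq> 0"
      using ij den_tu[of i j] den_tu[of j i] by (cases i j rule: linorder_cases) (auto simp: mult_ac)
    ultimately show "phi ?t (u i) (u j) \<noteq> 0"
      by (simp add: phi_def)
  qed (auto simp: Z2_def phi_def mult_ac)
  \<comment> \<open>Scaling by 1: the two forms of the weight are identified only on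
    \<open>X\<close>, where \<open>x y \<noteq> 1\<close>.\<close>
  also have "\<dots> = (\<Prod>x\<in>X. 1) * npf ?t (refined_weight ?t \<gamma> (s 0)) n X"
    unfolding X_def[symmetric]
  proof (rule npf_scale[OF _ X])
    fix x y assume "x \<in> X" "y \<in> X"
    then have nz: "1 - x * y \<noteq> 0"
      using XX by simp
    have "Z2 ?t \<gamma> (s 0) x y = (1 - ?t) * (x - \<gamma> * s 0) * (y - \<gamma> * s 0) + (1 - \<gamma> * ?t) * (1 - \<gamma> * (s 0)\<^sup>2) * (1 - x * y)"
      unfolding Z2_def by algebra
    then show "Z2 ?t \<gamma> (s 0) x y / (1 - x * y) = 1 * 1 * refined_weight ?t \<gamma> (s 0) x y"
      using nz by (simp add: refined_weight_def add_divide_distrib)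
  qed
  finally have pf: "npf ?t (refined_weight ?t \<gamma> (s 0)) n X = (\<Prod>j<2 * n. \<Prod>i<j. (1 - ?t * u i * u j) / (u i - u j)) *
      pfaffian n (\<lambda>i j. Z2 ?t \<gamma> (s 0) (u i) (u j) * (u i - u j) / ((1 - u i * u j) * (1 - ?t * u i * u j)))"
    by (simp add: phi_def)
  have "(\<Prod>x\<in>X. 1 / (1 - s 0 * x)) = (\<Prod>j<2 * n. 1 / (1 - s 0 * u j))"
    unfolding X_def using inj by (simp add: prod.reindex)
  with sum show ?thesis
    unfolding pf P_fun_def by (auto simp: has_sum_iff mult.assoc)
qed

end
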